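(* Let $\ell\ge3$ and let $R=R(C_\ell,S_1,S_2)$ be a reduced extended affine root system of type $X=C_\ell$, nullity $\nu$ and twist number $t$. Then $R$ is a minimal extended affine root system if one of the following conditions holds: (a) $\mathrm{ind}(S_2)-(\nu-t)\le3$; (b) $\nu-t\le3$ and $\mathrm{ind}(S_2)\neq7$. In particular, if $\nu-t\le3$, then $R$ is minimal if and only if $\mathrm{ind}(S_2)\ne7$.
   Context: A semilattice in a finite-dimensional real vector space $U$ is a discrete spanning subset $S\subseteq U$ with $0\in S$ and $S=S\pm2S$; $\langle S\rangle$ is its $\mathbb Z$-span, and $S$ is a lattice if $S=\langle S\rangle$. If $\sigma_1,\dots,\sigma_n\in S$ form a $\mathbb Z$-basis of $\langle S\rangle$ (such elements exist), $\mathrm{supp}(S)=\{J\subseteq\{1,\dots,n\}:\sum_{r\in J}\sigma_r\in S\}$ and $\mathrm{ind}(S)=|\mathrm{supp}(S)|-1$ (equivalently, $\mathrm{ind}(S)+1$ is the number of cosets of $2\langle S\rangle$ contained in $S$). A reduced extended affine root system of type $C_\ell$ ($\ell\ge3$), nullity $\nu$ and twist number $t$ is described as follows: $\mathcal V=\dot{\mathcal V}\oplus\mathcal V^0$ is a real vector space with a positive semidefinite symmetric bilinear form with radical $\mathcal V^0=\mathcal V_1^0\oplus\mathcal V_2^0$, $\dim\mathcal V^0_1=t$, $\dim\mathcal V^0_2=\nu-t$; $\dot R=\{0\}\cup\dot R_{sh}\cup\dot R_{lg}$ is a finite root system of type $C_\ell$ spanning $\dot{\mathcal V}$ (short and long roots);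 $S_1$ is a lattice in $\mathcal V_1^0$ and $S_2$ is a semilattice in $\mathcal V_2^0$; with $S=S_1\oplus\langle S_2\rangle$, $R=R(C_\ell,S_1,S_2)=(S+S)\cup(\dot R_{sh}+S_1\oplus\langle S_2\rangle)\cup(\dot R_{lg}+2\langle S_1\rangle\oplus S_2)$. $R^\times=\{\alpha\in R:(\alpha,\alpha)\neq0\}$, $\alpha^\vee=2\alpha/(\alpha,\alpha)$. Let $\tilde{\mathcal V}=\mathcal V\oplus(\mathcal V^0)^*$ with the form extended by $(\dot\beta_1+\delta_1+\lambda_1,\dot\beta_2+\delta_2+\lambda_2)=(\dot\beta_1,\dot\beta_2)+\lambda_1(\delta_2)+\lambda_2(\delta_1)$ for $\dot\beta_i\in\dot{\mathcal V}$, $\delta_i\in\mathcal V^0$, $\lambda_i\in(\mathcal V^0)^*$. The Weyl group $\mathcal W$ is the subgroup of $GL(\tilde{\mathcal V})$ generated by $w_\alpha(u)=u-(u,\alpha^\vee)\alpha$, $\alpha\in R^\times$. $R$ is minimal if there is no $\alpha\in R^\times$ such that the reflections $w_\beta$, $\beta\in R^\times\setminus\mathcal W\alpha$, generate $\mathcal W$. *)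

theory Defs
  imports "HOL-Analysis.Analysis" "HOL-Algebra.Bij" "HOL-Algebra.Generated_Groups"
begin

definition zspan :: "'a::real_vector set \<Rightarrow> 'a set" where
  "zspan S = {\<Sum>x\<in>T. of_int (c x) *\<^sub>R x |T c. finite T \<and> T \<subseteq> S}"

text \<open>Finite-dimensional spaces are subspaces \<open>U\<close> of a Euclidean space, so that
  zero-dimensional ones are included. The first two equations together say \<open>S = S \<plusminus> 2S\<close>.\<close>

definition semilattice_in :: "'a::euclidean_space set \<Rightarrow> 'a set \<Rightarrow> bool" where
  "semilattice_in U S \<longleftrightarrow>
     S = {x + 2 *\<^sub>R y |x y. x \<in> S \<and> y \<in> S} \<and>
     S = {x - 2 *\<^sub>R y |x y. x \<in> S \<and> y \<in> S} \<and>
     0 \<in> S \<and> discrete S \<and> span S = U"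

definition lattice_in :: "'a::euclidean_space set \<Rightarrow> 'a set \<Rightarrow> bool" where
  "lattice_in U S \<longleftrightarrow> semilattice_in U S \<and> S = zspan S"

definition zbasis_in :: "'a::real_vector set \<Rightarrow> nat \<Rightarrow> (nat \<Rightarrow> 'a) \<Rightarrow> bool" where
  "zbasis_in S n \<sigma> \<longleftrightarrow>
     (\<forall>r\<in>{1..n}. \<sigma> r \<in> S) \<and>
     (\<forall>c :: nat \<Rightarrow> int. (\<Sum>r=1..n. of_int (c r) *\<^sub>R \<sigma> r) = 0 \<longrightarrow> (\<forall>r\<in>{1..n}. c r = 0)) \<and>
     zspan (\<sigma> ` {1..n}) = zspan S"

definition supp :: "'a::real_vector set \<Rightarrow> nat \<Rightarrow> (nat \<Rightarrow> 'a) \<Rightarrow> nat set set" where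
  "supp S n \<sigma> = {J. J \<subseteq> {1..n} \<and> (\<Sum>r\<in>J. \<sigma> r) \<in> S}"

text \<open>Every semilattice contains a \<open>\<int>\<close>-basis of its \<open>\<int>\<close>-span, and the number below does not
  depend on the one that is chosen. The support contains \<open>{}\<close>, so nothing is truncated.\<close>

definition ind :: "'a::real_vector set \<Rightarrow> nat" where
  "ind S = (case (SOME (n, \<sigma>). zbasis_in S n \<sigma>) of (n, \<sigma>) \<Rightarrow> card (supp S n \<sigma>) - 1)"

definition coroot :: "('a::real_vector \<Rightarrow> 'a \<Rightarrow> real) \<Rightarrow> 'a \<Rightarrow> 'a" where
  "coroot B \<alpha> = (2 / B \<alpha> \<alpha>) *\<^sub>R \<alpha>"

definition reflection :: "('a::real_vector \<Rightarrow> 'a \<Rightarrow> real) \<Rightarrow> 'a \<Rightarrow> 'a \<Rightarrow> 'a" where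
  "reflection B \<alpha> u = u - B u (coroot B \<alpha>) *\<^sub>R \<alpha>"

text \<open>Reduced finite root systems in \<open>U\<close>, with \<open>0\<close> counted as a root, relative to the
  restriction of \<open>B\<close> to \<open>U\<close>.\<close>

definition finite_root_system ::
    "('a::real_vector \<Rightarrow> 'a \<Rightarrow> real) \<Rightarrow> 'a set \<Rightarrow> 'a set \<Rightarrow> bool" where
  "finite_root_system B U R \<longleftrightarrow>
     finite R \<and> 0 \<in> R \<and> span R = U \<and> (\<forall>u\<in>U - {0}. 0 < B u u) \<and>
     (\<forall>\<alpha>\<in>R - {0}. reflection B \<alpha> ` R \<subseteq> R) \<and>
     (\<forall>\<alpha>\<in>R - {0}. \<forall>\<beta>\<in>R. B \<beta> (coroot B \<alpha>) \<in> \<int>) \<and>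
     (\<forall>\<alpha>\<in>R - {0}. \<forall>c. c *\<^sub>R \<alpha> \<in> R \<longrightarrow> c \<in> {-1, 0, 1})"

text \<open>Type \<open>C\<^sub>\<ell>\<close>: linearly isomorphic to the standard root system
  \<open>{0} \<union> {\<plusminus>\<epsilon>\<^sub>i \<plusminus> \<epsilon>\<^sub>j | i \<noteq> j} \<union> {\<plusminus>2\<epsilon>\<^sub>i}\<close> of \<open>\<real>\<^sup>\<ell>\<close>. The isomorphism is given by the images \<open>e i\<close>
  of the \<open>\<epsilon>\<^sub>i\<close>; that these are orthogonal and of equal length for \<open>B\<close> is a consequence.\<close>

definition finite_root_system_C ::
    "nat \<Rightarrow> ('a::real_vector \<Rightarrow> 'a \<Rightarrow> real) \<Rightarrow> 'a set \<Rightarrow> 'a set \<Rightarrow> bool" where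
  "finite_root_system_C l B U R \<longleftrightarrow>
     finite_root_system B U R \<and>
     (\<exists>e :: nat \<Rightarrow> 'a.
        inj_on e {1..l} \<and> independent (e ` {1..l}) \<and> span (e ` {1..l}) = U \<and>
        R = {0} \<union>
            {s *\<^sub>R e i + s' *\<^sub>R e j |s s' i j.
               s \<in> {-1, 1} \<and> s' \<in> {-1, 1} \<and> i \<in> {1..l} \<and> j \<in> {1..l} \<and> i \<noteq> j} \<union>
            {(2 * s) *\<^sub>R e i |s i. s \<in> {-1, 1} \<and> i \<in> {1..l}})"

definition short_roots :: "('a::real_vector \<Rightarrow> 'a \<Rightarrow> real) \<Rightarrow> 'a set \<Rightarrow> 'a set" where
  "short_roots B R = {\<alpha>\<in>R - {0}. \<forall>\<beta>\<in>R - {0}. B \<alpha> \<alpha> \<le> B \<beta> \<beta>}"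

definition long_roots :: "('a::real_vector \<Rightarrow> 'a \<Rightarrow> real) \<Rightarrow> 'a set \<Rightarrow> 'a set" where
  "long_roots B R = {\<alpha>\<in>R - {0}. \<forall>\<beta>\<in>R - {0}. B \<beta> \<beta> \<le> B \<alpha> \<alpha>}"

text \<open>Below, \<open>+\<close> on sets is the elementwise sum.\<close>

definition ears_C ::
    "('v::real_vector \<Rightarrow> 'v \<Rightarrow> real) \<Rightarrow> 'v set \<Rightarrow> 'v set \<Rightarrow> 'v set \<Rightarrow> 'v set" where
  "ears_C B Rdot S1 S2 =
     (let S = S1 + zspan S2 in
        (S + S) \<union>
        (short_roots B Rdot + (S1 + zspan S2)) \<union>
        (long_roots B Rdot + ((\<lambda>x. 2 *\<^sub>R x) ` zspan S1 + S2)))"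

definition nonisotropic :: "('v \<Rightarrow> 'v \<Rightarrow> real) \<Rightarrow> 'v set \<Rightarrow> 'v set" where
  "nonisotropic B R = {\<alpha>\<in>R. B \<alpha> \<alpha> \<noteq> 0}"

text \<open>Let \<open>V = Vdot \<oplus> V0\<close> be the whole type, with \<open>V0\<close> the radical of \<open>B\<close>. The dual of \<open>V0\<close> is
  represented by the linear functionals on \<open>V\<close> that vanish on \<open>Vdot\<close> (extension by zero); all
  linear functionals are bounded here. For \<open>(x, f)\<close> and \<open>(y, g)\<close> in \<open>hyp_space Vdot\<close>, the number
  \<open>f y\<close> is therefore \<open>f\<close> applied to the \<open>V0\<close>-component of \<open>y\<close>, and \<open>B x y\<close> only depends on
  the \<open>Vdot\<close>-components of \<open>x\<close> and \<open>y\<close>.\<close>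

definition hyp_space :: "'v::euclidean_space set \<Rightarrow> ('v \<times> ('v \<Rightarrow>\<^sub>L real)) set" where
  "hyp_space Vdot = {(x, f). \<forall>y\<in>Vdot. blinfun_apply f y = 0}"

definition hyp_form :: "('v::euclidean_space \<Rightarrow> 'v \<Rightarrow> real) \<Rightarrow>
    'v \<times> ('v \<Rightarrow>\<^sub>L real) \<Rightarrow> 'v \<times> ('v \<Rightarrow>\<^sub>L real) \<Rightarrow> real" where
  "hyp_form B = (\<lambda>(x, f) (y, g). B x y + blinfun_apply f y + blinfun_apply g x)"

definition GL :: "'a::real_vector set \<Rightarrow> ('a \<Rightarrow> 'a) monoid" where
  "GL X = BijGroup X
     \<lparr>carrier := {g \<in> Bij X. (\<forall>x\<in>X. \<forall>y\<in>X. g (x + y) = g x + g y) \<and>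
                             (\<forall>c. \<forall>x\<in>X. g (c *\<^sub>R x) = c *\<^sub>R g x)}\<rparr>"

definition reflection_group ::
    "('v::euclidean_space \<Rightarrow> 'v \<Rightarrow> real) \<Rightarrow> 'v set \<Rightarrow> 'v set \<Rightarrow>
     ('v \<times> ('v \<Rightarrow>\<^sub>L real) \<Rightarrow> 'v \<times> ('v \<Rightarrow>\<^sub>L real)) set" where
  "reflection_group B Vdot A =
     generate (GL (hyp_space Vdot))
       ((\<lambda>\<alpha>. restrict (reflection (hyp_form B) (\<alpha>, 0)) (hyp_space Vdot)) ` A)"

definition weyl_group ::
    "('v::euclidean_space \<Rightarrow> 'v \<Rightarrow> real) \<Rightarrow> 'v set \<Rightarrow> 'v set \<Rightarrow>
     ('v \<times> ('v \<Rightarrow>\<^sub>L real) \<Rightarrow> 'v \<times> ('v \<Rightarrow>\<^sub>L real)) set" where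
  "weyl_group B Vdot R = reflection_group B Vdot (nonisotropic B R)"

definition weyl_orbit ::
    "('v::euclidean_space \<Rightarrow> 'v \<Rightarrow> real) \<Rightarrow> 'v set \<Rightarrow> 'v set \<Rightarrow> 'v \<Rightarrow> 'v set" where
  "weyl_orbit B Vdot R \<alpha> = {\<beta>. \<exists>w\<in>weyl_group B Vdot R. w (\<alpha>, 0) = (\<beta>, 0)}"

definition minimal_ears ::
    "('v::euclidean_space \<Rightarrow> 'v \<Rightarrow> real) \<Rightarrow> 'v set \<Rightarrow> 'v set \<Rightarrow> bool" where
  "minimal_ears B Vdot R \<longleftrightarrow>
     \<not> (\<exists>\<alpha>\<in>nonisotropic B R.
          reflection_group B Vdot (nonisotropic B R - weyl_orbit B Vdot R \<alpha>)
            = weyl_group B Vdot R)"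

end

theory Submission
  imports Defs
begin

text \<open>
  Write \<open>L = S\<^sub>1 \<oplus> \<langle>S\<^sub>2\<rangle>\<close> and \<open>n = \<nu> - t = dim V\<^sub>2\<close>. The roots that are not isotropic are the short ones
  \<open>\<plusminus>\<epsilon>\<^sub>i \<plusminus> \<epsilon>\<^sub>j + \<tau>\<close> with \<open>\<tau> \<in> L\<close> and the long ones \<open>\<plusminus>2\<epsilon>\<^sub>i + \<delta>\<close> with \<open>\<delta> \<in> D = 2S\<^sub>1 \<oplus> S\<^sub>2\<close>.
  As \<open>l \<ge> 3\<close>, the short roots form a single orbit of the Weyl group \<open>W\<close>, while two long roots are
  conjugate if and only if their isotropic parts \<open>\<delta>\<close> agree modulo \<open>2L\<close>; so the orbits of long roots
  correspond to the elements of \<open>supp(S\<^sub>2)\<close>, read as points of the space \<open>F\<^sub>2\<^sup>n\<close> over the field with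
  two elements. The short orbit cannot be omitted, because long reflections only change the signs
  of the \<open>\<epsilon>\<^sub>i\<close> modulo the radical.

  To decide when a long orbit can be omitted, divide \<open>W\<close> by the normal subgroup that the short
  reflections generate. The quotient is an elementary abelian 2-group, generated by one involution
  \<open>r\<^sub>J\<close> for every \<open>J \<in> supp(S\<^sub>2)\<close>, and \<open>R\<close> is minimal if and only if the \<open>r\<^sub>J\<close> are linearly independent.
  The matrix coefficients of \<open>w\<close> between functionals dual to the basis \<open>\<sigma>\<close>, together with the parity
  of the number of sign changes, are homomorphisms modulo 2 that send \<open>r\<^sub>J\<close> to the values at \<open>J\<close> of
  the polynomials \<open>x\<^sub>i x\<^sub>j\<close> and \<open>1\<close>. So a relation between the \<open>r\<^sub>J\<close> gives a nonempty set \<open>T\<close> of even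
  cardinality such that each pair \<open>i, j\<close>, also with \<open>i = j\<close>, lies in an even number of members of \<open>T\<close>
  (lemma \<open>long_reflection_dependency\<close>).

  If \<open>ind(S\<^sub>2) - n \<le> 3\<close>, then beyond the empty set and the singletons, which always belong to it,
  \<open>supp(S\<^sub>2)\<close> has at most three members, and an elementary count excludes such a \<open>T\<close>
  (lemma \<open>no_even_family_with_few_large_sets\<close>). For \<open>n \<le> 3\<close> the estimate \<open>ind(S\<^sub>2) \<le> 2\<^sup>n - 1\<close> gives
  this inequality unless \<open>ind(S\<^sub>2) = 7\<close>. In that case \<open>n = 3\<close> and \<open>supp(S\<^sub>2)\<close> is the full power
  set, which is a relation of the kind above; it does hold in \<open>W\<close>, as an exact
  identity between eight long reflections (lemma \<open>eightfold_relation\<close>), so an orbit can be omitted.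

  The number \<open>ind(S\<^sub>2)\<close> refers to a \<open>\<int>\<close>-basis contained in \<open>S\<^sub>2\<close>. Its existence follows from that of
  bases of discrete subgroups (lemma \<open>discrete_group_has_basis\<close>) and an exchange argument modulo 2
  (lemma \<open>semilattice_basis_set\<close>).
\<close>

section \<open>Discrete subgroups of Euclidean spaces\<close>

definition additive_group :: "'a::real_vector set \<Rightarrow> bool" where
  "additive_group G \<longleftrightarrow> 0 \<in> G \<and> (\<forall>x\<in>G. \<forall>y\<in>G. x - y \<in> G)"

lemma additive_groupI:
  "0 \<in> G \<Longrightarrow> (\<And>x y. x \<in> G \<Longrightarrow> y \<in> G \<Longrightarrow> x - y \<in> G) \<Longrightarrow> additive_group G"
  by (auto simp: additive_group_def)

lemma additive_group_0: "additive_group G \<Longrightarrow> 0 \<in> G"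
  by (auto simp: additive_group_def)

lemma additive_group_diff: "additive_group G \<Longrightarrow> x \<in> G \<Longrightarrow> y \<in> G \<Longrightarrow> x - y \<in> G"
  by (auto simp: additive_group_def)

lemma additive_group_minus: "additive_group G \<Longrightarrow> x \<in> G \<Longrightarrow> - x \<in> G"
  using additive_group_diff[of G 0 x] by (auto simp: additive_group_def)

lemma additive_group_add: "additive_group G \<Longrightarrow> x \<in> G \<Longrightarrow> y \<in> G \<Longrightarrow> x + y \<in> G"
  using additive_group_diff[of G x "- y"] by (auto simp: additive_group_minus)

lemma additive_group_scale:
  assumes "additive_group G" "x \<in> G" shows "of_int k *\<^sub>R x \<in> G"
proof -
  have nat: "of_nat m *\<^sub>R x \<in> G" for m
    by (induction m) (auto simp: assms additive_group_0 additive_group_add scaleR_add_left)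
  show ?thesis
  proof (cases "k \<ge> 0")
    case True
    then show ?thesis using nat[of "nat k"] by (simp add: of_nat_nat)
  next
    case False
    then have "of_int k *\<^sub>R x = - (of_nat (nat (- k)) *\<^sub>R x)"
      by (simp add: of_nat_nat)
    then show ?thesis using nat additive_group_minus[OF assms(1)] by metis
  qed
qed

lemma additive_group_sum:
  "additive_group G \<Longrightarrow> (\<And>x. x \<in> A \<Longrightarrow> f x \<in> G) \<Longrightarrow> sum f A \<in> G"
  by (induction A rule: infinite_finite_induct) (auto simp: additive_group_0 additive_group_add)

lemma zspan_superset: "S \<subseteq> zspan S"
proof
  fix x assume "x \<in> S"
  then show "x \<in> zspan S" unfolding zspan_def
    by (intro CollectI exI[of _ "{x}"] exI[of _ "\<lambda>_. 1"]) auto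
qed

lemma zspan_minimal:
  assumes "S \<subseteq> G" "additive_group G" shows "zspan S \<subseteq> G"
  using assms by (auto simp: zspan_def intro!: additive_group_sum additive_group_scale)

lemma additive_group_zspan: "additive_group (zspan S)"
proof (rule additive_groupI)
  show "0 \<in> zspan S" unfolding zspan_def by (intro CollectI exI[of _ "{}"]) auto
next
  fix x y assume "x \<in> zspan S" "y \<in> zspan S"
  then obtain T c T' c' where x: "x = (\<Sum>x\<in>T. of_int (c x) *\<^sub>R x)" "finite T" "T \<subseteq> S"
    and y: "y = (\<Sum>x\<in>T'. of_int (c' x) *\<^sub>R x)" "finite T'" "T' \<subseteq> S"
    unfolding zspan_def by blast
  define a where "a z = (if z \<in> T then c z else 0)" for z
  define b where "b z = (if z \<in> T' then c' z else 0)" for z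
  have "x = (\<Sum>x\<in>T \<union> T'. of_int (a x) *\<^sub>R x)"
    unfolding x(1) by (rule sum.mono_neutral_cong_left) (use x y in \<open>auto simp: a_def\<close>)
  moreover have "y = (\<Sum>x\<in>T \<union> T'. of_int (b x) *\<^sub>R x)"
    unfolding y(1) by (rule sum.mono_neutral_cong_left) (use x y in \<open>auto simp: b_def\<close>)
  ultimately have "x - y = (\<Sum>x\<in>T \<union> T'. of_int ((\<lambda>z. a z - b z) x) *\<^sub>R x)"
    by (simp add: sum_subtractf scaleR_diff_left)
  then show "x - y \<in> zspan S"
    using x y unfolding zspan_def
    by (intro CollectI exI[of _ "T \<union> T'"] exI[of _ "\<lambda>z. a z - b z"]) auto
qed

lemma zspan_subset_span: "zspan S \<subseteq> span S"
  by (rule zspan_minimal) (auto simp: additive_group_def span_base span_diff span_zero)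

lemma zspan_mono: "S \<subseteq> T \<Longrightarrow> zspan S \<subseteq> zspan T"
  using zspan_superset by (intro zspan_minimal additive_group_zspan) blast

lemma zspan_eqI: "S \<subseteq> zspan T \<Longrightarrow> T \<subseteq> zspan S \<Longrightarrow> zspan S = zspan T"
  by (intro equalityI zspan_minimal additive_group_zspan)

lemma zspan_coordinates:
  assumes "finite I" "x \<in> zspan (\<sigma> ` I)"
  obtains c :: "_ \<Rightarrow> int" where "x = (\<Sum>r\<in>I. of_int (c r) *\<^sub>R \<sigma> r)"
proof -
  let ?G = "{\<Sum>r\<in>I. of_int (c r) *\<^sub>R \<sigma> r | c :: _ \<Rightarrow> int. True}"
  have "additive_group ?G"
  proof (rule additive_groupI)
    show "0 \<in> ?G" by (intro CollectI exI[of _ "\<lambda>_. 0"]) auto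
  next
    fix x y assume "x \<in> ?G" "y \<in> ?G"
    then obtain c d :: "_ \<Rightarrow> int" where "x = (\<Sum>r\<in>I. of_int (c r) *\<^sub>R \<sigma> r)" "y = (\<Sum>r\<in>I. of_int (d r) *\<^sub>R \<sigma> r)"
      by blast
    then have "x - y = (\<Sum>r\<in>I. of_int (c r - d r) *\<^sub>R \<sigma> r)"
      by (simp add: sum_subtractf scaleR_diff_left)
    then show "x - y \<in> ?G" by (intro CollectI exI[of _ "\<lambda>r. c r - d r"]) auto
  qed
  moreover have "\<sigma> ` I \<subseteq> ?G"
  proof (rule image_subsetI)
    fix r assume "r \<in> I"
    then have "\<sigma> r = (\<Sum>q\<in>I. of_int (if q = r then 1 else 0) *\<^sub>R \<sigma> q)"
      using assms(1) by (simp add: if_distrib if_distribR sum.delta cong: if_cong)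
    then show "\<sigma> r \<in> ?G" by (intro CollectI exI[of _ "\<lambda>q. if q = r then 1 else 0"]) auto
  qed
  ultimately show ?thesis using zspan_minimal[of "\<sigma> ` I" ?G] assms(2) that by blast
qed

lemma independent_coefficients_unique:
  assumes "independent B" "finite B"
    "(\<Sum>b\<in>B. f b *\<^sub>R b) = (\<Sum>b\<in>B. g b *\<^sub>R b)" "b \<in> B"
  shows "f b = g b"
proof -
  have "(\<Sum>b\<in>B. (f b - g b) *\<^sub>R b) = 0"
    using assms(3) by (simp add: sum_subtractf scaleR_diff_left)
  from independentD[OF assms(1,2) order_refl this assms(4)] show ?thesis by simp
qed

text \<open>Induction on the dimension of the span. To add a direction \<open>c\<close>, consider the coefficients of \<open>c\<close>
  in the elements of \<open>G\<close>. Reduction modulo the basis that is already known moves the elements with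
  coefficient in \<open>]0, 1]\<close> into a bounded region, which meets \<open>G\<close> in a finite set. An element with the
  smallest positive coefficient completes the basis, by division with remainder.\<close>

lemma discrete_group_basis_of_span:
  fixes G :: "'a::euclidean_space set"
  assumes G: "additive_group G" and "\<epsilon> > 0" and sep: "\<And>x. x \<in> G \<Longrightarrow> norm x < \<epsilon> \<Longrightarrow> x = 0"
    and "finite C" "independent C" "C \<subseteq> G"
  shows "\<exists>B. finite B \<and> independent B \<and> B \<subseteq> G \<and> span B = span C \<and> G \<inter> span C = zspan B"
  using assms(4-6)
proof (induction C rule: finite_induct)
  case empty
  have "zspan {} \<subseteq> {0::'a}" using zspan_subset_span[of "{}::'a set"] by (simp only: span_empty)
  moreover have "0 \<in> zspan ({}::'a set)" by (rule additive_group_0[OF additive_group_zspan])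
  ultimately have "zspan {} = {0::'a}" by blast
  moreover have "G \<inter> {0} = {0}" using additive_group_0[OF G] by blast
  ultimately show ?case by (intro exI[of _ "{}"]) (simp add: independent_empty)
next
  case (insert c C)
  then obtain B where B: "finite B" "independent B" "B \<subseteq> G" "span B = span C" "G \<inter> span C = zspan B"
    by (auto simp: independent_insert)
  have c: "c \<in> G" "c \<notin> span B"
    using insert B(4) by (auto simp: independent_insert)
  have unif: "x = y" if "x \<in> G" "y \<in> G" "dist x y < \<epsilon>" for x y
    using sep[of "x - y"] that additive_group_diff[OF G] by (auto simp: dist_norm)
  have fin_ball: "finite {x\<in>G. norm x \<le> M}" for M
  proof -
    have "uniform_discrete {x\<in>G. norm x \<le> M}"
      unfolding uniform_discrete_def using \<open>\<epsilon> > 0\<close> unif by auto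
    moreover have "bounded {x\<in>G. norm x \<le> M}" by (auto simp: bounded_iff)
    ultimately show ?thesis using uniform_discrete_finite_iff by blast
  qed
  define P where "P = {p. 0 < p \<and> p \<le> 1 \<and> (\<exists>x\<in>G. x - p *\<^sub>R c \<in> span B)}"
  let ?M = "(\<Sum>b\<in>B. norm b) + norm c"
  have red: "\<exists>x. x \<in> G \<and> norm x \<le> ?M \<and> x - p *\<^sub>R c \<in> span B" if p: "p \<in> P" for p
  proof -
    from p obtain x where x: "x \<in> G" "x - p *\<^sub>R c \<in> span B" by (auto simp: P_def)
    then obtain t where t: "x - p *\<^sub>R c = (\<Sum>b\<in>B. t b *\<^sub>R b)"
      using B(1) by (auto simp: span_finite)
    define y where "y = x - (\<Sum>b\<in>B. of_int \<lfloor>t b\<rfloor> *\<^sub>R b)"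
    have yG: "y \<in> G" unfolding y_def
      using x B by (intro additive_group_diff additive_group_sum additive_group_scale G) auto
    have y: "y - p *\<^sub>R c = (\<Sum>b\<in>B. frac (t b) *\<^sub>R b)"
      using t by (simp add: y_def frac_def scaleR_diff_left sum_subtractf algebra_simps)
    have "norm y \<le> norm (\<Sum>b\<in>B. frac (t b) *\<^sub>R b) + norm (p *\<^sub>R c)"
      using y norm_triangle_ineq by (metis diff_add_cancel)
    also have "norm (\<Sum>b\<in>B. frac (t b) *\<^sub>R b) \<le> (\<Sum>b\<in>B. norm b)"
      by (rule sum_norm_le) (auto simp: frac_lt_1 less_imp_le mult_left_le_one_le)
    also have "norm (p *\<^sub>R c) \<le> norm c"
      using p by (auto simp: P_def mult_left_le_one_le)
    finally have "norm y \<le> ?M" by simp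
    moreover have "y - p *\<^sub>R c \<in> span B"
      unfolding y by (intro span_sum span_scale span_base)
    ultimately show ?thesis using yG by blast
  qed
  have uniq: "p = q" if "x - p *\<^sub>R c \<in> span B" "x - q *\<^sub>R c \<in> span B" for x p q
  proof (rule ccontr)
    assume "p \<noteq> q"
    have "(x - q *\<^sub>R c) - (x - p *\<^sub>R c) \<in> span B" by (rule span_diff[OF that(2,1)])
    then have "(p - q) *\<^sub>R c \<in> span B" by (simp add: scaleR_diff_left)
    then have "(1 / (p - q)) *\<^sub>R ((p - q) *\<^sub>R c) \<in> span B" by (rule span_scale)
    then show False using \<open>p \<noteq> q\<close> c by simp
  qed
  have "finite P"
  proof -
    obtain g where g: "\<And>p. p \<in> P \<Longrightarrow> g p \<in> G \<and> norm (g p) \<le> ?M \<and> g p - p *\<^sub>R c \<in> span B"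
      using red by metis
    have "inj_on g P" by (rule inj_onI) (metis g uniq)
    moreover have "g ` P \<subseteq> {x\<in>G. norm x \<le> ?M}" using g by auto
    ultimately show ?thesis using finite_imageD[OF finite_subset[OF _ fin_ball]] by blast
  qed
  moreover have "1 \<in> P" using c by (auto simp: P_def intro!: bexI[of _ c] span_zero)
  ultimately obtain p where p: "p \<in> P" "\<And>q. q \<in> P \<Longrightarrow> p \<le> q"
    using Min_in[of P] Min_le[of P] that[of "Min P"] by blast
  then obtain x where x: "x \<in> G" "x - p *\<^sub>R c \<in> span B" "0 < p" "p \<le> 1" by (auto simp: P_def)
  have c_span: "c \<in> span (insert x B)"
  proof -
    have "x - (x - p *\<^sub>R c) \<in> span (insert x B)"
      by (rule span_diff[OF span_base subsetD[OF span_mono x(2)]]) (rule insertI1, rule subset_insertI)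
    then have "(1 / p) *\<^sub>R (x - (x - p *\<^sub>R c)) \<in> span (insert x B)" by (rule span_scale)
    then show ?thesis using x by simp
  qed
  have x_notin: "x \<notin> span B" using uniq[of x p 0] x by auto
  have x_span: "x \<in> span (insert c B)"
    using x(2) by (auto simp: span_insert)
  have "B \<subseteq> span (insert c B)" "B \<subseteq> span (insert x B)" by (auto intro: span_base)
  then have "span (insert x B) = span (insert c B)"
    using c_span x_span unfolding span_eq by blast
  moreover have ccB: "span (insert c C) = span (insert c B)"
    using B(4) by (simp add: span_insert)
  ultimately have sp: "span (insert x B) = span (insert c C)" by simp
  have "G \<inter> span (insert c C) \<subseteq> zspan (insert x B)"
  proof
    fix y assume y: "y \<in> G \<inter> span (insert c C)"
    then obtain k where k: "y - k *\<^sub>R c \<in> span B" using ccB by (auto simp: span_insert)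
    define m where "m = \<lfloor>k / p\<rfloor>"
    define z where "z = y - of_int m *\<^sub>R x"
    have zG: "z \<in> G" unfolding z_def using y x by (intro additive_group_diff additive_group_scale G) auto
    have "(y - k *\<^sub>R c) - of_int m *\<^sub>R (x - p *\<^sub>R c) \<in> span B"
      by (rule span_diff[OF k span_scale[OF x(2)]])
    moreover have "(y - k *\<^sub>R c) - of_int m *\<^sub>R (x - p *\<^sub>R c) = z - (k - m * p) *\<^sub>R c"
      by (simp add: z_def algebra_simps)
    ultimately have z: "z - (k - m * p) *\<^sub>R c \<in> span B" by simp
    have "m \<le> k / p" "k / p < m + 1" unfolding m_def by linarith+
    then have "0 \<le> k - m * p" "k - m * p < p"
      using \<open>0 < p\<close> by (auto simp: field_simps)
    then have "k - m * p = 0" using p(2)[of "k - m * p"] zG z x(4) by (force simp: P_def)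
    then have "z \<in> zspan B" using z zG B by auto
    then have "z \<in> zspan (insert x B)"
      using zspan_mono[OF subset_insertI] by blast
    moreover have "of_int m *\<^sub>R x \<in> zspan (insert x B)"
      by (intro additive_group_scale additive_group_zspan subsetD[OF zspan_superset] insertI1)
    ultimately have "z + of_int m *\<^sub>R x \<in> zspan (insert x B)"
      by (intro additive_group_add additive_group_zspan)
    then show "y \<in> zspan (insert x B)" by (simp add: z_def)
  qed
  moreover have "zspan (insert x B) \<subseteq> G \<inter> span (insert c C)"
    using zspan_minimal[OF _ G, of "insert x B"] zspan_subset_span[of "insert x B"] sp B x by auto
  ultimately show ?case
    using B x sp x_notin by (intro exI[of _ "insert x B"]) (auto simp: independent_insert)
qed

lemma discrete_group_has_basis:
  fixes G :: "'a::euclidean_space set"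
  assumes "additive_group G" "\<epsilon> > 0" "\<And>x. x \<in> G \<Longrightarrow> norm x < \<epsilon> \<Longrightarrow> x = 0"
  obtains B where "finite B" "independent B" "zspan B = G"
proof -
  obtain C where C: "C \<subseteq> G" "independent C" "G \<subseteq> span C" by (rule basis_exists)
  then have "finite C" by (simp add: independent_imp_finite)
  from discrete_group_basis_of_span[OF assms this C(2,1)] C(3) that show ?thesis
    by (metis Int_absorb2)
qed

section \<open>Bases and indices of semilattices\<close>

lemma semilattice_add_double:
  assumes "semilattice_in U S" "x \<in> S" "y \<in> zspan S"
  shows "x + 2 *\<^sub>R y \<in> S"
proof -
  let ?G = "{y. (\<forall>x\<in>S. x + 2 *\<^sub>R y \<in> S) \<and> (\<forall>x\<in>S. x - 2 *\<^sub>R y \<in> S)}"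
  have S: "{x + 2 *\<^sub>R y |x y. x \<in> S \<and> y \<in> S} \<subseteq> S" "{x - 2 *\<^sub>R y |x y. x \<in> S \<and> y \<in> S} \<subseteq> S"
    using assms(1) unfolding semilattice_in_def by (elim conjE; blast)+
  then have "S \<subseteq> ?G" by blast
  moreover have "additive_group ?G"
  proof (rule additive_groupI)
    fix y z assume *: "y \<in> ?G" "z \<in> ?G"
    have eq: "x + 2 *\<^sub>R (y - z) = (x + 2 *\<^sub>R y) - 2 *\<^sub>R z" "x - 2 *\<^sub>R (y - z) = (x - 2 *\<^sub>R y) + 2 *\<^sub>R z" for x
      by (simp_all add: algebra_simps)
    show "y - z \<in> ?G" unfolding mem_Collect_eq eq using * by blast
  qed auto
  ultimately show ?thesis using zspan_minimal[of S ?G] assms(2,3) by blast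
qed

lemma semilattice_diff_double:
  assumes "semilattice_in U S" "x \<in> S" "y \<in> zspan S"
  shows "x - 2 *\<^sub>R y \<in> S"
  using semilattice_add_double[OF assms(1,2) additive_group_minus[OF additive_group_zspan assms(3)]]
  by simp

text \<open>Isolatedness of \<open>0\<close> in \<open>S\<close> already makes the whole group \<open>\<langle>S\<rangle>\<close> discrete, because
  \<open>2\<langle>S\<rangle> = 0 + 2\<langle>S\<rangle>\<close> is contained in \<open>S\<close>.\<close>

lemma semilattice_zspan_separated:
  assumes "semilattice_in U S"
  obtains \<epsilon> where "\<epsilon> > 0" "\<And>x. x \<in> zspan S \<Longrightarrow> norm x < \<epsilon> \<Longrightarrow> x = 0"
proof -
  have "0 \<in> S" "discrete S" using assms by (auto simp: semilattice_in_def)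
  then obtain e where e: "e > 0" "\<And>y. y \<in> S \<Longrightarrow> dist 0 y < e \<Longrightarrow> y = 0"
    unfolding discrete_def isolated_in_dist_Ex_iff by metis
  show ?thesis
  proof (rule that[of "e / 2"])
    fix x assume "x \<in> zspan S" "norm x < e / 2"
    then show "x = 0"
      using e(2)[of "2 *\<^sub>R x"] semilattice_add_double[OF assms \<open>0 \<in> S\<close>, of x] by auto
  qed (use e in auto)
qed

text \<open>Among the bases of \<open>\<langle>S\<rangle>\<close>, take one with as many members in \<open>S\<close> as possible. If a member is
  outside \<open>S\<close>, then some \<open>s \<in> S\<close> has an odd coefficient at a basis vector \<open>b\<^sub>1 \<notin> S\<close>, since the elements
  without such a coefficient form a proper subgroup. As \<open>S + 2\<langle>S\<rangle> \<subseteq> S\<close>, all coefficients of \<open>s\<close> can be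
  reduced to \<open>0\<close> or \<open>1\<close>, and then exchanging \<open>b\<^sub>1\<close> for \<open>s\<close> is unimodular.\<close>

lemma semilattice_basis_set:
  fixes S :: "'a::euclidean_space set"
  assumes S: "semilattice_in U S"
  obtains B where "finite B" "independent B" "B \<subseteq> S" "zspan B = zspan S"
proof -
  define basis where "basis B \<longleftrightarrow> finite B \<and> independent B \<and> zspan B = zspan S" for B
  obtain B0 where "basis B0"
    using semilattice_zspan_separated[OF S] discrete_group_has_basis[OF additive_group_zspan]
    unfolding basis_def by metis
  have bound: "card (B \<inter> S) < DIM('a) + 1" if "basis B" for B
    using that independent_card_le[of B] card_mono[of B "B \<inter> S"] by (auto simp: basis_def)
  obtain B where B: "basis B" and max: "\<And>B'. basis B' \<Longrightarrow> card (B' \<inter> S) \<le> card (B \<inter> S)"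
    using ex_has_greatest_nat[of basis B0 "\<lambda>B. card (B \<inter> S)"] \<open>basis B0\<close> bound by metis
  have B': "finite B" "independent B" "zspan B = zspan S" using B by (auto simp: basis_def)
  have "B \<subseteq> S"
  proof (rule ccontr)
    assume "\<not> B \<subseteq> S"
    then obtain b0 where b0: "b0 \<in> B" "b0 \<notin> S" by auto
    \<comment> \<open>The subgroup of the elements with even coefficients at all basis vectors outside \<open>S\<close>.\<close>
    let ?G = "{x. \<exists>c :: 'a \<Rightarrow> int. x = (\<Sum>b\<in>B. of_int (c b) *\<^sub>R b) \<and> (\<forall>b\<in>B - S. even (c b))}"
    have grp: "additive_group ?G"
    proof (rule additive_groupI)
      show "0 \<in> ?G" by (intro CollectI exI[of _ "\<lambda>_. 0"]) auto
    next
      fix x y assume "x \<in> ?G" "y \<in> ?G"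
      then obtain c d :: "'a \<Rightarrow> int" where
        "x = (\<Sum>b\<in>B. of_int (c b) *\<^sub>R b)" "\<forall>b\<in>B - S. even (c b)"
        "y = (\<Sum>b\<in>B. of_int (d b) *\<^sub>R b)" "\<forall>b\<in>B - S. even (d b)" by blast
      then show "x - y \<in> ?G"
        by (intro CollectI exI[of _ "\<lambda>b. c b - d b"]) (auto simp: sum_subtractf scaleR_diff_left)
    qed
    have "b0 \<notin> ?G"
    proof
      assume "b0 \<in> ?G"
      then obtain c :: "'a \<Rightarrow> int" where c: "b0 = (\<Sum>b\<in>B. of_int (c b) *\<^sub>R b)" "even (c b0)"
        using b0 by blast
      have "b0 = (\<Sum>b\<in>B. (if b = b0 then 1 else 0) *\<^sub>R b)"
        using b0 B' by (simp add: if_distrib if_distribR sum.delta cong: if_cong)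
      then have "(\<Sum>b\<in>B. of_int (c b) *\<^sub>R b) = (\<Sum>b\<in>B. (if b = b0 then 1 else 0) *\<^sub>R b)"
        using c by simp
      from independent_coefficients_unique[OF B'(2,1) this b0(1)] have "c b0 = 1" by simp
      then show False using c by simp
    qed
    moreover have "b0 \<in> zspan S" using b0 B' zspan_superset by blast
    ultimately have "\<not> S \<subseteq> ?G" using zspan_minimal[OF _ grp, of S] by blast
    then obtain s where s: "s \<in> S" "s \<notin> ?G" by blast
    have "s \<in> zspan (id ` B)" using s B' zspan_superset by auto
    then obtain c :: "'a \<Rightarrow> int" where c: "s = (\<Sum>b\<in>B. of_int (c b) *\<^sub>R b)"
      using zspan_coordinates[OF B'(1), of s id] by auto
    then obtain b1 where b1: "b1 \<in> B" "b1 \<notin> S" "odd (c b1)" using s by blast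
    have BzS: "b \<in> zspan S" if "b \<in> B" for b using that B' zspan_superset by blast
    define s' where "s' = s - 2 *\<^sub>R (\<Sum>b\<in>B. of_int (c b div 2) *\<^sub>R b)"
    have s'S: "s' \<in> S" unfolding s'_def
      using BzS by (intro semilattice_diff_double[OF S s(1)] additive_group_sum additive_group_scale
          additive_group_zspan)
    have "real_of_int (c b) - 2 * real_of_int (c b div 2) = of_int (c b mod 2)" for b
      by (metis minus_mult_div_eq_mod of_int_diff of_int_mult of_int_numeral)
    then have "s' = (\<Sum>b\<in>B. of_int (c b mod 2) *\<^sub>R b)"
      by (simp add: s'_def c scaleR_sum_right flip: sum_subtractf scaleR_diff_left)
    also have "\<dots> = of_int (c b1 mod 2) *\<^sub>R b1 + (\<Sum>b\<in>B - {b1}. of_int (c b mod 2) *\<^sub>R b)"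
      using B' b1 by (simp add: sum.remove)
    finally have s': "s' = b1 + (\<Sum>b\<in>B - {b1}. of_int (c b mod 2) *\<^sub>R b)"
      using b1(3) by (simp add: odd_iff_mod_2_eq_one)
    let ?B = "insert s' (B - {b1})"
    have b1_eq: "b1 = s' - (\<Sum>b\<in>B - {b1}. of_int (c b mod 2) *\<^sub>R b)" using s' by simp
    have s'_notin: "s' \<notin> span (B - {b1})"
    proof
      assume "s' \<in> span (B - {b1})"
      then have "b1 \<in> span (B - {b1})"
        by (subst b1_eq) (rule span_diff, assumption, intro span_sum span_scale span_base)
      then show False using B' b1 by (auto simp: dependent_def)
    qed
    have "zspan ?B = zspan B"
    proof (rule zspan_eqI)
      show "?B \<subseteq> zspan B" using s'S B' zspan_superset by blast
      have "b1 \<in> zspan ?B"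
        by (subst b1_eq) (intro additive_group_diff additive_group_sum additive_group_scale
            additive_group_zspan; use zspan_superset[of ?B] in blast)
      then show "B \<subseteq> zspan ?B" using zspan_superset[of ?B] by blast
    qed
    moreover have "independent ?B"
      using s'_notin independent_mono[OF B'(2), of "B - {b1}"] by (intro independent_insertI) blast+
    ultimately have "basis ?B" using B' by (auto simp: basis_def)
    moreover have "card (B \<inter> S) < card (?B \<inter> S)"
    proof -
      have "?B \<inter> S = insert s' (B \<inter> S)" using s'S b1 by auto
      moreover have "s' \<notin> B \<inter> S" using s'_notin b1(2) span_base[of s' "B - {b1}"] by blast
      ultimately show ?thesis using B' by simp
    qed
    ultimately show False using max by (meson not_le)
  qed
  then show ?thesis using that B' by blast
qed

text \<open>A family that is independent over \<open>\<int>\<close> need not be independent over \<open>\<real>\<close>. Here it is, since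
  it generates the same group as an \<open>\<real>\<close>-independent set \<open>B\<close>: the partial sums of \<open>\<sigma>\<close>
  are distinct modulo \<open>2\<langle>S\<rangle>\<close>, and there are only \<open>2\<close> to the power \<open>|B|\<close> classes, so that \<open>n \<le> |B|\<close>.\<close>

lemma zbasis_real_basis:
  fixes S :: "'a::euclidean_space set"
  assumes S: "semilattice_in U S" and z: "zbasis_in S n \<sigma>"
  shows "n = dim U" "inj_on \<sigma> {1..n}" "independent (\<sigma> ` {1..n})" "span (\<sigma> ` {1..n}) = U"
proof -
  obtain B where B: "finite B" "independent B" "B \<subseteq> S" "zspan B = zspan S"
    using semilattice_basis_set[OF S] by blast
  note z = z[unfolded zbasis_in_def]
  have \<sigma>S: "\<sigma> ` {1..n} \<subseteq> S" using z by auto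
  have \<sigma>z: "zspan (\<sigma> ` {1..n}) = zspan S" using z by simp
  note indep = z[THEN conjunct2, THEN conjunct1, rule_format]
  have U: "span S = U" using S by (simp add: semilattice_in_def)
  have "S \<subseteq> span B" using B(4) zspan_superset[of S] zspan_subset_span[of B] by blast
  moreover have "S \<subseteq> span (\<sigma> ` {1..n})"
    using \<sigma>z zspan_superset[of S] zspan_subset_span[of "\<sigma> ` {1..n}"] by blast
  ultimately have spB: "span B = U" and sp\<sigma>: "span (\<sigma> ` {1..n}) = U"
    using B(3) \<sigma>S unfolding U[symmetric] by (meson span_eq span_superset subset_trans)+
  have dimU: "dim U = card B"
    using dim_eq_card_independent[OF B(2)] dim_span[of B] spB by simp
  have "\<exists>a :: 'a \<Rightarrow> int. (\<Sum>r\<in>J. \<sigma> r) = (\<Sum>b\<in>B. of_int (a b) *\<^sub>R b)" if "J \<subseteq> {1..n}" for J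
  proof -
    have "\<sigma> r \<in> zspan S" if "r \<in> J" for r
      using that \<open>J \<subseteq> {1..n}\<close> \<sigma>S zspan_superset[of S] by blast
    then have "(\<Sum>r\<in>J. \<sigma> r) \<in> zspan S" by (intro additive_group_sum additive_group_zspan)
    then have "(\<Sum>r\<in>J. \<sigma> r) \<in> zspan (id ` B)" by (simp add: B(4))
    then obtain a :: "'a \<Rightarrow> int" where "(\<Sum>r\<in>J. \<sigma> r) = (\<Sum>b\<in>B. of_int (a b) *\<^sub>R id b)"
      by (rule zspan_coordinates[OF B(1)])
    then show ?thesis by (intro exI[of _ a]) simp
  qed
  then obtain a :: "nat set \<Rightarrow> 'a \<Rightarrow> int"
    where a: "\<And>J. J \<subseteq> {1..n} \<Longrightarrow> (\<Sum>r\<in>J. \<sigma> r) = (\<Sum>b\<in>B. of_int (a J b) *\<^sub>R b)"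
    by metis
  \<comment> \<open>The odd coordinates with respect to \<open>B\<close> determine the class of a partial sum modulo \<open>2\<langle>S\<rangle>\<close>.\<close>
  have "inj_on (\<lambda>J. {b \<in> B. odd (a J b)}) (Pow {1..n})"
  proof (rule inj_onI)
    fix J J' assume J: "J \<in> Pow {1..n}" "J' \<in> Pow {1..n}" and eq: "{b \<in> B. odd (a J b)} = {b \<in> B. odd (a J' b)}"
    define y where "y = (\<Sum>b\<in>B. of_int ((a J b - a J' b) div 2) *\<^sub>R b)"
    have "2 *\<^sub>R y = (\<Sum>b\<in>B. of_int (a J b - a J' b) *\<^sub>R b)"
      unfolding y_def scaleR_sum_right
    proof (rule sum.cong[OF refl])
      fix b assume "b \<in> B"
      then have "even (a J b - a J' b)" using eq by auto
      then obtain k where "a J b - a J' b = 2 * k" by blast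
      then show "2 *\<^sub>R of_int ((a J b - a J' b) div 2) *\<^sub>R b = of_int (a J b - a J' b) *\<^sub>R b"
        by (simp del: of_int_diff)
    qed
    also have "\<dots> = (\<Sum>r\<in>J. \<sigma> r) - (\<Sum>r\<in>J'. \<sigma> r)"
      using J a by (simp add: sum_subtractf scaleR_diff_left)
    finally have y: "2 *\<^sub>R y = (\<Sum>r\<in>J. \<sigma> r) - (\<Sum>r\<in>J'. \<sigma> r)" .
    have "y \<in> zspan B" unfolding y_def
      by (intro additive_group_sum additive_group_scale additive_group_zspan subsetD[OF zspan_superset])
    then obtain d :: "nat \<Rightarrow> int" where d: "y = (\<Sum>r\<in>{1..n}. of_int (d r) *\<^sub>R \<sigma> r)"
      using zspan_coordinates[of "{1..n}" y \<sigma>] B(4) \<sigma>z by auto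
    have ind: "(\<Sum>r\<in>K. \<sigma> r) = (\<Sum>r=1..n. of_int (of_bool (r \<in> K)) *\<^sub>R \<sigma> r)" if "K \<in> Pow {1..n}" for K
    proof -
      have "(\<Sum>r\<in>K. \<sigma> r) = (\<Sum>r\<in>K. of_int (of_bool (r \<in> K)) *\<^sub>R \<sigma> r)" by (rule sum.cong) auto
      also have "\<dots> = (\<Sum>r=1..n. of_int (of_bool (r \<in> K)) *\<^sub>R \<sigma> r)"
        using that by (intro sum.mono_neutral_left) auto
      finally show ?thesis .
    qed
    have "(\<Sum>r=1..n. of_int (of_bool (r \<in> J) - of_bool (r \<in> J') - 2 * d r) *\<^sub>R \<sigma> r)
      = (\<Sum>r\<in>J. \<sigma> r) - (\<Sum>r\<in>J'. \<sigma> r) - 2 *\<^sub>R y"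
      unfolding ind[OF J(1)] ind[OF J(2)] d scaleR_sum_right
      by (simp add: sum_subtractf scaleR_diff_left)
    also have "\<dots> = 0" using y by simp
    finally have zero: "of_bool (r \<in> J) - of_bool (r \<in> J') - 2 * d r = 0" if "r \<in> {1..n}" for r
      by (rule indep[OF _ that])
    have "r \<in> J \<longleftrightarrow> r \<in> J'" if "r \<in> {1..n}" for r
    proof -
      have "of_bool (r \<in> J) - of_bool (r \<in> J') = 2 * d r" using zero[OF that] by simp
      then have "even (of_bool (r \<in> J) - of_bool (r \<in> J') :: int)" by simp
      then show ?thesis by (cases "r \<in> J"; cases "r \<in> J'") auto
    qed
    then show "J = J'" using J by blast
  qed
  then have "card (Pow {1..n}) \<le> card (Pow B)"
    by (rule card_inj_on_le) (use B(1) in auto)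
  then have nB: "n \<le> card B" using B(1) by (simp add: card_Pow)
  have fin: "finite (\<sigma> ` {1..n})" by simp
  have le: "card (\<sigma> ` {1..n}) \<le> n" using card_image_le[of "{1..n}" \<sigma>] by simp
  have "dim U \<le> card (\<sigma> ` {1..n})"
    using dim_le_card[OF _ fin, of U] sp\<sigma> by simp
  then show n: "n = dim U" using le nB dimU by linarith
  then have "card (\<sigma> ` {1..n}) = card {1..n}" using le \<open>dim U \<le> card (\<sigma> ` {1..n})\<close> by simp
  then show "inj_on \<sigma> {1..n}" by (intro eq_card_imp_inj_on) simp_all
  show "independent (\<sigma> ` {1..n})"
    using \<sigma>S U sp\<sigma> span_superset[of S] le n by (intro card_le_dim_spanning[of _ U]) auto
  show "span (\<sigma> ` {1..n}) = U" by (rule sp\<sigma>)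
qed

lemma semilattice_has_zbasis:
  fixes S :: "'a::euclidean_space set"
  assumes S: "semilattice_in U S"
  shows "\<exists>n \<sigma>. zbasis_in S n \<sigma>"
proof -
  obtain B where B: "finite B" "independent B" "B \<subseteq> S" "zspan B = zspan S"
    using semilattice_basis_set[OF S] by blast
  obtain \<sigma> where \<sigma>: "bij_betw \<sigma> {1..card B} B" using ex_bij_betw_nat_finite_1[OF B(1)] by blast
  have img: "\<sigma> ` {1..card B} = B" using \<sigma> by (simp add: bij_betw_def)
  have "zbasis_in S (card B) \<sigma>"
    unfolding zbasis_in_def
  proof (intro conjI ballI allI impI)
    show "\<sigma> r \<in> S" if "r \<in> {1..card B}" for r using that img B(3) by blast
    show "zspan (\<sigma> ` {1..card B}) = zspan S" using img B(4) by simp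
  next
    fix k :: "nat \<Rightarrow> int" and r
    assume sum: "(\<Sum>r = 1..card B. of_int (k r) *\<^sub>R \<sigma> r) = 0" and r: "r \<in> {1..card B}"
    define g where "g = inv_into {1..card B} \<sigma>"
    have g: "g (\<sigma> q) = q" if "q \<in> {1..card B}" for q
      unfolding g_def using \<sigma> that by (simp add: bij_betw_def inv_into_f_f)
    have "(\<Sum>b\<in>B. of_int (k (g b)) *\<^sub>R b) = (\<Sum>q = 1..card B. of_int (k (g (\<sigma> q))) *\<^sub>R \<sigma> q)"
      by (rule sum.reindex_bij_betw[OF \<sigma>, symmetric])
    also have "\<dots> = 0" unfolding sum[symmetric] by (rule sum.cong) (simp_all add: g)
    finally have "(\<Sum>b\<in>B. of_int (k (g b)) *\<^sub>R b) = 0" .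
    moreover have "\<sigma> r \<in> B" using img r by blast
    ultimately show "k r = 0"
      using independentD[OF B(2,1) order_refl, of "\<lambda>b. of_int (k (g b))" "\<sigma> r"] g[OF r] by simp
  qed
  then show ?thesis by blast
qed

lemma ind_eq_card_supp:
  fixes S :: "'a::euclidean_space set"
  assumes "semilattice_in U S"
  obtains n \<sigma> where "zbasis_in S n \<sigma>" "ind S = card (supp S n \<sigma>) - 1"
proof -
  let ?P = "\<lambda>(n, \<sigma>). zbasis_in S n \<sigma>"
  have "\<exists>x. ?P x" using semilattice_has_zbasis[OF assms] by auto
  then have "?P (SOME x. ?P x)" by (rule someI_ex)
  then show thesis using that unfolding ind_def by (cases "SOME x. ?P x") auto
qed

section \<open>Set families with even intersection numbers\<close>

lemma another_set_containing_pair: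
  assumes "finite T" "even (card {J \<in> T. i \<in> J \<and> j \<in> J})" "K \<in> T" "i \<in> K" "j \<in> K"
  obtains K' where "K' \<in> T" "K' \<noteq> K" "i \<in> K'" "j \<in> K'"
proof -
  have "{J \<in> T. i \<in> J \<and> j \<in> J} \<noteq> {K}"
  proof
    assume "{J \<in> T. i \<in> J \<and> j \<in> J} = {K}"
    from assms(2)[unfolded this] show False by simp
  qed
  moreover have "K \<in> {J \<in> T. i \<in> J \<and> j \<in> J}" using assms(3-5) by blast
  ultimately show thesis using that by blast
qed

text \<open>A member with two elements \<open>a, b\<close> has a partner that contains both. One of the two, say \<open>J\<close>, has an
  element \<open>x\<close> that the other lacks. The pairs \<open>x, a\<close> and \<open>x, b\<close> again
  need a second set each, and only one large set is left for both. Then \<open>a, b\<close> lie in exactly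
  three members, which is odd. So all members have at most one element, and the evenness conditions
  for \<open>i = j\<close> and for the cardinality of \<open>T\<close> rule these out.

  The bound is natural: the power set of \<open>{1, 2, 3}\<close> satisfies the evenness conditions and has four
  members with at least two elements.\<close>

lemma no_even_family_with_few_large_sets:
  assumes T: "finite T" "T \<noteq> {}" "\<Union>T \<subseteq> I" "even (card T)"
    and pairs: "\<And>i j. i \<in> I \<Longrightarrow> j \<in> I \<Longrightarrow> even (card {J \<in> T. i \<in> J \<and> j \<in> J})"
    and large: "card {J \<in> T. \<exists>i\<in>J. \<exists>j\<in>J. i \<noteq> j} \<le> 3"
  shows False
proof -
  let ?L = "{J \<in> T. \<exists>i\<in>J. \<exists>j\<in>J. i \<noteq> j}"
  have other: "\<exists>K'\<in>T. K' \<noteq> K \<and> i \<in> K' \<and> j \<in> K'" if "K \<in> T" "i \<in> K" "j \<in> K" for K i j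
  proof -
    have "i \<in> I" "j \<in> I" using that T(3) by blast+
    show ?thesis by (rule another_set_containing_pair[OF T(1) pairs[OF \<open>i \<in> I\<close> \<open>j \<in> I\<close>] that]) (intro bexI conjI)
  qed
  have triple: "K = K'" if "J \<in> ?L" "J' \<in> ?L" "K \<in> ?L" "K' \<in> ?L" "J \<noteq> J'" "K \<noteq> J" "K \<noteq> J'" "K' \<noteq> J" "K' \<noteq> J'"
    for J J' K K'
  proof (rule ccontr)
    assume "K \<noteq> K'"
    then have "card {J, J', K, K'} = 4" using that by auto
    moreover have "{J, J', K, K'} \<subseteq> ?L" using that by blast
    ultimately show False using large T(1) card_mono[of ?L "{J, J', K, K'}"] by simp
  qed
  have no_chain: False if J: "J \<in> T" "J' \<in> T" "a \<noteq> b" "a \<in> J" "b \<in> J" "a \<in> J'" "b \<in> J'" "x \<in> J" "x \<notin> J'"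
    for J J' a b x
  proof -
    obtain K where K: "K \<in> T" "K \<noteq> J" "x \<in> K" "a \<in> K" using other[OF J(1,8,4)] by blast
    obtain K' where K': "K' \<in> T" "K' \<noteq> J" "x \<in> K'" "b \<in> K'" using other[OF J(1,8,5)] by blast
    have x: "x \<noteq> a" "x \<noteq> b" using J by blast+
    have large4: "J \<in> ?L" "J' \<in> ?L" "K \<in> ?L" "K' \<in> ?L"
      using J(1-7) K(1,3,4) K'(1,3,4) x by blast+
    have neq: "J \<noteq> J'" "K \<noteq> J'" "K' \<noteq> J'" using J(8,9) K(3) K'(3) by blast+
    then have "K = K'" using triple[OF large4] K(2) K'(2) by blast
    then have "{J, J', K} \<subseteq> {A \<in> T. a \<in> A \<and> b \<in> A}" using J K K' by blast
    moreover have "{A \<in> T. a \<in> A \<and> b \<in> A} \<subseteq> ?L" using J(3) by blast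
    moreover have "card {J, J', K} = 3" using neq K(2) by simp
    ultimately have "card {A \<in> T. a \<in> A \<and> b \<in> A} = 3"
      using large T(1) card_mono[of "{A \<in> T. a \<in> A \<and> b \<in> A}" "{J, J', K}"]
        card_mono[of ?L "{A \<in> T. a \<in> A \<and> b \<in> A}"] by simp
    then show False using pairs[of a b] J T(3) by fastforce
  qed
  have small: "i = j" if J: "J \<in> T" "i \<in> J" "j \<in> J" for J i j
  proof (rule ccontr)
    assume "i \<noteq> j"
    obtain K where K: "K \<in> T" "K \<noteq> J" "i \<in> K" "j \<in> K" using other[OF J] by blast
    then consider x where "x \<in> J" "x \<notin> K" | x where "x \<in> K" "x \<notin> J" by blast
    then show False using no_chain[OF that(1) K(1) \<open>i \<noteq> j\<close>] no_chain[OF K(1) that(1) \<open>i \<noteq> j\<close>] that K by metis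
  qed
  have "J = {}" if J: "J \<in> T" for J
  proof (rule ccontr)
    assume "J \<noteq> {}"
    then obtain i where i: "i \<in> J" by blast
    obtain K where K: "K \<in> T" "K \<noteq> J" "i \<in> K" using other[OF J i i] by blast
    have "J = {i}" "K = {i}" using small[OF J _ i] small[OF K(1) _ K(3)] K(3) i by blast+
    then show False using K by blast
  qed
  then have "T = {{}}" using T(2) by blast
  then show False using T(4) by simp
qed

section \<open>Linear groups generated by involutions\<close>

lemma group_GL:
  assumes "subspace X" shows "group (GL X)"
proof -
  interpret BG: group "BijGroup X" by (rule group_BijGroup)
  let ?C = "{g \<in> Bij X. (\<forall>x\<in>X. \<forall>y\<in>X. g (x + y) = g x + g y) \<and> (\<forall>c. \<forall>x\<in>X. g (c *\<^sub>R x) = c *\<^sub>R g x)}"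
  have X: "x + y \<in> X" "c *\<^sub>R x \<in> X" if "x \<in> X" "y \<in> X" for x y c
    using assms that by (auto simp: subspace_def)
  have "subgroup ?C (BijGroup X)"
  proof (rule subgroup.intro)
    show "?C \<subseteq> carrier (BijGroup X)" by (auto simp: BijGroup_def)
    show "\<one>\<^bsub>BijGroup X\<^esub> \<in> ?C" using X by (auto simp: BijGroup_def id_Bij)
  next
    fix g h assume gh: "g \<in> ?C" "h \<in> ?C"
    then have "h x \<in> X" if "x \<in> X" for x using that by (auto dest!: Bij_imp_funcset)
    with gh X show "g \<otimes>\<^bsub>BijGroup X\<^esub> h \<in> ?C"
      by (auto simp: BijGroup_def compose_Bij compose_eq)
  next
    fix g assume g: "g \<in> ?C"
    then have gB: "g \<in> Bij X" by auto
    have "inv_into X g (x + y) = inv_into X g x + inv_into X g y" if "x \<in> X" "y \<in> X" for x y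
      using g X that by (intro Bij_inv_into_lemma[where S = X and g = "(+)"]) auto
    moreover have "inv_into X g (c *\<^sub>R x) = c *\<^sub>R inv_into X g x" if "x \<in> X" for x c
      using g X that by (intro Bij_inv_into_lemma[where S = X and g = "\<lambda>x _. c *\<^sub>R x" and y = x]) auto
    ultimately show "inv\<^bsub>BijGroup X\<^esub> g \<in> ?C"
      using gB X by (auto simp: inv_BijGroup restrict_inv_into_Bij)
  qed
  then show ?thesis unfolding GL_def by (rule BG.subgroup_imp_group)
qed

lemma GL_mult_apply:
  "g \<in> carrier (GL X) \<Longrightarrow> h \<in> carrier (GL X) \<Longrightarrow> x \<in> X \<Longrightarrow> (g \<otimes>\<^bsub>GL X\<^esub> h) x = g (h x)"
  by (auto simp: GL_def BijGroup_def compose_eq)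

lemma GL_one_apply: "x \<in> X \<Longrightarrow> \<one>\<^bsub>GL X\<^esub> x = x"
  by (auto simp: GL_def BijGroup_def)

lemma GL_add: "g \<in> carrier (GL X) \<Longrightarrow> x \<in> X \<Longrightarrow> y \<in> X \<Longrightarrow> g (x + y) = g x + g y"
  by (auto simp: GL_def)

lemma GL_scale: "g \<in> carrier (GL X) \<Longrightarrow> x \<in> X \<Longrightarrow> g (c *\<^sub>R x) = c *\<^sub>R g x"
  by (auto simp: GL_def)

lemma GL_eqI:
  assumes "g \<in> carrier (GL X)" "h \<in> carrier (GL X)" "\<And>x. x \<in> X \<Longrightarrow> g x = h x"
  shows "g = h"
  using assms by (intro extensionalityI[of _ X]) (auto simp: GL_def Bij_def)

text \<open>Involutions are their own inverses, so right multiplication by generators reaches the whole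
  generated subgroup. This matches invariants that are controlled along \<open>w \<mapsto> w h\<close>.\<close>

lemma (in group) generate_involutions_induct:
  assumes "H \<subseteq> carrier G" "\<And>h. h \<in> H \<Longrightarrow> h \<otimes> h = \<one>"
    and "w \<in> generate G H" "P \<one>"
    and step: "\<And>w h. w \<in> generate G H \<Longrightarrow> P w \<Longrightarrow> h \<in> H \<Longrightarrow> P (w \<otimes> h)"
  shows "P w"
proof -
  have "\<forall>v\<in>generate G H. P v \<longrightarrow> P (v \<otimes> w)"
    using assms(3)
  proof (induction rule: generate.induct)
    case one
    then show ?case using generate_in_carrier[OF assms(1)] by auto
  next
    case (incl h)
    then show ?case using step by auto
  next
    case (inv h)
    then have "inv h = h" using assms(1,2) by (intro inv_equality) auto
    then show ?case using inv step by auto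
  next
    case (eng h1 h2)
    show ?case
    proof (intro ballI impI)
      fix v assume v: "v \<in> generate G H" "P v"
      then have "P (v \<otimes> h1 \<otimes> h2)" using eng by (auto intro: generate.eng)
      then show "P (v \<otimes> (h1 \<otimes> h2))"
        using v eng generate_in_carrier[OF assms(1)] by (simp add: m_assoc)
    qed
  qed
  then have "P (\<one> \<otimes> w)" using assms(4) generate.one by blast
  then show ?thesis using generate_in_carrier[OF assms(1,3)] by simp
qed

section \<open>Reflections in affine roots of type C\<close>

text \<open>The vectors \<open>e 1, \<dots>, e l\<close> play the role of \<open>\<epsilon>\<^sub>1, \<dots>, \<epsilon>\<^sub>l\<close>.\<close>

definition affine_short :: "(nat \<Rightarrow> 'v::real_vector) \<Rightarrow> nat \<Rightarrow> 'v set \<Rightarrow> 'v set" where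
  "affine_short e l L = {s *\<^sub>R e i + s' *\<^sub>R e j + \<tau> |s s' i j \<tau>.
     s \<in> {-1, 1} \<and> s' \<in> {-1, 1} \<and> i \<in> {1..l} \<and> j \<in> {1..l} \<and> i \<noteq> j \<and> \<tau> \<in> L}"

definition affine_long :: "(nat \<Rightarrow> 'v::real_vector) \<Rightarrow> nat \<Rightarrow> 'v set \<Rightarrow> 'v set" where
  "affine_long e l D = {(2 * s) *\<^sub>R e i + \<delta> |s i \<delta>. s \<in> {-1, 1} \<and> i \<in> {1..l} \<and> \<delta> \<in> D}"

text \<open>Here \<open>L\<close> stands for \<open>S\<^sub>1 \<oplus> \<langle>S\<^sub>2\<rangle>\<close>, and \<open>D\<close> for \<open>2S\<^sub>1 \<oplus> S\<^sub>2\<close>, a union of cosets of \<open>2L\<close>.\<close>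

locale affine_C =
  fixes B :: "'v::euclidean_space \<Rightarrow> 'v \<Rightarrow> real" and Vdot V0 :: "'v set"
    and e :: "nat \<Rightarrow> 'v" and c :: real and l :: nat and L D R :: "'v set"
  assumes bil: "bilinear B" and sym: "\<And>x y. B x y = B y x"
    and rad: "\<And>x y. x \<in> V0 \<Longrightarrow> B x y = 0"
    and l3: "3 \<le> l" and c0: "0 < c"
    and B_e: "\<And>i j. i \<in> {1..l} \<Longrightarrow> j \<in> {1..l} \<Longrightarrow> B (e i) (e j) = (if i = j then c else 0)"
    and e_dot: "\<And>i. i \<in> {1..l} \<Longrightarrow> e i \<in> Vdot"
    and L_group: "additive_group L" and L_V0: "L \<subseteq> V0"
    and D_L: "D \<subseteq> L" and D_double: "\<And>d x. d \<in> D \<Longrightarrow> x \<in> L \<Longrightarrow> d + 2 *\<^sub>R x \<in> D"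
    and roots: "nonisotropic B R = affine_short e l L \<union> affine_long e l D"
begin

abbreviation "H \<equiv> hyp_space Vdot"
abbreviation "G \<equiv> GL H"
abbreviation "shorts \<equiv> affine_short e l L"
abbreviation "longs \<equiv> affine_long e l D"
abbreviation "X \<equiv> shorts \<union> longs"
definition "rfl \<alpha> = restrict (reflection (hyp_form B) (\<alpha>, 0)) H"
abbreviation "W A \<equiv> reflection_group B Vdot A"

lemmas B_simps = bilinear_ladd[OF bil] bilinear_radd[OF bil] bilinear_lmul[OF bil] bilinear_rmul[OF bil]
  bilinear_lzero[OF bil] bilinear_rzero[OF bil] bilinear_lneg[OF bil] bilinear_rneg[OF bil]
  bilinear_lsub[OF bil] bilinear_rsub[OF bil]

lemma rad': "x \<in> V0 \<Longrightarrow> B y x = 0"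
  using rad sym by metis

lemma V0_L: "x \<in> L \<Longrightarrow> x \<in> V0" and V0_D: "x \<in> D \<Longrightarrow> x \<in> V0" and LD: "x \<in> D \<Longrightarrow> x \<in> L"
  using L_V0 D_L by auto

lemma subspace_H: "subspace H"
  by (auto simp: subspace_def hyp_space_def zero_prod_def blinfun.add_left blinfun.scaleR_left)

sublocale G: group G
  by (rule group_GL[OF subspace_H])

lemma H_iff: "(x, f) \<in> H \<longleftrightarrow> (\<forall>y\<in>Vdot. blinfun_apply f y = 0)"
  by (auto simp: hyp_space_def)

lemma H_0: "(x, 0) \<in> H"
  by (auto simp: H_iff)

lemma reflection_group_eq: "W A = generate G (rfl ` A)"
  unfolding reflection_group_def rfl_def ..

lemma refl_apply:
  "(x, f) \<in> H \<Longrightarrow> rfl \<alpha> (x, f) = (x - (2 / B \<alpha> \<alpha> * (B x \<alpha> + blinfun_apply f \<alpha>)) *\<^sub>R \<alpha>, f)"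
  by (simp add: rfl_def reflection_def coroot_def hyp_form_def B_simps blinfun.scaleR_right
      algebra_simps add_divide_distrib)

lemma refl_involution:
  assumes "B \<alpha> \<alpha> \<noteq> 0" "u \<in> H" shows "rfl \<alpha> (rfl \<alpha> u) = u"
proof (cases u)
  case (Pair x f)
  let ?t = "2 / B \<alpha> \<alpha> * (B x \<alpha> + blinfun_apply f \<alpha>)"
  have "(x - ?t *\<^sub>R \<alpha>, f) \<in> H" using assms Pair by (simp add: H_iff)
  moreover have "2 / B \<alpha> \<alpha> * (B (x - ?t *\<^sub>R \<alpha>) \<alpha> + blinfun_apply f \<alpha>) = - ?t"
    using assms(1) by (simp add: B_simps field_simps)
  ultimately show ?thesis using assms(2) Pair by (simp only: refl_apply) simp
qed

lemma refl_closed: "u \<in> H \<Longrightarrow> rfl \<alpha> u \<in> H"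
  by (cases u) (simp only: refl_apply H_iff)

lemma refl_in_GL:
  assumes "B \<alpha> \<alpha> \<noteq> 0" shows "rfl \<alpha> \<in> carrier G"
proof -
  have "bij_betw (rfl \<alpha>) H H"
    by (rule bij_betwI[where g = "rfl \<alpha>"])
      (use refl_closed refl_involution[OF assms] in auto)
  then have "rfl \<alpha> \<in> Bij H" by (simp add: Bij_def rfl_def)
  moreover have "rfl \<alpha> (u + v) = rfl \<alpha> u + rfl \<alpha> v" if "u \<in> H" "v \<in> H" for u v
  proof (cases u, cases v)
    fix x f y g assume uv: "u = (x, f)" "v = (y, g)"
    have "(x + y, f + g) \<in> H" using that uv subspace_add[OF subspace_H that] by simp
    then show ?thesis using that unfolding uv add_Pair
      by (simp only: refl_apply) (simp add: B_simps blinfun.add_left algebra_simps add_divide_distrib)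
  qed
  moreover have "rfl \<alpha> (a *\<^sub>R u) = a *\<^sub>R rfl \<alpha> u" if "u \<in> H" for u a
  proof (cases u)
    fix x f assume u: "u = (x, f)"
    have "(a *\<^sub>R x, a *\<^sub>R f) \<in> H" using that u subspace_scale[OF subspace_H that] by simp
    then show ?thesis using that unfolding u scaleR_Pair
      by (simp only: refl_apply) (simp add: B_simps blinfun.scaleR_left algebra_simps add_divide_distrib)
  qed
  ultimately show ?thesis by (simp add: GL_def)
qed

lemma refl_square:
  assumes "B \<alpha> \<alpha> \<noteq> 0" shows "rfl \<alpha> \<otimes>\<^bsub>G\<^esub> rfl \<alpha> = \<one>\<^bsub>G\<^esub>"
  using refl_in_GL[OF assms]
  by (intro GL_eqI[of _ H]) (simp_all only: GL_mult_apply G.m_closed G.one_closed GL_one_apply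
      refl_involution[OF assms])

lemma reflection_group_induct:
  assumes A: "\<And>\<alpha>. \<alpha> \<in> A \<Longrightarrow> B \<alpha> \<alpha> \<noteq> 0" and w: "w \<in> W A" and one: "P \<one>\<^bsub>G\<^esub>"
    and step: "\<And>w \<alpha>. w \<in> carrier G \<Longrightarrow> P w \<Longrightarrow> \<alpha> \<in> A \<Longrightarrow> P (w \<otimes>\<^bsub>G\<^esub> rfl \<alpha>)"
  shows "P w"
proof (rule G.generate_involutions_induct[where P = P and w = w and H = "rfl ` A"])
  show sub: "rfl ` A \<subseteq> carrier G" using refl_in_GL[OF A] by blast
  show "w \<in> generate G (rfl ` A)" using w by (simp add: reflection_group_eq)
  show "h \<otimes>\<^bsub>G\<^esub> h = \<one>\<^bsub>G\<^esub>" if "h \<in> rfl ` A" for h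
    using that refl_square[OF A] by blast
  show "P (v \<otimes>\<^bsub>G\<^esub> h)" if "v \<in> generate G (rfl ` A)" "P v" "h \<in> rfl ` A" for v h
    using that step[of v] G.generate_in_carrier[OF sub] by blast
qed (rule one)

text \<open>The linearity of \<open>w\<close> reduces the change of \<open>w\<close> under right multiplication to the value of \<open>w\<close> at
  the root; all invariants below are computed from this formula.\<close>

lemma mult_refl_apply:
  assumes w: "w \<in> carrier G" and \<alpha>: "B \<alpha> \<alpha> \<noteq> 0" and u: "(x, f) \<in> H"
  shows "(w \<otimes>\<^bsub>G\<^esub> rfl \<alpha>) (x, f)
    = w (x, f) - (2 / B \<alpha> \<alpha> * (B x \<alpha> + blinfun_apply f \<alpha>)) *\<^sub>R w (\<alpha>, 0)"
proof -
  let ?t = "2 / B \<alpha> \<alpha> * (B x \<alpha> + blinfun_apply f \<alpha>)"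
  have "(w \<otimes>\<^bsub>G\<^esub> rfl \<alpha>) (x, f) = w (rfl \<alpha> (x, f))"
    using GL_mult_apply[OF w refl_in_GL[OF \<alpha>] u] .
  also have "rfl \<alpha> (x, f) = (x, f) + (- ?t) *\<^sub>R (\<alpha>, 0)"
    unfolding refl_apply[OF u] by simp
  also have "w \<dots> = w (x, f) + (- ?t) *\<^sub>R w (\<alpha>, 0)"
    using GL_add[OF w u subspace_scale[OF subspace_H H_0]] GL_scale[OF w H_0] by metis
  finally show ?thesis by simp
qed

lemma W_carrier: "(\<And>\<alpha>. \<alpha> \<in> A \<Longrightarrow> B \<alpha> \<alpha> \<noteq> 0) \<Longrightarrow> w \<in> W A \<Longrightarrow> w \<in> carrier G"
  unfolding reflection_group_eq using refl_in_GL by (intro G.generate_in_carrier) auto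

lemma refl_in_W: "\<alpha> \<in> A \<Longrightarrow> rfl \<alpha> \<in> W A"
  unfolding reflection_group_eq by (intro generate.incl) blast

lemma W_mult: "v \<in> W A \<Longrightarrow> w \<in> W A \<Longrightarrow> v \<otimes>\<^bsub>G\<^esub> w \<in> W A"
  unfolding reflection_group_eq by (rule generate.eng)

lemma W_subset:
  assumes "\<And>\<alpha>. \<alpha> \<in> A' \<Longrightarrow> B \<alpha> \<alpha> \<noteq> 0" "\<And>\<alpha>. \<alpha> \<in> A \<Longrightarrow> rfl \<alpha> \<in> W A'"
  shows "W A \<subseteq> W A'"
  using assms refl_in_GL unfolding reflection_group_eq
  by (intro G.generate_subgroup_incl G.generate_is_subgroup) blast+

lemma B_short:
  assumes "s \<in> {-1, 1}" "s' \<in> {-1, 1}" "i \<in> {1..l}" "j \<in> {1..l}" "i \<noteq> j" "\<tau> \<in> L"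
  shows "B (s *\<^sub>R e i + s' *\<^sub>R e j + \<tau>) (s *\<^sub>R e i + s' *\<^sub>R e j + \<tau>) = 2 * c"
    "k \<in> {1..l} \<Longrightarrow> B (e k) (s *\<^sub>R e i + s' *\<^sub>R e j + \<tau>)
       = c * ((if k = i then s else 0) + (if k = j then s' else 0))"
  using assms V0_L[OF assms(6)] by (auto simp: B_simps B_e rad rad')

lemma B_long:
  assumes "s \<in> {-1, 1}" "i \<in> {1..l}" "\<delta> \<in> V0"
  shows "B ((2 * s) *\<^sub>R e i + \<delta>) ((2 * s) *\<^sub>R e i + \<delta>) = 4 * c"
    "k \<in> {1..l} \<Longrightarrow> B (e k) ((2 * s) *\<^sub>R e i + \<delta>) = (if k = i then 2 * s * c else 0)"
  using assms by (auto simp: B_simps B_e rad rad')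

lemma shortsE:
  assumes "\<alpha> \<in> shorts"
  obtains s s' i j \<tau> where "s \<in> {-1, 1}" "s' \<in> {-1, 1}" "i \<in> {1..l}" "j \<in> {1..l}" "i \<noteq> j" "\<tau> \<in> L"
    "\<alpha> = s *\<^sub>R e i + s' *\<^sub>R e j + \<tau>"
  using assms unfolding affine_short_def by blast

lemma longsE:
  assumes "\<alpha> \<in> longs"
  obtains s i \<delta> where "s \<in> {-1, 1}" "i \<in> {1..l}" "\<delta> \<in> D" "\<alpha> = (2 * s) *\<^sub>R e i + \<delta>"
  using assms unfolding affine_long_def by blast

lemma B_shorts: "\<alpha> \<in> shorts \<Longrightarrow> B \<alpha> \<alpha> = 2 * c"
  by (elim shortsE, hypsubst, rule B_short(1))

lemma B_longs: "\<alpha> \<in> longs \<Longrightarrow> B \<alpha> \<alpha> = 4 * c"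
  by (elim longsE, hypsubst, rule B_long(1)) (simp_all add: V0_D)

lemma B_roots: "\<alpha> \<in> X \<Longrightarrow> B \<alpha> \<alpha> \<noteq> 0"
  using c0 by (auto simp: B_shorts B_longs)

end

section \<open>Orbits of roots\<close>

context affine_C
begin

abbreviation "orb \<alpha> \<equiv> weyl_orbit B Vdot R \<alpha>"

lemma orb_iff: "\<beta> \<in> orb \<alpha> \<longleftrightarrow> (\<exists>w\<in>W X. w (\<alpha>, 0) = (\<beta>, 0))"
  by (simp add: weyl_orbit_def weyl_group_def roots)

lemma W_X_carrier: "w \<in> W X \<Longrightarrow> w \<in> carrier G"
  using W_carrier B_roots by blast

lemma orb_refl: "\<alpha> \<in> orb \<alpha>"
  unfolding orb_iff reflection_group_eq
  using GL_one_apply[OF H_0[of \<alpha>]] generate.one by blast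

lemma orb_trans: "\<beta> \<in> orb \<alpha> \<Longrightarrow> \<gamma> \<in> orb \<beta> \<Longrightarrow> \<gamma> \<in> orb \<alpha>"
  unfolding orb_iff
proof (elim bexE)
  fix v w assume "v \<in> W X" "v (\<alpha>, 0) = (\<beta>, 0)" "w \<in> W X" "w (\<beta>, 0) = (\<gamma>, 0)"
  then show "\<exists>u\<in>W X. u (\<alpha>, 0) = (\<gamma>, 0)"
    using GL_mult_apply[OF W_X_carrier W_X_carrier H_0] by (intro bexI[of _ "w \<otimes>\<^bsub>G\<^esub> v"] W_mult) simp_all
qed

lemma orb_step:
  assumes "\<beta> \<in> orb \<alpha>" "\<gamma> \<in> X" shows "\<beta> - (2 / B \<gamma> \<gamma> * B \<beta> \<gamma>) *\<^sub>R \<gamma> \<in> orb \<alpha>"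
proof (rule orb_trans[OF assms(1)])
  show "\<beta> - (2 / B \<gamma> \<gamma> * B \<beta> \<gamma>) *\<^sub>R \<gamma> \<in> orb \<beta>"
    unfolding orb_iff using assms(2) refl_in_W refl_apply[OF H_0, of \<gamma> \<beta>] by (intro bexI[of _ "rfl \<gamma>"]) auto
qed

text \<open>If \<open>\<alpha>\<close> and \<open>\<beta>\<close> span a root system of type \<open>A\<^sub>2\<close> modulo the radical, then the product of their
  reflections carries \<open>\<alpha>\<close> to \<open>\<plusminus>\<beta>\<close>.\<close>

lemma shorts_adjacent:
  assumes "\<alpha> \<in> shorts" "\<beta> \<in> shorts" "B \<alpha> \<beta> = \<sigma> * c" "\<sigma> \<in> {-1, 1}"
  shows "\<beta> \<in> orb \<alpha>"
proof -
  have X: "\<alpha> \<in> X" "\<beta> \<in> X" using assms by auto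
  have "\<alpha> - \<sigma> *\<^sub>R \<beta> \<in> orb \<alpha>"
    using orb_step[OF orb_refl[of \<alpha>] X(2)] assms(3) c0 B_shorts[OF assms(2)] by simp
  from orb_step[OF this X(1)] have "- \<sigma> *\<^sub>R \<beta> \<in> orb \<alpha>"
    using assms(3,4) c0 B_shorts[OF assms(1)] sym[of \<beta> \<alpha>] by (auto simp: B_simps)
  from this orb_step[OF this X(2)] show ?thesis
    using assms(4) c0 B_shorts[OF assms(2)] by (auto simp: B_simps scaleR_2)
qed

lemma shorts_overlap:
  assumes "\<alpha> = s *\<^sub>R e i + s' *\<^sub>R e j + \<tau>" "s \<in> {-1, 1}" "s' \<in> {-1, 1}" "i \<in> {1..l}" "j \<in> {1..l}" "i \<noteq> j" "\<tau> \<in> L"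
    "\<beta> = t *\<^sub>R e p + t' *\<^sub>R e q + \<tau>'" "t \<in> {-1, 1}" "t' \<in> {-1, 1}" "p \<in> {1..l}" "q \<in> {1..l}" "p \<noteq> q" "\<tau>' \<in> L"
    and one: "i \<in> {p, q} \<longleftrightarrow> j \<notin> {p, q}"
  shows "\<beta> \<in> orb \<alpha>"
proof -
  have "B \<alpha> \<beta> = s * B (e i) \<beta> + s' * B (e j) \<beta>"
    using assms(1,7) by (simp add: B_simps rad V0_L)
  also have "\<dots> = (s * ((if i = p then t else 0) + (if i = q then t' else 0))
      + s' * ((if j = p then t else 0) + (if j = q then t' else 0))) * c" (is "_ = ?\<sigma> * c")
    unfolding assms(8) B_short(2)[OF assms(9-14,4)] B_short(2)[OF assms(9-14,5)]
    by (simp add: algebra_simps)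
  finally have "B \<alpha> \<beta> = ?\<sigma> * c" .
  moreover have "?\<sigma> \<in> {-1, 1}" using one assms(2,3,6,9,10,13) by auto
  ultimately show ?thesis
    using assms by (intro shorts_adjacent[where \<sigma> = ?\<sigma>]) (unfold affine_short_def, blast+)
qed

text \<open>Two short roots whose index pairs meet in one index are adjacent. For equal pairs an intermediate
  root needs a third index; this is where \<open>l \<ge> 3\<close> enters. For disjoint pairs it takes one index from
  each.\<close>

lemma shorts_single_orbit:
  assumes "\<alpha> \<in> shorts" "\<beta> \<in> shorts" shows "\<beta> \<in> orb \<alpha>"
  using assms
proof (elim shortsE)
  fix s s' i j \<tau> t t' p q \<tau>'
  assume \<alpha>: "s \<in> {-1, 1}" "s' \<in> {-1, 1}" "i \<in> {1..l}" "j \<in> {1..l}" "i \<noteq> j" "\<tau> \<in> L"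
    "\<alpha> = s *\<^sub>R e i + s' *\<^sub>R e j + \<tau>"
  and \<beta>: "t \<in> {-1, 1}" "t' \<in> {-1, 1}" "p \<in> {1..l}" "q \<in> {1..l}" "p \<noteq> q" "\<tau>' \<in> L"
    "\<beta> = t *\<^sub>R e p + t' *\<^sub>R e q + \<tau>'"
  have L0: "0 \<in> L" using L_group by (rule additive_group_0)
  have via: "\<beta> \<in> orb \<alpha>" if ab: "a \<in> {1..l}" "b \<in> {1..l}" "a \<noteq> b"
    "i \<in> {a, b} \<longleftrightarrow> j \<notin> {a, b}" "a \<in> {p, q} \<longleftrightarrow> b \<notin> {p, q}" for a b
  proof -
    let ?\<gamma> = "1 *\<^sub>R e a + 1 *\<^sub>R e b + 0"
    have "?\<gamma> \<in> orb \<alpha>"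
      using ab by (intro shorts_overlap[OF \<alpha>(7,1-6) refl _ _ ab(1,2,3) L0]) auto
    moreover have "\<beta> \<in> orb ?\<gamma>"
      using ab by (intro shorts_overlap[OF refl _ _ ab(1-3) L0 \<beta>(7,1-6)]) auto
    ultimately show ?thesis by (rule orb_trans)
  qed
  consider "i \<in> {p, q} \<longleftrightarrow> j \<notin> {p, q}" | "i \<in> {p, q}" "j \<in> {p, q}" | "i \<notin> {p, q}" "j \<notin> {p, q}"
    by blast
  then show "\<beta> \<in> orb \<alpha>"
  proof cases
    case 1
    then show ?thesis by (intro shorts_overlap[OF \<alpha>(7,1-6) \<beta>(7,1-6)])
  next
    case 2
    have "card {1..l} > card {i, j}" using l3 \<alpha>(5) by simp
    then have "\<not> {1..l} \<subseteq> {i, j}" using card_mono[of "{i, j}" "{1..l}"] by fastforce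
    then obtain b where "b \<in> {1..l}" "b \<noteq> i" "b \<noteq> j" by blast
    then show ?thesis using 2 \<alpha>(3,5) by (intro via[of i b]) auto
  next
    case 3
    then show ?thesis using \<alpha>(3,5) \<beta>(3,5) by (intro via[of i p]) auto
  qed
qed

text \<open>The reflection in \<open>s\<epsilon>\<^sub>i - s'\<epsilon>\<^sub>j - x\<close> changes the index and the sign as required and adds \<open>2x\<close> to the
  isotropic part. For \<open>i = j\<close> a detour over another index is needed.\<close>

lemma longs_congruent_orbit:
  assumes "s \<in> {-1, 1}" "s' \<in> {-1, 1}" "i \<in> {1..l}" "j \<in> {1..l}" "\<delta> \<in> V0" "x \<in> L" "\<delta>' = \<delta> + 2 *\<^sub>R x"
  shows "(2 * s') *\<^sub>R e j + \<delta>' \<in> orb ((2 * s) *\<^sub>R e i + \<delta>)"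
proof -
  have move: "(2 * s') *\<^sub>R e j + (\<delta> + 2 *\<^sub>R x) \<in> orb ((2 * s) *\<^sub>R e i + \<delta>)"
    if h: "s \<in> {-1, 1}" "s' \<in> {-1, 1}" "i \<in> {1..l}" "j \<in> {1..l}" "i \<noteq> j" "x \<in> L" for s s' i j x
  proof -
    define \<gamma> where "\<gamma> = s *\<^sub>R e i + (- s') *\<^sub>R e j + (- x)"
    have s': "- s' \<in> {-1, 1}" and x: "- x \<in> L" using h additive_group_minus[OF L_group] by auto
    have "\<gamma> \<in> X" using h s' x unfolding affine_short_def \<gamma>_def by blast
    moreover have "B \<gamma> \<gamma> = 2 * c" unfolding \<gamma>_def by (rule B_short(1)[OF h(1) s' h(3-5) x])
    moreover have "B (e i) \<gamma> = c * s" unfolding \<gamma>_def B_short(2)[OF h(1) s' h(3-5) x h(3)] using h by simp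
    then have "B ((2 * s) *\<^sub>R e i + \<delta>) \<gamma> = 2 * c" using h(1) assms(5) by (auto simp: B_simps rad)
    ultimately have "((2 * s) *\<^sub>R e i + \<delta>) - 2 *\<^sub>R \<gamma> \<in> orb ((2 * s) *\<^sub>R e i + \<delta>)"
      using orb_step[OF orb_refl, of \<gamma> "(2 * s) *\<^sub>R e i + \<delta>"] c0 by simp
    moreover have "((2 * s) *\<^sub>R e i + \<delta>) - 2 *\<^sub>R \<gamma> = (2 * s') *\<^sub>R e j + (\<delta> + 2 *\<^sub>R x)"
      by (simp add: \<gamma>_def algebra_simps)
    ultimately show ?thesis by simp
  qed
  show ?thesis
  proof (cases "i = j")
    case False
    then show ?thesis using move assms by blast
  next
    case True
    have "card {1..l} > card {i}" using l3 by simp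
    then have "\<not> {1..l} \<subseteq> {i}" using card_mono[of "{i}" "{1..l}"] by fastforce
    then obtain k where k: "k \<in> {1..l}" "k \<noteq> i" by blast
    have 1: "(2 * 1) *\<^sub>R e k + (\<delta> + 2 *\<^sub>R 0) \<in> orb ((2 * s) *\<^sub>R e i + \<delta>)"
      using k assms additive_group_0[OF L_group] by (intro move) auto
    have "(2 * s') *\<^sub>R e j + (\<delta> + 2 *\<^sub>R x) \<in> orb ((2 * 1) *\<^sub>R e k + \<delta>)"
      using k assms True by (intro move) auto
    with 1 show ?thesis using orb_trans assms(7) by simp
  qed
qed

lemma L_sign: "s \<in> {-1, 1} \<Longrightarrow> x \<in> L \<Longrightarrow> s *\<^sub>R x \<in> L"
  using additive_group_minus[OF L_group] by auto

lemma rfl_e: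
  assumes "\<alpha> \<in> X" "k \<in> {1..l}"
  obtains m t \<tau> where "m \<in> {1..l}" "t \<in> {-1, 1}" "\<tau> \<in> L" "rfl \<alpha> (e k, 0) = (t *\<^sub>R e m + \<tau>, 0)"
    "\<alpha> \<in> longs \<longrightarrow> m = k"
proof (cases "B (e k) \<alpha> = 0")
  case True
  then show thesis using that[of k 1 0] assms refl_apply[OF H_0, of \<alpha> "e k"] additive_group_0[OF L_group]
    by auto
next
  case nz: False
  show thesis
  proof (cases "\<alpha> \<in> longs")
    case True
    then obtain s i \<delta> where \<alpha>: "s \<in> {-1, 1}" "i \<in> {1..l}" "\<delta> \<in> D" "\<alpha> = (2 * s) *\<^sub>R e i + \<delta>"
      by (rule longsE)
    have "B (e k) \<alpha> = (if k = i then 2 * s * c else 0)"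
      unfolding \<alpha>(4) using \<alpha> V0_D assms by (intro B_long(2)) auto
    with nz have ki: "k = i" and Bk: "B (e k) \<alpha> = 2 * s * c" by (auto split: if_splits)
    have "rfl \<alpha> (e k, 0) = (e k - s *\<^sub>R \<alpha>, 0)"
      using refl_apply[OF H_0, of \<alpha> "e k"] B_longs[OF True] Bk c0 by simp
    also have "e k - s *\<^sub>R \<alpha> = (-1) *\<^sub>R e k + (- s) *\<^sub>R \<delta>"
      using \<alpha>(1) by (auto simp: \<alpha>(4) ki algebra_simps scaleR_2)
    finally show thesis using ki assms L_sign[of "- s" \<delta>] \<alpha>(1) LD[OF \<alpha>(3)]
      by (intro that[of k "-1" "(- s) *\<^sub>R \<delta>"]) auto
  next
    case False
    then have sh: "\<alpha> \<in> shorts" using assms by blast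
    then obtain s s' i j \<tau> where \<alpha>: "s \<in> {-1, 1}" "s' \<in> {-1, 1}" "i \<in> {1..l}" "j \<in> {1..l}" "i \<noteq> j" "\<tau> \<in> L"
      "\<alpha> = s *\<^sub>R e i + s' *\<^sub>R e j + \<tau>" by (rule shortsE)
    have "B (e k) \<alpha> = c * ((if k = i then s else 0) + (if k = j then s' else 0))"
      unfolding \<alpha>(7) by (rule B_short(2)[OF \<alpha>(1-6) assms(2)])
    with nz \<alpha>(5) consider "k = i" "B (e k) \<alpha> = c * s" | "k = j" "B (e k) \<alpha> = c * s'"
      by (auto split: if_splits)
    then show thesis
    proof cases
      case 1
      have "rfl \<alpha> (e k, 0) = (e k - s *\<^sub>R \<alpha>, 0)"
        using refl_apply[OF H_0, of \<alpha> "e k"] B_shorts[OF sh] 1 c0 by simp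
      also have "e k - s *\<^sub>R \<alpha> = (- s * s') *\<^sub>R e j + (- s) *\<^sub>R \<tau>"
        using \<alpha>(1) by (auto simp: \<alpha>(7) 1(1) algebra_simps)
      finally show thesis using \<alpha> False L_sign[of "- s" \<tau>]
        by (intro that[of j "- s * s'" "(- s) *\<^sub>R \<tau>"]) auto
    next
      case 2
      have "rfl \<alpha> (e k, 0) = (e k - s' *\<^sub>R \<alpha>, 0)"
        using refl_apply[OF H_0, of \<alpha> "e k"] B_shorts[OF sh] 2 c0 by simp
      also have "e k - s' *\<^sub>R \<alpha> = (- s * s') *\<^sub>R e i + (- s') *\<^sub>R \<tau>"
        using \<alpha>(2) by (auto simp: \<alpha>(7) 2(1) algebra_simps)
      finally show thesis using \<alpha> False L_sign[of "- s'" \<tau>]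
        by (intro that[of i "- s * s'" "(- s') *\<^sub>R \<tau>"]) auto
    qed
  qed
qed

lemma GL_affine:
  assumes "w \<in> carrier G"
  shows "w (a *\<^sub>R x + y, 0) = a *\<^sub>R w (x, 0) + w (y, 0)"
  using GL_add[OF assms H_0[of "a *\<^sub>R x"] H_0[of y]] GL_scale[OF assms H_0[of x], of a] by simp

text \<open>Modulo the radical, the Weyl group acts by signed permutations of the \<open>\<epsilon>\<^sub>i\<close>; the point is that
  the isotropic parts of the images of the \<open>\<epsilon>\<^sub>i\<close> stay in \<open>L\<close>.\<close>

definition "signed_perm w \<longleftrightarrow> (\<forall>\<delta>\<in>V0. w (\<delta>, 0) = (\<delta>, 0)) \<and>
  (\<forall>k\<in>{1..l}. \<exists>m\<in>{1..l}. \<exists>s\<in>{-1, 1}. \<exists>\<tau>\<in>L. w (e k, 0) = (s *\<^sub>R e m + \<tau>, 0))"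

lemma mult_refl_V0:
  assumes "w \<in> carrier G" "\<alpha> \<in> X" "\<delta> \<in> V0"
  shows "(w \<otimes>\<^bsub>G\<^esub> rfl \<alpha>) (\<delta>, 0) = w (\<delta>, 0)"
  using mult_refl_apply[OF assms(1) B_roots[OF assms(2)] H_0, of \<delta>] rad[OF assms(3)] by simp

lemma mult_refl_e:
  assumes w: "w \<in> carrier G" "\<forall>\<delta>\<in>V0. w (\<delta>, 0) = (\<delta>, 0)" and "\<alpha> \<in> X" "k \<in> {1..l}"
  obtains m t \<tau> where "m \<in> {1..l}" "t \<in> {-1, 1}" "\<tau> \<in> L"
    "(w \<otimes>\<^bsub>G\<^esub> rfl \<alpha>) (e k, 0) = t *\<^sub>R w (e m, 0) + (\<tau>, 0)" "\<alpha> \<in> longs \<longrightarrow> m = k"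
proof -
  obtain m t \<tau> where m: "m \<in> {1..l}" "t \<in> {-1, 1}" "\<tau> \<in> L" "rfl \<alpha> (e k, 0) = (t *\<^sub>R e m + \<tau>, 0)"
    "\<alpha> \<in> longs \<longrightarrow> m = k"
    using rfl_e[OF assms(3,4)] by blast
  have "(w \<otimes>\<^bsub>G\<^esub> rfl \<alpha>) (e k, 0) = t *\<^sub>R w (e m, 0) + (\<tau>, 0)"
    using GL_mult_apply[OF w(1) refl_in_GL[OF B_roots[OF assms(3)]] H_0] m(3,4) GL_affine[OF w(1)] w(2) V0_L
    by simp
  then show thesis using m that by blast
qed

lemma signed_perm_mult:
  assumes w: "w \<in> carrier G" "signed_perm w" and \<alpha>: "\<alpha> \<in> X"
  shows "signed_perm (w \<otimes>\<^bsub>G\<^esub> rfl \<alpha>)"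
  unfolding signed_perm_def
proof (intro conjI ballI)
  have fixV0: "\<forall>\<delta>\<in>V0. w (\<delta>, 0) = (\<delta>, 0)" using w(2) by (simp add: signed_perm_def)
  then show "(w \<otimes>\<^bsub>G\<^esub> rfl \<alpha>) (\<delta>, 0) = (\<delta>, 0)" if "\<delta> \<in> V0" for \<delta>
    using that mult_refl_V0[OF w(1) \<alpha> that] by simp
  fix k assume k: "k \<in> {1..l}"
  obtain m t \<tau> where m: "m \<in> {1..l}" "t \<in> {-1, 1}" "\<tau> \<in> L"
    "(w \<otimes>\<^bsub>G\<^esub> rfl \<alpha>) (e k, 0) = t *\<^sub>R w (e m, 0) + (\<tau>, 0)"
    using mult_refl_e[OF w(1) fixV0 \<alpha> k] by blast
  obtain m' t' \<tau>' where m': "m' \<in> {1..l}" "t' \<in> {-1, 1}" "\<tau>' \<in> L" "w (e m, 0) = (t' *\<^sub>R e m' + \<tau>', 0)"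
    using w(2) m(1) unfolding signed_perm_def by blast
  have "(w \<otimes>\<^bsub>G\<^esub> rfl \<alpha>) (e k, 0) = ((t * t') *\<^sub>R e m' + (t *\<^sub>R \<tau>' + \<tau>), 0)"
    unfolding m(4) m'(4) by (simp add: algebra_simps)
  moreover have "t * t' \<in> {-1, 1}" using m m' by auto
  moreover have "t *\<^sub>R \<tau>' + \<tau> \<in> L" using m m' L_sign additive_group_add[OF L_group] by blast
  ultimately show "\<exists>m\<in>{1..l}. \<exists>s\<in>{-1, 1}. \<exists>\<tau>\<in>L. (w \<otimes>\<^bsub>G\<^esub> rfl \<alpha>) (e k, 0) = (s *\<^sub>R e m + \<tau>, 0)"
    using m'(1) by blast
qed

lemma signed_perm_one: "signed_perm \<one>\<^bsub>G\<^esub>"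
  unfolding signed_perm_def using additive_group_0[OF L_group]
  by (simp only: GL_one_apply H_0) (intro conjI ballI, simp, intro bexI[of _ _] bexI[of _ 1] bexI[of _ 0], auto)

lemma W_signed_perm:
  assumes "w \<in> W A" "A \<subseteq> X" shows "signed_perm w"
  using assms(2) signed_perm_mult B_roots
  by (intro reflection_group_induct[OF _ assms(1), where P = signed_perm] signed_perm_one) blast+

text \<open>The orbit of a long root does not leave the class of its isotropic part modulo \<open>2L\<close>. For the
  class of \<open>0\<close> this follows from \<open>w (2\<epsilon>\<^sub>k) = 2 w (\<epsilon>\<^sub>k)\<close>.\<close>

lemma orb_long_zero_class:
  assumes "\<beta> \<in> orb (2 *\<^sub>R e k)" "k \<in> {1..l}"
  obtains m s \<tau> where "m \<in> {1..l}" "s \<in> {-1, 1}" "\<tau> \<in> L" "\<beta> = (2 * s) *\<^sub>R e m + 2 *\<^sub>R \<tau>"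
proof -
  obtain w where w: "w \<in> W X" "w (2 *\<^sub>R e k, 0) = (\<beta>, 0)" using assms by (auto simp: orb_iff)
  obtain m s \<tau> where m: "m \<in> {1..l}" "s \<in> {-1, 1}" "\<tau> \<in> L" "w (e k, 0) = (s *\<^sub>R e m + \<tau>, 0)"
    using W_signed_perm[OF w(1) order_refl] assms(2) unfolding signed_perm_def by blast
  have "(\<beta>, 0) = 2 *\<^sub>R w (e k, 0)"
    using w(2) GL_scale[OF W_X_carrier[OF w(1)] H_0[of "e k"], of 2] by simp
  then have "\<beta> = (2 * s) *\<^sub>R e m + 2 *\<^sub>R \<tau>" unfolding m(4) by (simp add: algebra_simps)
  then show thesis using m that by blast
qed

text \<open>Modulo the radical, long reflections preserve every line spanned by an \<open>\<epsilon>\<^sub>i\<close>, whereas a short one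
  interchanges two of these lines.\<close>

lemma short_reflection_not_generated_by_longs:
  assumes "A \<subseteq> longs" "\<alpha> \<in> shorts" shows "rfl \<alpha> \<notin> W A"
proof
  assume "rfl \<alpha> \<in> W A"
  obtain s s' i j \<tau> where \<alpha>: "s \<in> {-1, 1}" "s' \<in> {-1, 1}" "i \<in> {1..l}" "j \<in> {1..l}" "i \<noteq> j" "\<tau> \<in> L"
    "\<alpha> = s *\<^sub>R e i + s' *\<^sub>R e j + \<tau>" using assms(2) by (rule shortsE)
  define P where "P w \<longleftrightarrow> (\<forall>\<delta>\<in>V0. w (\<delta>, 0) = (\<delta>, 0)) \<and> B (fst (w (e i, 0))) (e j) = 0"
    for w :: "'v \<times> ('v \<Rightarrow>\<^sub>L real) \<Rightarrow> 'v \<times> ('v \<Rightarrow>\<^sub>L real)"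
  have "P (rfl \<alpha>)"
  proof (rule reflection_group_induct[OF _ \<open>rfl \<alpha> \<in> W A\<close>, where P = P])
    show "B \<beta> \<beta> \<noteq> 0" if "\<beta> \<in> A" for \<beta> using that assms(1) B_roots by blast
    show "P \<one>\<^bsub>G\<^esub>" using \<alpha> by (simp add: P_def GL_one_apply[OF H_0] B_e)
  next
    fix w \<beta> assume w: "w \<in> carrier G" "P w" and \<beta>: "\<beta> \<in> A"
    have \<beta>X: "\<beta> \<in> X" "\<beta> \<in> longs" using \<beta> assms(1) by auto
    have fixV0: "\<forall>\<delta>\<in>V0. w (\<delta>, 0) = (\<delta>, 0)" using w(2) by (simp add: P_def)
    obtain m t \<tau> where m: "m \<in> {1..l}" "t \<in> {-1, 1}" "\<tau> \<in> L"
      "(w \<otimes>\<^bsub>G\<^esub> rfl \<beta>) (e i, 0) = t *\<^sub>R w (e m, 0) + (\<tau>, 0)" "m = i"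
      using mult_refl_e[OF w(1) fixV0 \<beta>X(1) \<alpha>(3)] \<beta>X(2) by metis
    then have "B (fst ((w \<otimes>\<^bsub>G\<^esub> rfl \<beta>) (e i, 0))) (e j) = 0"
      using w(2) V0_L by (simp add: P_def B_simps rad)
    then show "P (w \<otimes>\<^bsub>G\<^esub> rfl \<beta>)"
      using fixV0 mult_refl_V0[OF w(1) \<beta>X(1)] by (simp add: P_def)
  qed
  moreover have "rfl \<alpha> (e i, 0) = (e i - s *\<^sub>R \<alpha>, 0)"
  proof -
    have "B (e i) \<alpha> = c * s" unfolding \<alpha>(7) B_short(2)[OF \<alpha>(1-6,3)] using \<alpha>(5) by simp
    then show ?thesis using refl_apply[OF H_0, of \<alpha> "e i"] B_shorts[OF assms(2)] c0 by simp
  qed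
  moreover have "B \<alpha> (e j) = c * s'"
    unfolding sym[of \<alpha>] unfolding \<alpha>(7) B_short(2)[OF \<alpha>(1-6,4)] using \<alpha>(5) by simp
  ultimately show False using \<alpha>(1-5) c0 by (auto simp: P_def B_simps B_e)
qed

end

section \<open>Parity invariants of the Weyl group\<close>

definition cong2 :: "real \<Rightarrow> real \<Rightarrow> bool" where
  "cong2 x y \<longleftrightarrow> (x - y) / 2 \<in> \<int>"

lemma cong2_refl: "cong2 x x"
  by (simp add: cong2_def)

lemma cong2_trans: "cong2 x y \<Longrightarrow> cong2 y z \<Longrightarrow> cong2 x z"
  unfolding cong2_def using Ints_add[of "(x - y) / 2" "(y - z) / 2"] by (simp add: diff_divide_distrib)

lemma cong2_sym: "cong2 x y \<Longrightarrow> cong2 y x"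
  unfolding cong2_def using Ints_minus[of "(x - y) / 2"] by (simp add: diff_divide_distrib)

lemma cong2_add: "cong2 x y \<Longrightarrow> cong2 x' y' \<Longrightarrow> cong2 (x + x') (y + y')"
proof -
  assume "cong2 x y" "cong2 x' y'"
  then have "(x - y) / 2 + (x' - y') / 2 \<in> \<int>" by (simp add: cong2_def)
  moreover have "(x - y) / 2 + (x' - y') / 2 = (x + x' - (y + y')) / 2" by (simp add: field_simps)
  ultimately show ?thesis by (simp add: cong2_def)
qed

lemma cong2_of_int: "cong2 (of_int a) (of_int b) \<longleftrightarrow> even (a - b)"
proof
  assume "cong2 (of_int a) (of_int b)"
  then obtain k where "(real_of_int a - of_int b) / 2 = of_int k" by (auto simp: cong2_def elim: Ints_cases)
  then have "real_of_int (a - b) = of_int (2 * k)" by simp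
  then have "a - b = 2 * k" by (simp only: of_int_eq_iff)
  then show "even (a - b)" by simp
next
  assume "even (a - b)"
  then obtain k where "a - b = 2 * k" by blast
  then have "(real_of_int a - of_int b) / 2 = of_int k" by (simp flip: of_int_diff)
  then show "cong2 (of_int a) (of_int b)" by (simp add: cong2_def)
qed

text \<open>Symmetric difference with a singleton, that is, addition of a basis vector in the space of finite sets
  over the field with two elements.\<close>

definition toggle :: "'b \<Rightarrow> 'b set \<Rightarrow> 'b set" where
  "toggle J T = (if J \<in> T then T - {J} else insert J T)"

lemma card_toggle_cong2:
  assumes "finite T"
  shows "cong2 (card {K \<in> toggle J T. P K}) (real (card {K \<in> T. P K}) + of_bool (P J))"
proof -
  have "{K \<in> toggle J T. P K} = (if P J then toggle J {K \<in> T. P K} else {K \<in> T. P K})"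
    by (auto simp: toggle_def)
  moreover have "cong2 (card (toggle J T')) (card T' + 1)" if "finite T'" for T'
  proof (cases "J \<in> T'")
    case True
    have "card T' = Suc (card (T' - {J}))" by (rule card.remove[OF that True])
    then show ?thesis using True by (simp add: toggle_def cong2_def del: card_Diff_singleton)
  next
    case False
    then show ?thesis using that by (simp add: toggle_def cong2_def)
  qed
  ultimately show ?thesis using assms by (simp add: cong2_refl add.commute)
qed

text \<open>The functionals \<open>lam i\<close> are coordinates of \<open>L\<close>. They vanish on \<open>Vdot\<close> and hence are
  vectors of the extended space.\<close>

locale affine_C_coordinates = affine_C B Vdot V0 e c l L D R
  for B :: "'v::euclidean_space \<Rightarrow> 'v \<Rightarrow> real" and Vdot V0 e c l L D R +
  fixes I :: "'i set" and lam :: "'i \<Rightarrow> 'v \<Rightarrow>\<^sub>L real"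
  assumes lam_dot: "\<And>i y. i \<in> I \<Longrightarrow> y \<in> Vdot \<Longrightarrow> blinfun_apply (lam i) y = 0"
    and lam_L: "\<And>i x. i \<in> I \<Longrightarrow> x \<in> L \<Longrightarrow> blinfun_apply (lam i) x \<in> \<int>"
begin

text \<open>The point of the space \<open>F\<^sub>2\<^sup>n\<close> that \<open>\<delta>\<close> defines, encoded like the members of a support.\<close>

definition cls :: "'v \<Rightarrow> 'i set" where
  "cls \<delta> = {i \<in> I. odd \<lfloor>blinfun_apply (lam i) \<delta>\<rfloor>}"

text \<open>The form on the extended space pairs \<open>w (lam i)\<close> with \<open>lam j\<close>; up to the factor \<open>2c\<close> the
  result is \<open>chi i j w\<close>. For a translation in \<open>W\<close> it combines the scalar products of the
  \<open>Vdot\<close>-valued coordinates with the central coordinate of a Heisenberg group. The factor \<open>2c\<close> makes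
  it integral. The number \<open>chi0 w\<close> is minus the number of the \<open>\<epsilon>\<^sub>i\<close> whose sign \<open>w\<close> reverses: modulo
  the radical, \<open>w (rho)\<close> is the sum of the signed \<open>\<epsilon>\<^sub>i\<close>.\<close>

definition "rho = (\<Sum>k\<in>{1..l}. e k)"

definition "chi i j w = 2 * c * blinfun_apply (lam j) (fst (w (0, lam i)))"

definition "chi0 w = (B (fst (w (rho, 0))) rho - l * c) / (2 * c)"

text \<open>This says that \<open>w\<close> takes the same values modulo 2 as a product of long reflections with one factor
  in each class of \<open>T\<close>.\<close>

definition "parity T w \<longleftrightarrow> (\<forall>i\<in>I. \<forall>j\<in>I. cong2 (chi i j w) (card {J \<in> T. i \<in> J \<and> j \<in> J})) \<and>
  cong2 (chi0 w) (card T)"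

lemma H_lam: "i \<in> I \<Longrightarrow> (x, lam i) \<in> H"
  using lam_dot by (simp add: H_iff)

lemma lam_e: "i \<in> I \<Longrightarrow> k \<in> {1..l} \<Longrightarrow> blinfun_apply (lam i) (e k) = 0"
  using lam_dot e_dot by blast

lemma B_e_rho: "k \<in> {1..l} \<Longrightarrow> B (e k) rho = c"
proof -
  assume k: "k \<in> {1..l}"
  have "B (e k) rho = (\<Sum>m\<in>{1..l}. B (e k) (e m))"
    unfolding rho_def using bil by (simp add: bilinear_def linear_sum)
  also have "\<dots> = (\<Sum>m\<in>{1..l}. if m = k then c else 0)"
    using k by (intro sum.cong) (auto simp: B_e)
  finally show ?thesis using k by simp
qed

lemma B_rho_rho: "B rho rho = l * c"
proof -
  have "linear (\<lambda>x. B x rho)" using bil by (simp add: bilinear_def)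
  then have "B rho rho = (\<Sum>m\<in>{1..l}. B (e m) rho)"
    by (subst (1) rho_def) (rule linear_sum)
  then show ?thesis by (simp add: B_e_rho)
qed

lemma parity_one: "parity {} \<one>\<^bsub>G\<^esub>"
  using c0 by (simp add: parity_def chi_def chi0_def GL_one_apply H_0 H_lam B_rho_rho cong2_refl blinfun.zero_right)

lemma cong2_nat_even:
  assumes "cong2 x (real a)" "cong2 x (real b)" shows "even (a + b)"
proof -
  have "cong2 (of_int (int a)) (of_int (int b))" using cong2_trans[OF cong2_sym[OF assms(1)] assms(2)] by simp
  then have "even (int a - int b)" by (simp only: cong2_of_int)
  then show ?thesis by presburger
qed

lemma parity_unique_pairs:
  "parity T w \<Longrightarrow> parity T' w \<Longrightarrow> i \<in> I \<Longrightarrow> j \<in> I \<Longrightarrow>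
    even (card {J \<in> T. i \<in> J \<and> j \<in> J} + card {J \<in> T'. i \<in> J \<and> j \<in> J})"
  by (rule cong2_nat_even[of "chi i j w"]) (simp_all add: parity_def)

lemma parity_unique_card: "parity T w \<Longrightarrow> parity T' w \<Longrightarrow> even (card T + card T')"
  by (rule cong2_nat_even[of "chi0 w"]) (simp_all add: parity_def)

lemma chi_mult:
  assumes w: "w \<in> carrier G" and \<alpha>: "\<alpha> \<in> X" and i: "i \<in> I"
  shows "chi i j (w \<otimes>\<^bsub>G\<^esub> rfl \<alpha>) = chi i j w
    - 4 * c / B \<alpha> \<alpha> * blinfun_apply (lam i) \<alpha> * blinfun_apply (lam j) (fst (w (\<alpha>, 0)))"
  unfolding chi_def mult_refl_apply[OF w B_roots[OF \<alpha>] H_lam[OF i]]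
  by (simp add: B_simps blinfun.diff_right blinfun.scaleR_right algebra_simps)

lemma chi0_mult:
  assumes w: "w \<in> carrier G" and \<alpha>: "\<alpha> \<in> X"
  shows "chi0 (w \<otimes>\<^bsub>G\<^esub> rfl \<alpha>) = chi0 w - B rho \<alpha> / B \<alpha> \<alpha> * (B (fst (w (\<alpha>, 0))) rho / c)"
  unfolding chi0_def mult_refl_apply[OF w B_roots[OF \<alpha>] H_0] using c0 B_roots[OF \<alpha>]
  by (simp add: B_simps field_simps)

text \<open>The factor \<open>4c / (\<alpha>, \<alpha>)\<close> is \<open>2\<close> for a short root, so the change of \<open>chi\<close> is even; and a
  short reflection reverses either no sign or two.\<close>

lemma parity_short:
  assumes w: "w \<in> carrier G" "signed_perm w" and \<alpha>: "\<alpha> \<in> shorts" and T: "parity T w"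
  shows "parity T (w \<otimes>\<^bsub>G\<^esub> rfl \<alpha>)"
proof -
  have X: "\<alpha> \<in> X" using \<alpha> by blast
  obtain s s' p q \<tau> where sh: "s \<in> {-1, 1}" "s' \<in> {-1, 1}" "p \<in> {1..l}" "q \<in> {1..l}" "p \<noteq> q" "\<tau> \<in> L"
    "\<alpha> = s *\<^sub>R e p + s' *\<^sub>R e q + \<tau>" using \<alpha> by (rule shortsE)
  obtain p' t \<tau>1 where p': "p' \<in> {1..l}" "t \<in> {-1, 1}" "\<tau>1 \<in> L" "w (e p, 0) = (t *\<^sub>R e p' + \<tau>1, 0)"
    using w(2) sh(3) unfolding signed_perm_def by blast
  obtain q' t' \<tau>2 where q': "q' \<in> {1..l}" "t' \<in> {-1, 1}" "\<tau>2 \<in> L" "w (e q, 0) = (t' *\<^sub>R e q' + \<tau>2, 0)"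
    using w(2) sh(4) unfolding signed_perm_def by blast
  have "w (\<tau>, 0) = (\<tau>, 0)" using w(2) sh(6) V0_L unfolding signed_perm_def by blast
  then have w\<alpha>: "fst (w (\<alpha>, 0)) = s *\<^sub>R (t *\<^sub>R e p' + \<tau>1) + (s' *\<^sub>R (t' *\<^sub>R e q' + \<tau>2) + \<tau>)"
    unfolding sh(7) add.assoc GL_affine[OF w(1)] p'(4) q'(4) by simp
  show ?thesis unfolding parity_def
  proof (intro conjI ballI)
    fix i j assume ij: "i \<in> I" "j \<in> I"
    have \<alpha>i: "blinfun_apply (lam i) \<alpha> = blinfun_apply (lam i) \<tau>"
      using ij sh by (simp add: blinfun.add_right blinfun.scaleR_right lam_e)
    have "blinfun_apply (lam j) (fst (w (\<alpha>, 0)))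
      = s * blinfun_apply (lam j) \<tau>1 + s' * blinfun_apply (lam j) \<tau>2 + blinfun_apply (lam j) \<tau>"
      unfolding w\<alpha> using ij p' q' by (simp add: blinfun.add_right blinfun.scaleR_right lam_e)
    also have "\<dots> \<in> \<int>" using sh(1,2) lam_L ij sh p' q' by (intro Ints_add Ints_mult) auto
    finally have "blinfun_apply (lam i) \<alpha> * blinfun_apply (lam j) (fst (w (\<alpha>, 0))) \<in> \<int>"
      unfolding \<alpha>i by (rule Ints_mult[OF lam_L[OF ij(1) sh(6)]])
    then have "cong2 (chi i j (w \<otimes>\<^bsub>G\<^esub> rfl \<alpha>)) (chi i j w)"
      unfolding chi_mult[OF w(1) X ij(1)] B_shorts[OF \<alpha>] cong2_def using c0 by (simp add: mult.assoc)
    then show "cong2 (chi i j (w \<otimes>\<^bsub>G\<^esub> rfl \<alpha>)) (card {J \<in> T. i \<in> J \<and> j \<in> J})"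
      using T ij cong2_trans unfolding parity_def by blast
  next
    have rp: "B rho \<alpha> = (s + s') * c"
      unfolding sym[of rho] sh(7) using sh B_e_rho V0_L by (simp add: B_simps rad algebra_simps)
    have wr: "B (fst (w (\<alpha>, 0))) rho = (s * t + s' * t') * c"
      unfolding w\<alpha> using p' q' sh(6) B_e_rho V0_L by (simp add: B_simps rad algebra_simps)
    have "chi0 (w \<otimes>\<^bsub>G\<^esub> rfl \<alpha>) = chi0 w - (s + s') * (s * t + s' * t') / 2"
      unfolding chi0_mult[OF w(1) X] B_shorts[OF \<alpha>] rp wr using c0 by simp
    moreover have "(s + s') * (s * t + s' * t') / 2 \<in> {-2, 0, 2}"
      using sh(1,2) p'(2) q'(2) by auto
    ultimately have "cong2 (chi0 (w \<otimes>\<^bsub>G\<^esub> rfl \<alpha>)) (chi0 w)"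
      unfolding cong2_def by auto
    then show "cong2 (chi0 (w \<otimes>\<^bsub>G\<^esub> rfl \<alpha>)) (card T)"
      using T cong2_trans unfolding parity_def by blast
  qed
qed

text \<open>Modulo 2 this is the quadratic monomial \<open>x\<^sub>i x\<^sub>j\<close> evaluated at the class of \<open>\<delta>\<close>.\<close>

lemma cls_cong2:
  assumes "i \<in> I" "j \<in> I" "\<delta> \<in> L"
  shows "cong2 (- (blinfun_apply (lam i) \<delta> * blinfun_apply (lam j) \<delta>)) (of_bool (i \<in> cls \<delta> \<and> j \<in> cls \<delta>))"
proof -
  obtain a b where ab: "blinfun_apply (lam i) \<delta> = of_int a" "blinfun_apply (lam j) \<delta> = of_int b"
    using lam_L assms by (meson Ints_cases)
  have "cong2 (of_int (- (a * b))) (of_int (of_bool (odd a \<and> odd b)))"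
    unfolding cong2_of_int by auto
  then show ?thesis using assms by (simp add: cls_def ab)
qed

text \<open>The product of the coordinates \<open>i\<close> and \<open>j\<close> of \<open>\<delta>\<close> is the only odd contribution to
  \<open>chi i j\<close>, because \<open>w (2\<epsilon>\<^sub>k)\<close> has an isotropic part in \<open>2L\<close>. Exactly one sign changes.\<close>

lemma parity_long:
  assumes w: "w \<in> carrier G" "signed_perm w" and s: "s \<in> {-1, 1}" and k: "k \<in> {1..l}" and \<delta>: "\<delta> \<in> D"
    and T: "parity T w" "finite T"
  shows "parity (toggle (cls \<delta>) T) (w \<otimes>\<^bsub>G\<^esub> rfl ((2 * s) *\<^sub>R e k + \<delta>))"
proof -
  define \<alpha> where "\<alpha> = (2 * s) *\<^sub>R e k + \<delta>"
  have \<alpha>: "\<alpha> \<in> longs" unfolding \<alpha>_def affine_long_def using s k \<delta> by blast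
  have X: "\<alpha> \<in> X" using \<alpha> by blast
  obtain p t \<tau> where p: "p \<in> {1..l}" "t \<in> {-1, 1}" "\<tau> \<in> L" "w (e k, 0) = (t *\<^sub>R e p + \<tau>, 0)"
    using w(2) k unfolding signed_perm_def by blast
  have "w (\<delta>, 0) = (\<delta>, 0)" using w(2) \<delta> V0_D unfolding signed_perm_def by blast
  then have w\<alpha>: "fst (w (\<alpha>, 0)) = (2 * s) *\<^sub>R (t *\<^sub>R e p + \<tau>) + \<delta>"
    unfolding \<alpha>_def GL_affine[OF w(1)] p(4) by simp
  have "parity (toggle (cls \<delta>) T) (w \<otimes>\<^bsub>G\<^esub> rfl \<alpha>)" unfolding parity_def
  proof (intro conjI ballI)
    fix i j assume ij: "i \<in> I" "j \<in> I"
    let ?a = "blinfun_apply (lam i) \<delta>" and ?b = "blinfun_apply (lam j) \<tau>" and ?d = "blinfun_apply (lam j) \<delta>"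
    have \<alpha>i: "blinfun_apply (lam i) \<alpha> = ?a"
      using ij k by (simp add: \<alpha>_def blinfun.add_right blinfun.scaleR_right lam_e)
    have wj: "blinfun_apply (lam j) (fst (w (\<alpha>, 0))) = 2 * s * ?b + ?d"
      unfolding w\<alpha> using ij p by (simp add: blinfun.add_right blinfun.scaleR_right lam_e)
    have "chi i j (w \<otimes>\<^bsub>G\<^esub> rfl \<alpha>) = chi i j w + (- (?a * ?d)) - 2 * (s * ?a * ?b)"
      unfolding chi_mult[OF w(1) X ij(1)] B_longs[OF \<alpha>] \<alpha>i wj using c0 by (simp add: algebra_simps)
    moreover have "s * ?a * ?b \<in> \<int>"
      using s lam_L ij LD[OF \<delta>] p by (intro Ints_mult) auto
    ultimately have 1: "cong2 (chi i j (w \<otimes>\<^bsub>G\<^esub> rfl \<alpha>)) (chi i j w + (- (?a * ?d)))"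
      by (simp add: cong2_def)
    have 2: "cong2 (chi i j w + (- (?a * ?d)))
       (real (card {J \<in> T. i \<in> J \<and> j \<in> J}) + of_bool (i \<in> cls \<delta> \<and> j \<in> cls \<delta>))"
      using T ij by (intro cong2_add cls_cong2 LD[OF \<delta>]) (auto simp: parity_def)
    show "cong2 (chi i j (w \<otimes>\<^bsub>G\<^esub> rfl \<alpha>)) (card {J \<in> toggle (cls \<delta>) T. i \<in> J \<and> j \<in> J})"
      by (rule cong2_trans[OF cong2_trans[OF 1 2] cong2_sym[OF card_toggle_cong2[OF T(2)]]])
  next
    have rp: "B rho \<alpha> = 2 * s * c"
      unfolding sym[of rho] \<alpha>_def using k B_e_rho V0_D \<delta> by (simp add: B_simps rad)
    have wr: "B (fst (w (\<alpha>, 0))) rho = 2 * s * t * c"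
      unfolding w\<alpha> using p B_e_rho V0_L V0_D \<delta> by (simp add: B_simps rad)
    have "chi0 (w \<otimes>\<^bsub>G\<^esub> rfl \<alpha>) = chi0 w - t"
      unfolding chi0_mult[OF w(1) X] B_longs[OF \<alpha>] rp wr using c0 s by auto
    then have 1: "cong2 (chi0 (w \<otimes>\<^bsub>G\<^esub> rfl \<alpha>)) (chi0 w + 1)"
      using p(2) by (auto simp: cong2_def)
    have "cong2 (chi0 w + 1) (real (card T) + of_bool True)"
      using T by (intro cong2_add) (auto simp: parity_def cong2_refl)
    then have 2: "cong2 (chi0 w + 1) (real (card {J \<in> T. True}) + of_bool True)" by simp
    have "cong2 (chi0 (w \<otimes>\<^bsub>G\<^esub> rfl \<alpha>)) (card {J \<in> toggle (cls \<delta>) T. True})"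
      by (rule cong2_trans[OF cong2_trans[OF 1 2] cong2_sym[OF card_toggle_cong2[OF T(2)]]])
    then show "cong2 (chi0 (w \<otimes>\<^bsub>G\<^esub> rfl \<alpha>)) (card (toggle (cls \<delta>) T))" by simp
  qed
  then show ?thesis unfolding \<alpha>_def .
qed

lemma W_parity:
  assumes "w \<in> W A" "A \<subseteq> shorts \<union> affine_long e l {\<delta> \<in> D. cls \<delta> \<in> K}"
  shows "\<exists>T. finite T \<and> T \<subseteq> K \<and> parity T w"
proof -
  have sub: "affine_long e l {\<delta> \<in> D. cls \<delta> \<in> K} \<subseteq> longs" unfolding affine_long_def by blast
  have "signed_perm w \<and> (\<exists>T. finite T \<and> T \<subseteq> K \<and> parity T w)"
  proof (rule reflection_group_induct[OF _ assms(1)])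
    show "B \<alpha> \<alpha> \<noteq> 0" if "\<alpha> \<in> A" for \<alpha> using that assms(2) sub B_roots by blast
    show "signed_perm \<one>\<^bsub>G\<^esub> \<and> (\<exists>T. finite T \<and> T \<subseteq> K \<and> parity T \<one>\<^bsub>G\<^esub>)"
      using parity_one signed_perm_one by blast
  next
    fix w \<alpha> assume w: "w \<in> carrier G" "signed_perm w \<and> (\<exists>T. finite T \<and> T \<subseteq> K \<and> parity T w)" and "\<alpha> \<in> A"
    then obtain T where T: "finite T" "T \<subseteq> K" "parity T w" by blast
    have \<alpha>: "\<alpha> \<in> shorts \<or> \<alpha> \<in> affine_long e l {\<delta> \<in> D. cls \<delta> \<in> K}" "\<alpha> \<in> X"
      using \<open>\<alpha> \<in> A\<close> assms(2) sub by blast+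
    from \<alpha>(1) have "\<exists>T. finite T \<and> T \<subseteq> K \<and> parity T (w \<otimes>\<^bsub>G\<^esub> rfl \<alpha>)"
    proof
      assume "\<alpha> \<in> shorts"
      then show ?thesis using parity_short[OF w(1)] w(2) T by blast
    next
      assume "\<alpha> \<in> affine_long e l {\<delta> \<in> D. cls \<delta> \<in> K}"
      then obtain s k \<delta> where h: "s \<in> {-1, 1}" "k \<in> {1..l}" "\<delta> \<in> D" "cls \<delta> \<in> K" "\<alpha> = (2 * s) *\<^sub>R e k + \<delta>"
        unfolding affine_long_def by blast
      have "finite (toggle (cls \<delta>) T)" "toggle (cls \<delta>) T \<subseteq> K" using T h by (auto simp: toggle_def)
      then show ?thesis using parity_long[OF w(1) _ h(1-3) T(3,1)] w(2) h(5) by blast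
    qed
    then show "signed_perm (w \<otimes>\<^bsub>G\<^esub> rfl \<alpha>) \<and> (\<exists>T. finite T \<and> T \<subseteq> K \<and> parity T (w \<otimes>\<^bsub>G\<^esub> rfl \<alpha>))"
      using signed_perm_mult[OF w(1) conjunct1[OF w(2)] \<alpha>(2)] by (rule conjI[rotated])
  qed
  then show ?thesis by blast
qed

text \<open>The reflection has the parities of \<open>{cls \<delta>}\<close>. If it is also a product of reflections in short roots
  and in long roots of other classes, then it has the parities of a set \<open>T\<close> that omits \<open>cls \<delta>\<close>. The
  union of both is the dependency.\<close>

lemma long_reflection_dependency:
  assumes "s \<in> {-1, 1}" "k \<in> {1..l}" "\<delta> \<in> D"
    and A: "A \<subseteq> shorts \<union> affine_long e l {\<delta>' \<in> D. cls \<delta>' \<noteq> cls \<delta>}"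
    and gen: "rfl ((2 * s) *\<^sub>R e k + \<delta>) \<in> W A"
  obtains T where "finite T" "T \<noteq> {}" "T \<subseteq> cls ` D" "even (card T)"
    "\<And>i j. i \<in> I \<Longrightarrow> j \<in> I \<Longrightarrow> even (card {J \<in> T. i \<in> J \<and> j \<in> J})"
proof -
  let ?\<alpha> = "(2 * s) *\<^sub>R e k + \<delta>" and ?J = "cls \<delta>"
  have "A \<subseteq> shorts \<union> affine_long e l {\<delta>' \<in> D. cls \<delta>' \<in> cls ` D - {?J}}"
    using A unfolding affine_long_def by blast
  from W_parity[OF gen this] obtain T where T: "finite T" "T \<subseteq> cls ` D - {?J}" "parity T (rfl ?\<alpha>)" by blast
  have \<alpha>: "?\<alpha> \<in> longs" using assms(1-3) unfolding affine_long_def by blast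
  then have "rfl ?\<alpha> \<in> carrier G" using refl_in_GL B_roots by blast
  then have "\<one>\<^bsub>G\<^esub> \<otimes>\<^bsub>G\<^esub> rfl ?\<alpha> = rfl ?\<alpha>" by simp
  then have J: "parity {?J} (rfl ?\<alpha>)"
    using parity_long[OF G.one_closed signed_perm_one assms(1-3) parity_one] by (simp add: toggle_def)
  show thesis
  proof (rule that[of "insert ?J T"])
    show "even (card (insert ?J T))"
      using parity_unique_card[OF T(3) J] T(1,2) by (subst card_insert_disjoint) auto
    fix i j assume ij: "i \<in> I" "j \<in> I"
    have "{K \<in> insert ?J T. i \<in> K \<and> j \<in> K} = {K \<in> T. i \<in> K \<and> j \<in> K} \<union> {K \<in> {?J}. i \<in> K \<and> j \<in> K}"
      by auto
    moreover have "card \<dots> = card {K \<in> T. i \<in> K \<and> j \<in> K} + card {K \<in> {?J}. i \<in> K \<and> j \<in> K}"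
      using T by (intro card_Un_disjoint) auto
    ultimately show "even (card {K \<in> insert ?J T. i \<in> K \<and> j \<in> K})"
      using parity_unique_pairs[OF T(3) J ij] by simp
  qed (use T assms in auto)
qed

end

context affine_C_coordinates
begin

text \<open>If \<open>cls\<close> separates the classes modulo \<open>2L\<close>, then omitting the orbit of a long root omits all long
  roots of its class.\<close>

lemma minimal_if_no_dependency:
  assumes sep: "\<And>\<delta> \<delta>'. \<delta> \<in> D \<Longrightarrow> \<delta>' \<in> D \<Longrightarrow> cls \<delta> = cls \<delta>' \<Longrightarrow> \<exists>x\<in>L. \<delta>' = \<delta> + 2 *\<^sub>R x"
    and nodep: "\<And>T. finite T \<Longrightarrow> T \<noteq> {} \<Longrightarrow> T \<subseteq> cls ` D \<Longrightarrow> even (card T) \<Longrightarrow>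
      (\<And>i j. i \<in> I \<Longrightarrow> j \<in> I \<Longrightarrow> even (card {J \<in> T. i \<in> J \<and> j \<in> J})) \<Longrightarrow> False"
  shows "minimal_ears B Vdot R"
  unfolding minimal_ears_def
proof
  assume "\<exists>\<alpha>\<in>nonisotropic B R. W (nonisotropic B R - orb \<alpha>) = weyl_group B Vdot R"
  then obtain \<alpha> where \<alpha>: "\<alpha> \<in> X" and gen: "W (X - orb \<alpha>) = W X"
    unfolding weyl_group_def roots by blast
  have in_W: "rfl \<alpha> \<in> W (X - orb \<alpha>)" unfolding gen by (rule refl_in_W[OF \<alpha>])
  from \<alpha> show False
  proof
    assume sh: "\<alpha> \<in> shorts"
    have "X - orb \<alpha> \<subseteq> longs" using shorts_single_orbit[OF sh] by blast
    from short_reflection_not_generated_by_longs[OF this sh] show False using in_W by contradiction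
  next
    assume "\<alpha> \<in> longs"
    then obtain s k \<delta> where h: "s \<in> {-1, 1}" "k \<in> {1..l}" "\<delta> \<in> D" "\<alpha> = (2 * s) *\<^sub>R e k + \<delta>"
      by (rule longsE)
    have sub: "X - orb \<alpha> \<subseteq> shorts \<union> affine_long e l {\<delta>' \<in> D. cls \<delta>' \<noteq> cls \<delta>}"
    proof
      fix \<beta> assume \<beta>: "\<beta> \<in> X - orb \<alpha>"
      show "\<beta> \<in> shorts \<union> affine_long e l {\<delta>' \<in> D. cls \<delta>' \<noteq> cls \<delta>}"
      proof (cases "\<beta> \<in> shorts")
        case False
        then have "\<beta> \<in> longs" using \<beta> by blast
        then obtain s' j \<delta>' where h': "s' \<in> {-1, 1}" "j \<in> {1..l}" "\<delta>' \<in> D" "\<beta> = (2 * s') *\<^sub>R e j + \<delta>'"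
          by (rule longsE)
        have "cls \<delta>' \<noteq> cls \<delta>"
        proof
          assume "cls \<delta>' = cls \<delta>"
          then obtain x where "x \<in> L" "\<delta>' = \<delta> + 2 *\<^sub>R x" using sep[OF h(3) h'(3)] by auto
          from longs_congruent_orbit[OF h(1) h'(1) h(2) h'(2) V0_D[OF h(3)] this] show False
            using \<beta> h(4) h'(4) by simp
        qed
        then show ?thesis using h' unfolding affine_long_def by blast
      qed simp
    qed
    have in_W': "rfl ((2 * s) *\<^sub>R e k + \<delta>) \<in> W (X - orb \<alpha>)" using in_W by (simp only: h(4)[symmetric])
    show False
      by (rule long_reflection_dependency[OF h(1-3) sub in_W']) (rule nodep)
  qed
qed

end

section \<open>A relation between eight long reflections\<close>

context affine_C
begin

lemma long_rfl_apply:
  assumes "(x, f) \<in> H" "s \<in> {-1, 1}" "k \<in> {1..l}" "d \<in> V0"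
  shows "rfl ((2 * s) *\<^sub>R e k + d) (x, f)
    = (x - ((B x ((2 * s) *\<^sub>R e k) + blinfun_apply f d) / (2 * c)) *\<^sub>R ((2 * s) *\<^sub>R e k + d), f)"
proof -
  have "blinfun_apply f (e k) = 0" using assms e_dot by (simp add: H_iff)
  then show ?thesis
    unfolding refl_apply[OF assms(1)] B_long(1)[OF assms(2-4)] using rad'[OF assms(4)]
    by (simp add: B_simps blinfun.add_right blinfun.scaleR_right)
qed

text \<open>The product is a central translation: it moves \<open>x\<close> by a multiple of \<open>p \<and> r\<close>, contracted with \<open>f\<close>.
  The essential point is that \<open>a\<close> has disappeared.\<close>

lemma four_long_reflections:
  fixes s :: real and k :: nat
  defines "\<rho> d \<equiv> rfl ((2 * s) *\<^sub>R e k + d)"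
  assumes u: "(x, f) \<in> H" and s: "s \<in> {-1, 1}" "k \<in> {1..l}" and V: "a \<in> V0" "a + p \<in> V0" "a + p + r \<in> V0" "a + r \<in> V0"
  shows "\<rho> a (\<rho> (a + p) (\<rho> (a + p + r) (\<rho> (a + r) (x, f))))
    = (x - (blinfun_apply f p / (2 * c)) *\<^sub>R r + (blinfun_apply f r / (2 * c)) *\<^sub>R p, f)"
proof -
  let ?\<epsilon> = "(2 * s) *\<^sub>R e k"
  have \<epsilon>\<epsilon>: "B ?\<epsilon> ?\<epsilon> = 4 * c" using s by (auto simp: B_simps B_e)
  have H: "(y, f) \<in> H" for y using u by (simp add: H_iff)
  have step: "\<rho> d (y, f) = (y - ((b + blinfun_apply f d) / (2 * c)) *\<^sub>R (?\<epsilon> + d), f)" (is "?A")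
    and next_b: "B (y - t *\<^sub>R (?\<epsilon> + d)) ?\<epsilon> = b - 4 * c * t" (is "?B") if "B y ?\<epsilon> = b" "d \<in> V0" for y b d t
  proof -
    show ?A unfolding \<rho>_def using long_rfl_apply[OF H s that(2), of y] unfolding that(1) .
    have "B (y - t *\<^sub>R (?\<epsilon> + d)) ?\<epsilon> = B y ?\<epsilon> - t * (B ?\<epsilon> ?\<epsilon> + B d ?\<epsilon>)"
      by (simp add: B_simps algebra_simps)
    then show ?B using \<epsilon>\<epsilon> that rad[OF that(2), of ?\<epsilon>] by simp
  qed
  \<comment> \<open>The four coefficients of the subtracted roots are \<open>t1\<close>, \<open>u - t1\<close>, \<open>t1 - u - v\<close> and \<open>v - t1\<close>;
    they add up to \<open>0\<close>, which removes the multiples of \<open>\<epsilon>\<^sub>k\<close> and of \<open>a\<close>.\<close>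
  define u v t1 where "u = blinfun_apply f p / (2 * c)" and "v = blinfun_apply f r / (2 * c)"
    and "t1 = (B x ?\<epsilon> + blinfun_apply f (a + r)) / (2 * c)"
  define b where "b = B x ?\<epsilon>"
  let ?x1 = "x - t1 *\<^sub>R (?\<epsilon> + (a + r))"
  have r1: "\<rho> (a + r) (x, f) = (?x1, f)" and b1: "B ?x1 ?\<epsilon> = b - 4 * c * t1"
    using step[OF refl V(4), of x] next_b[OF refl V(4), of x t1] by (simp_all add: t1_def b_def)
  let ?x2 = "?x1 - (u - t1) *\<^sub>R (?\<epsilon> + (a + p + r))"
  have t2: "(b - 4 * c * t1 + blinfun_apply f (a + p + r)) / (2 * c) = u - t1"
    using c0 by (simp add: u_def t1_def b_def blinfun.add_right field_simps)
  have r2: "\<rho> (a + p + r) (?x1, f) = (?x2, f)"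
    using step[OF b1 V(3)] unfolding t2 .
  have "b - 4 * c * t1 - 4 * c * (u - t1) = b - 4 * c * u" by (simp add: algebra_simps)
  then have b2: "B ?x2 ?\<epsilon> = b - 4 * c * u"
    using next_b[OF b1 V(3), of "u - t1"] by (rule trans[rotated])
  let ?x3 = "?x2 - (t1 - u - v) *\<^sub>R (?\<epsilon> + (a + p))"
  have t3: "(b - 4 * c * u + blinfun_apply f (a + p)) / (2 * c) = t1 - u - v"
    using c0 by (simp add: u_def v_def t1_def b_def blinfun.add_right field_simps)
  have r3: "\<rho> (a + p) (?x2, f) = (?x3, f)"
    using step[OF b2 V(2)] unfolding t3 .
  have "b - 4 * c * u - 4 * c * (t1 - u - v) = b - 4 * c * (t1 - v)" by (simp add: algebra_simps)
  then have b3: "B ?x3 ?\<epsilon> = b - 4 * c * (t1 - v)"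
    using next_b[OF b2 V(2), of "t1 - u - v"] by (rule trans[rotated])
  let ?x4 = "?x3 - (v - t1) *\<^sub>R (?\<epsilon> + a)"
  have t4: "(b - 4 * c * (t1 - v) + blinfun_apply f a) / (2 * c) = v - t1"
    using c0 by (simp add: v_def t1_def b_def blinfun.add_right field_simps)
  have r4: "\<rho> a (?x3, f) = (?x4, f)"
    using step[OF b3 V(1)] unfolding t4 .
  have "?x4 = x - u *\<^sub>R r + v *\<^sub>R p"
    by (simp add: scaleR_add_left scaleR_diff_left scaleR_add_right algebra_simps)
  moreover have "\<rho> a (\<rho> (a + p) (\<rho> (a + p + r) (\<rho> (a + r) (x, f)))) = (?x4, f)"
    by (simp only: r1 r2 r3 r4)
  ultimately show ?thesis unfolding u_def v_def by simp
qed

text \<open>Equate the products of four reflections for \<open>a\<close> and for \<open>a + g\<close>, and cancel the involutions.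
  The eight isotropic parts run through \<open>a\<close> plus all partial sums of \<open>p, r, g\<close>.\<close>

lemma eightfold_relation:
  fixes s :: real and k :: nat
  defines "\<rho> d \<equiv> rfl ((2 * s) *\<^sub>R e k + d)"
  assumes u: "u \<in> H" and s: "s \<in> {-1, 1}" "k \<in> {1..l}"
    and L: "a \<in> L" "p \<in> L" "r \<in> L" "g \<in> L"
  shows "\<rho> a u = \<rho> (a + g) (\<rho> (a + g + p) (\<rho> (a + g + p + r) (\<rho> (a + g + r)
    (\<rho> (a + r) (\<rho> (a + p + r) (\<rho> (a + p) u))))))"
proof -
  have V: "x \<in> V0" if "x \<in> L" for x using that by (rule V0_L)
  note add = additive_group_add[OF L_group]
  have cl: "\<rho> d v \<in> H" if "v \<in> H" for d v unfolding \<rho>_def using that by (rule refl_closed)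
  have inv: "\<rho> d (\<rho> d v) = v" if "v \<in> H" "d \<in> L" for d v
    unfolding \<rho>_def using that s c0 B_long(1)[OF s V[OF that(2)]] by (intro refl_involution) simp_all
  \<comment> \<open>The factors for \<open>a + p\<close>, \<open>a + p + r\<close> and \<open>a + r\<close> of the product for \<open>a\<close> undo this composition.\<close>
  define v where "v = \<rho> (a + r) (\<rho> (a + p + r) (\<rho> (a + p) u))"
  obtain x f where xf: "v = (x, f)" by (cases v)
  have vH: "v \<in> H" unfolding v_def using u cl by blast
  have "\<rho> a (\<rho> (a + p) (\<rho> (a + p + r) (\<rho> (a + r) v)))
    = \<rho> (a + g) (\<rho> (a + g + p) (\<rho> (a + g + p + r) (\<rho> (a + g + r) v)))"
    unfolding xf \<rho>_def
    by (subst (1 2) four_long_reflections[OF vH[unfolded xf] s]) (intro V add L refl)+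
  moreover have "\<rho> (a + p) (\<rho> (a + p + r) (\<rho> (a + r) v)) = u"
    unfolding v_def using u cl inv add L by simp
  ultimately show ?thesis unfolding v_def by simp
qed

lemma long_decomposition_unique:
  assumes "(2 * s) *\<^sub>R e i + \<delta> = (2 * s') *\<^sub>R e j + \<delta>'" "s \<in> {-1, 1}" "s' \<in> {-1, 1}"
    "i \<in> {1..l}" "j \<in> {1..l}" "\<delta> \<in> V0" "\<delta>' \<in> V0"
  shows "s = s' \<and> i = j \<and> \<delta> = \<delta>'"
proof -
  have "(if i = i then 2 * s * c else 0) = (if i = j then 2 * s' * c else 0)"
    using B_long(2)[OF assms(2,4,6,4)] B_long(2)[OF assms(3,5,7,4)] assms(1) by simp
  then have "i = j" "s = s'" using assms(2) c0 by (auto split: if_splits)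
  then show ?thesis using assms(1) by simp
qed

text \<open>The orbit of \<open>2\<epsilon>\<^sub>1\<close> consists of the long roots with isotropic part in \<open>2L\<close>. By the eightfold
  relation, such a reflection is a product of seven long reflections whose isotropic parts differ from
  its own by nonempty partial sums of \<open>p, r, g\<close>. As these sums are not in \<open>2L\<close>, the seven roots lie
  outside the orbit.\<close>

lemma removable_orbit_of_independent_classes:
  assumes L: "p \<in> L" "r \<in> L" "g \<in> L" and D0: "0 \<in> D"
    and v: "\<And>v x. v \<in> {p, r, p + r, g, g + p, g + r, g + p + r} \<Longrightarrow> x \<in> L \<Longrightarrow> 2 *\<^sub>R x + v \<in> D \<and> v \<noteq> 2 *\<^sub>R x"
  shows "\<exists>\<alpha>\<in>X. W (X - orb \<alpha>) = W X"
proof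
  let ?\<alpha> = "2 *\<^sub>R e 1"
  have one: "1 \<in> {1..l}" using l3 by simp
  have "?\<alpha> = (2 * 1) *\<^sub>R e 1 + 0" by simp
  then have "?\<alpha> \<in> longs" unfolding affine_long_def using one D0 by blast
  then show "?\<alpha> \<in> X" by blast
  let ?A = "X - orb ?\<alpha>"
  have A: "\<And>\<alpha>. \<alpha> \<in> ?A \<Longrightarrow> B \<alpha> \<alpha> \<noteq> 0" "\<And>\<alpha>. \<alpha> \<in> X \<Longrightarrow> B \<alpha> \<alpha> \<noteq> 0" using B_roots by blast+
  show "W ?A = W X"
  proof
    show "W ?A \<subseteq> W X" by (rule W_subset[OF A(2) refl_in_W]) blast+
    show "W X \<subseteq> W ?A"
    proof (rule W_subset[OF A(1)])
      fix \<beta> assume \<beta>X: "\<beta> \<in> X"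
      show "rfl \<beta> \<in> W ?A"
      proof (cases "\<beta> \<in> orb ?\<alpha>")
        case False
        then show ?thesis using \<beta>X by (intro refl_in_W DiffI)
      next
        case True
        then obtain m s \<tau> where \<beta>: "m \<in> {1..l}" "s \<in> {-1, 1}" "\<tau> \<in> L" "\<beta> = (2 * s) *\<^sub>R e m + 2 *\<^sub>R \<tau>"
          using orb_long_zero_class[OF True one] by blast
        let ?\<rho> = "\<lambda>d. rfl ((2 * s) *\<^sub>R e m + d)"
        have L2: "2 *\<^sub>R x \<in> L" if "x \<in> L" for x
          using additive_group_scale[OF L_group that, of 2] by simp
        have \<rho>W: "?\<rho> (2 *\<^sub>R \<tau> + v) \<in> W ?A" if vv: "v \<in> {p, r, p + r, g, g + p, g + r, g + p + r}" for v
        proof (rule refl_in_W, rule DiffI)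
          have d: "2 *\<^sub>R \<tau> + v \<in> D" using v[OF vv \<beta>(3)] by blast
          then show "(2 * s) *\<^sub>R e m + (2 *\<^sub>R \<tau> + v) \<in> X" using \<beta>(1,2) unfolding affine_long_def by blast
          show "(2 * s) *\<^sub>R e m + (2 *\<^sub>R \<tau> + v) \<notin> orb ?\<alpha>"
          proof
            assume "(2 * s) *\<^sub>R e m + (2 *\<^sub>R \<tau> + v) \<in> orb ?\<alpha>"
            then obtain m' s' \<tau>' where h: "m' \<in> {1..l}" "s' \<in> {-1, 1}" "\<tau>' \<in> L"
              "(2 * s) *\<^sub>R e m + (2 *\<^sub>R \<tau> + v) = (2 * s') *\<^sub>R e m' + 2 *\<^sub>R \<tau>'"
              using orb_long_zero_class[OF _ one] by blast
            have "2 *\<^sub>R \<tau> + v = 2 *\<^sub>R \<tau>'"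
              using long_decomposition_unique[OF h(4) \<beta>(2) h(2) \<beta>(1) h(1) V0_D[OF d] V0_L[OF L2[OF h(3)]]]
              by blast
            then have "v = 2 *\<^sub>R (\<tau>' - \<tau>)" by (simp add: algebra_simps)
            then show False using v[OF vv additive_group_diff[OF L_group h(3) \<beta>(3)]] by blast
          qed
        qed
        let ?w = "?\<rho> (2 *\<^sub>R \<tau> + g) \<otimes>\<^bsub>G\<^esub> (?\<rho> (2 *\<^sub>R \<tau> + (g + p)) \<otimes>\<^bsub>G\<^esub> (?\<rho> (2 *\<^sub>R \<tau> + (g + p + r)) \<otimes>\<^bsub>G\<^esub>
          (?\<rho> (2 *\<^sub>R \<tau> + (g + r)) \<otimes>\<^bsub>G\<^esub> (?\<rho> (2 *\<^sub>R \<tau> + r) \<otimes>\<^bsub>G\<^esub> (?\<rho> (2 *\<^sub>R \<tau> + (p + r)) \<otimes>\<^bsub>G\<^esub> ?\<rho> (2 *\<^sub>R \<tau> + p))))))"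
        have wW: "?w \<in> W ?A" by (intro W_mult \<rho>W) simp_all
        have car: "x \<in> carrier G" if "x \<in> W ?A" for x by (rule W_carrier[OF A(1) that])
        have "rfl \<beta> = ?w"
        proof (rule GL_eqI)
          show "rfl \<beta> \<in> carrier G" by (rule refl_in_GL[OF A(2)[OF \<beta>X]])
          show "?w \<in> carrier G" by (rule car[OF wW])
          fix u assume u: "u \<in> H"
          have \<rho>c: "?\<rho> (2 *\<^sub>R \<tau> + v) \<in> carrier G" if "v \<in> {p, r, p + r, g, g + p, g + r, g + p + r}" for v
            by (rule car[OF \<rho>W[OF that]])
          have "?w u = ?\<rho> (2 *\<^sub>R \<tau> + g) (?\<rho> (2 *\<^sub>R \<tau> + (g + p)) (?\<rho> (2 *\<^sub>R \<tau> + (g + p + r))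
            (?\<rho> (2 *\<^sub>R \<tau> + (g + r)) (?\<rho> (2 *\<^sub>R \<tau> + r) (?\<rho> (2 *\<^sub>R \<tau> + (p + r)) (?\<rho> (2 *\<^sub>R \<tau> + p) u))))))"
            using u by (simp add: GL_mult_apply refl_closed G.m_closed \<rho>c)
          also have "\<dots> = rfl \<beta> u"
            using eightfold_relation[OF u \<beta>(2,1) L2[OF \<beta>(3)] L] by (simp add: \<beta>(4) add.assoc)
          finally show "rfl \<beta> u = ?w u" by simp
        qed
        then show ?thesis using wW by simp
      qed
    qed
  qed
qed

end

section \<open>The finite root system\<close>

text \<open>Reflecting \<open>2\<epsilon>\<^sub>j\<close> in \<open>2\<epsilon>\<^sub>i\<close> leaves the coefficient \<open>2\<close> of \<open>\<epsilon>\<^sub>j\<close>, and \<open>2\<epsilon>\<^sub>j\<close> is the only root with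
  that coefficient; hence \<open>\<epsilon>\<^sub>i\<close> and \<open>\<epsilon>\<^sub>j\<close> are orthogonal. Reflecting \<open>2\<epsilon>\<^sub>i\<close> in \<open>\<epsilon>\<^sub>i + \<epsilon>\<^sub>j\<close> gives
  \<open>(2 - m)\<epsilon>\<^sub>i - m\<epsilon>\<^sub>j\<close> with \<open>m = 4(\<epsilon>\<^sub>i, \<epsilon>\<^sub>i) / ((\<epsilon>\<^sub>i, \<epsilon>\<^sub>i) + (\<epsilon>\<^sub>j, \<epsilon>\<^sub>j))\<close>. The absolute values of two
  coefficients of a root add up to at most \<open>2\<close>, so \<open>m \<le> 2\<close>, and the two lengths agree by symmetry.\<close>

lemma type_C_orthogonal_basis:
  fixes B :: "'v::euclidean_space \<Rightarrow> 'v \<Rightarrow> real"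
  assumes bil: "bilinear B" and sym: "\<And>x y. B x y = B y x"
    and R: "finite_root_system_C l B U Rdot" and l: "l \<ge> 3"
  obtains e c where "0 < c"
    "\<forall>i\<in>{1..l}. \<forall>j\<in>{1..l}. B (e i) (e j) = (if i = j then c else 0)"
    "\<forall>i\<in>{1..l}. e i \<in> U"
    "Rdot = {0} \<union>
            {s *\<^sub>R e i + s' *\<^sub>R e j |s s' i j.
               s \<in> {-1, 1} \<and> s' \<in> {-1, 1} \<and> i \<in> {1..l} \<and> j \<in> {1..l} \<and> i \<noteq> j} \<union>
            {(2 * s) *\<^sub>R e i |s i. s \<in> {-1, 1} \<and> i \<in> {1..l}}"
proof -
  obtain e where e: "inj_on e {1..l}" "independent (e ` {1..l})" "span (e ` {1..l}) = U"
    and Rdot: "Rdot = {0} \<union>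
            {s *\<^sub>R e i + s' *\<^sub>R e j |s s' i j.
               s \<in> {-1, 1} \<and> s' \<in> {-1, 1} \<and> i \<in> {1..l} \<and> j \<in> {1..l} \<and> i \<noteq> j} \<union>
            {(2 * s) *\<^sub>R e i |s i. s \<in> {-1, 1} \<and> i \<in> {1..l}}"
    using R unfolding finite_root_system_C_def by blast
  note frs = R[unfolded finite_root_system_C_def finite_root_system_def, THEN conjunct1,
      THEN conjunct2, THEN conjunct2, THEN conjunct2]
  have pos: "0 < B u u" if "u \<in> U" "u \<noteq> 0" for u using frs[THEN conjunct1] that by blast
  have refl: "reflection B \<alpha> x \<in> Rdot" if "\<alpha> \<in> Rdot" "\<alpha> \<noteq> 0" "x \<in> Rdot" for \<alpha> x
    using frs[THEN conjunct2, THEN conjunct1] that by blast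
  note B_simps = bilinear_ladd[OF bil] bilinear_radd[OF bil] bilinear_lmul[OF bil] bilinear_rmul[OF bil]
  have eU: "e i \<in> U" if "i \<in> {1..l}" for i
    using span_base[OF imageI[OF that, of e]] e(3) by simp
  have e0: "e i \<noteq> 0" if "i \<in> {1..l}" for i
    using dependent_zero[of "e ` {1..l}"] imageI[OF that, of e] e(2) by metis
  have norm_pos: "0 < B (e i) (e i)" if "i \<in> {1..l}" for i using pos eU e0 that by blast
  have "\<exists>g. linear g \<and> (\<forall>i\<in>{1..l}. g (e i) = (if i = j then 1 else 0 :: real))" if "j \<in> {1..l}" for j
  proof -
    obtain g where "linear g" "\<forall>x\<in>e ` {1..l}. g x = (if x = e j then 1 else 0 :: real)"
      using linear_independent_extend[OF e(2), of "\<lambda>x. if x = e j then 1 else 0"] by blast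
    moreover have "e i = e j \<longleftrightarrow> i = j" if "i \<in> {1..l}" for i
      by (rule inj_on_eq_iff[OF e(1) that \<open>j \<in> {1..l}\<close>])
    ultimately show ?thesis by (intro exI[of _ g]) simp
  qed
  then obtain g where g: "\<And>j. j \<in> {1..l} \<Longrightarrow> linear (g j)"
    "\<And>i j. j \<in> {1..l} \<Longrightarrow> i \<in> {1..l} \<Longrightarrow> g j (e i) = (if i = j then 1 else 0 :: real)"
    by metis
  have g_short: "g j (s *\<^sub>R e p + s' *\<^sub>R e q) = (if p = j then s else 0) + (if q = j then s' else 0)"
    and g_long: "g j (t *\<^sub>R e p) = (if p = j then t else 0)"
    if "j \<in> {1..l}" "p \<in> {1..l}" "q \<in> {1..l}" for j p q s s' t
    using that g by (simp_all add: linear_add linear_scale)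
  have long_in: "2 *\<^sub>R e i \<in> Rdot" if "i \<in> {1..l}" for i
  proof -
    have "(2 * 1) *\<^sub>R e i \<in> Rdot" using that unfolding Rdot by blast
    then show ?thesis by simp
  qed
  have short_in: "e i + e j \<in> Rdot" if "i \<in> {1..l}" "j \<in> {1..l}" "i \<noteq> j" for i j
  proof -
    have "1 *\<^sub>R e i + 1 *\<^sub>R e j \<in> Rdot" using that unfolding Rdot by blast
    then show ?thesis by simp
  qed
  have eq_long: "x = 2 *\<^sub>R e j" if x: "x \<in> Rdot" "g j x = 2" and j: "j \<in> {1..l}" for x j
  proof -
    from x(1) consider "x = 0"
      | s s' p q where "s \<in> {-1, 1}" "s' \<in> {-1, 1}" "p \<in> {1..l}" "q \<in> {1..l}" "p \<noteq> q" "x = s *\<^sub>R e p + s' *\<^sub>R e q"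
      | s p where "s \<in> {-1, 1}" "p \<in> {1..l}" "x = (2 * s) *\<^sub>R e p"
      unfolding Rdot by blast
    then show ?thesis
    proof cases
      case 1
      then show ?thesis using x(2) linear_0[OF g(1)[OF j]] by simp
    next
      case 2
      then show ?thesis using x(2) g_short[OF j 2(3,4), of s s'] by (auto split: if_splits)
    next
      case 3
      then show ?thesis using x(2) g_long[OF j 3(2,2), of "2 * s"] by (auto split: if_splits)
    qed
  qed
  have two: "\<bar>g i x\<bar> + \<bar>g j x\<bar> \<le> 2" if x: "x \<in> Rdot" and ij: "i \<in> {1..l}" "j \<in> {1..l}" "i \<noteq> j" for x i j
  proof -
    from x consider "x = 0"
      | s s' p q where "s \<in> {-1, 1}" "s' \<in> {-1, 1}" "p \<in> {1..l}" "q \<in> {1..l}" "p \<noteq> q" "x = s *\<^sub>R e p + s' *\<^sub>R e q"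
      | s p where "s \<in> {-1, 1}" "p \<in> {1..l}" "x = (2 * s) *\<^sub>R e p"
      unfolding Rdot by blast
    then show ?thesis
    proof cases
      case 1
      then show ?thesis using linear_0[OF g(1)[OF ij(1)]] linear_0[OF g(1)[OF ij(2)]] by simp
    next
      case 2
      have "\<bar>s\<bar> = 1" "\<bar>s'\<bar> = 1" using 2 by auto
      then show ?thesis
        unfolding 2(6) g_short[OF ij(1) 2(3,4)] g_short[OF ij(2) 2(3,4)] using ij(3) 2(5) by auto
    next
      case 3
      have "\<bar>s\<bar> = 1" using 3 by auto
      then show ?thesis
        unfolding 3(3) g_long[OF ij(1) 3(2,2)] g_long[OF ij(2) 3(2,2)] using ij(3) by auto
    qed
  qed
  have orth: "B (e j) (e i) = 0" if ij: "i \<in> {1..l}" "j \<in> {1..l}" "i \<noteq> j" for i j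
  proof -
    let ?m = "B (2 *\<^sub>R e j) (coroot B (2 *\<^sub>R e i))"
    let ?x = "reflection B (2 *\<^sub>R e i) (2 *\<^sub>R e j)"
    have x: "?x \<in> Rdot" using ij e0 long_in by (intro refl) auto
    have xe: "?x = 2 *\<^sub>R e j + (- 2 * ?m) *\<^sub>R e i" by (simp add: reflection_def)
    have "g j ?x = 2" unfolding xe g_short[OF ij(2) ij(2) ij(1)] using ij(3) by simp
    from eq_long[OF x this ij(2)] have "?m = 0" unfolding xe using e0[OF ij(1)] by simp
    then show ?thesis using norm_pos[OF ij(1)] by (simp add: coroot_def B_simps)
  qed
  have le: "B (e i) (e i) \<le> B (e j) (e j)" if ij: "i \<in> {1..l}" "j \<in> {1..l}" "i \<noteq> j" for i j
  proof -
    let ?a = "B (e i) (e i)" and ?b = "B (e j) (e j)"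
    let ?m = "B (2 *\<^sub>R e i) (coroot B (e i + e j))"
    let ?x = "reflection B (e i + e j) (2 *\<^sub>R e i)"
    have ab: "0 < ?a" "0 < ?b" using norm_pos ij by auto
    have norm: "B (e i + e j) (e i + e j) = ?a + ?b"
      using orth[OF ij] orth[OF ij(2,1)] ij(3) by (simp add: B_simps)
    then have "e i + e j \<noteq> 0" using ab by (auto simp: bilinear_lzero[OF bil])
    then have x: "?x \<in> Rdot" using ij long_in short_in by (intro refl) auto
    have m: "?m = 4 * ?a / (?a + ?b)"
      unfolding coroot_def norm using orth[OF ij(2,1)] ij(3) by (simp add: B_simps)
    have xe: "?x = (2 - ?m) *\<^sub>R e i + (- ?m) *\<^sub>R e j"
      by (simp add: reflection_def algebra_simps)
    have "g i ?x = 2 - ?m" "g j ?x = - ?m"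
      unfolding xe g_short[OF ij(1) ij(1,2)] g_short[OF ij(2) ij(1,2)] using ij(3) by simp_all
    then have "\<bar>2 - ?m\<bar> + \<bar>- ?m\<bar> \<le> 2" using two[OF x ij] by simp
    then have "?m \<le> 2" by linarith
    then show ?thesis unfolding m using ab by (simp add: field_simps)
  qed
  have one: "1 \<in> {1..l}" using l by simp
  show thesis
  proof (rule that[OF norm_pos[OF one] _ _ Rdot]; intro ballI)
    show "e i \<in> U" if "i \<in> {1..l}" for i using that by (rule eU)
    show "B (e i) (e j) = (if i = j then B (e 1) (e 1) else 0)" if ij: "i \<in> {1..l}" "j \<in> {1..l}" for i j
    proof (cases "i = j")
      case True
      have "B (e i) (e i) = B (e 1) (e 1)"
        using le[OF ij(1) one] le[OF one ij(1)] by (cases "i = 1") auto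
      then show ?thesis using True by simp
    qed (use orth ij in auto)
  qed
qed

lemma nonisotropic_ears_C:
  fixes B :: "'v::euclidean_space \<Rightarrow> 'v \<Rightarrow> real"
  assumes bil: "bilinear B" and sym: "\<And>x y. B x y = B y x" and l: "l \<ge> 3" and c: "0 < c"
    and V0: "\<And>x y. x \<in> V0 \<Longrightarrow> B x y = 0" "subspace V0" "S1 \<subseteq> V0" "S2 \<subseteq> V0"
    and B_e: "\<And>i j. i \<in> {1..l} \<Longrightarrow> j \<in> {1..l} \<Longrightarrow> B (e i) (e j) = (if i = j then c else 0)"
    and Rdot: "Rdot = {0} \<union>
            {s *\<^sub>R e i + s' *\<^sub>R e j |s s' i j.
               s \<in> {-1, 1} \<and> s' \<in> {-1, 1} \<and> i \<in> {1..l} \<and> j \<in> {1..l} \<and> i \<noteq> j} \<union>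
            {(2 * s) *\<^sub>R e i |s i. s \<in> {-1, 1} \<and> i \<in> {1..l}}"
  shows "nonisotropic B (ears_C B Rdot S1 S2) =
    affine_short e l (S1 + zspan S2) \<union> affine_long e l ((\<lambda>x. 2 *\<^sub>R x) ` zspan S1 + S2)"
proof -
  note B_simps = bilinear_ladd[OF bil] bilinear_radd[OF bil] bilinear_lmul[OF bil] bilinear_rmul[OF bil]
    bilinear_lsub[OF bil] bilinear_rsub[OF bil] bilinear_lneg[OF bil] bilinear_rneg[OF bil]
  define Sh where "Sh = {s *\<^sub>R e i + s' *\<^sub>R e j |s s' i j.
               s \<in> {-1, 1} \<and> s' \<in> {-1, 1} \<and> i \<in> {1..l} \<and> j \<in> {1..l} \<and> i \<noteq> j}"
  define Lg where "Lg = {(2 * s) *\<^sub>R e i |s i. s \<in> {-1, 1} \<and> i \<in> {1..l}}"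
  have Rdot': "Rdot = {0} \<union> Sh \<union> Lg" unfolding Rdot Sh_def Lg_def ..
  have V0': "B y x = 0" if "x \<in> V0" for x y using V0(1) sym that by metis
  have Bsh: "B \<alpha> \<alpha> = 2 * c" if "\<alpha> \<in> Sh" for \<alpha>
    using that unfolding Sh_def by (auto simp: B_simps B_e)
  have Blg: "B \<alpha> \<alpha> = 4 * c" if "\<alpha> \<in> Lg" for \<alpha>
    using that unfolding Lg_def by (auto simp: B_simps B_e)
  have "0 \<notin> Sh" "0 \<notin> Lg" using Bsh[of 0] Blg[of 0] c bilinear_lzero[OF bil, of 0] by auto
  then have nz: "Rdot - {0} = Sh \<union> Lg" unfolding Rdot' by blast
  have ge: "2 * c \<le> B \<beta> \<beta>" "B \<beta> \<beta> \<le> 4 * c" if "\<beta> \<in> Sh \<union> Lg" for \<beta>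
    using that Bsh[of \<beta>] Blg[of \<beta>] c by auto
  have ij: "1 \<in> {1..l}" "2 \<in> {1..l}" "1 \<noteq> (2::nat)" using l by auto
  then obtain \<alpha>s \<alpha>l where ex: "\<alpha>s \<in> Sh" "\<alpha>l \<in> Lg" unfolding Sh_def Lg_def by blast
  have sh: "short_roots B Rdot = Sh"
  proof
    show "Sh \<subseteq> short_roots B Rdot"
      unfolding short_roots_def nz using Bsh ge(1) by auto
    show "short_roots B Rdot \<subseteq> Sh"
    proof
      fix \<alpha> assume "\<alpha> \<in> short_roots B Rdot"
      then have \<alpha>: "\<alpha> \<in> Sh \<union> Lg" "\<forall>\<beta>\<in>Sh \<union> Lg. B \<alpha> \<alpha> \<le> B \<beta> \<beta>" unfolding short_roots_def nz by blast+
      then have "B \<alpha> \<alpha> \<le> 2 * c" using bspec[OF \<alpha>(2) UnI1[OF ex(1)]] Bsh[OF ex(1)] by simp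
      then show "\<alpha> \<in> Sh" using \<alpha>(1) Blg[of \<alpha>] c by auto
    qed
  qed
  have lg: "long_roots B Rdot = Lg"
  proof
    show "Lg \<subseteq> long_roots B Rdot"
      unfolding long_roots_def nz using Blg ge(2) by auto
    show "long_roots B Rdot \<subseteq> Lg"
    proof
      fix \<alpha> assume "\<alpha> \<in> long_roots B Rdot"
      then have \<alpha>: "\<alpha> \<in> Sh \<union> Lg" "\<forall>\<beta>\<in>Sh \<union> Lg. B \<beta> \<beta> \<le> B \<alpha> \<alpha>" unfolding long_roots_def nz by blast+
      then have "B \<alpha> \<alpha> \<ge> 4 * c" using bspec[OF \<alpha>(2) UnI2[OF ex(2)]] Blg[OF ex(2)] by simp
      then show "\<alpha> \<in> Lg" using \<alpha>(1) Bsh[of \<alpha>] c by auto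
    qed
  qed
  have grp: "additive_group V0" using V0(2) by (simp add: additive_group_def subspace_0 subspace_diff)
  have z2: "zspan S2 \<subseteq> V0" "zspan S1 \<subseteq> V0" using zspan_minimal grp V0(3,4) by blast+
  let ?L = "S1 + zspan S2" and ?D = "(\<lambda>x. 2 *\<^sub>R x) ` zspan S1 + S2"
  have L: "?L \<subseteq> V0"
    unfolding set_plus_def using additive_group_add[OF grp] V0(3) z2(1) by blast
  have D: "?D \<subseteq> V0"
    unfolding set_plus_def using additive_group_add[OF grp] V0(4) z2(2) subspace_scale[OF V0(2)] by blast
  have short: "Sh + A = affine_short e l A" for A
    unfolding affine_short_def set_plus_def Sh_def by blast
  have long: "Lg + A = affine_long e l A" for A
    unfolding affine_long_def set_plus_def Lg_def by blast
  have iso: "B x x = 0" if x: "x \<in> ?L + ?L" for x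
  proof -
    obtain a b where "a \<in> ?L" "b \<in> ?L" "x = a + b" using x by (rule set_plus_elim)
    then have "x \<in> V0" using L additive_group_add[OF grp] by blast
    then show ?thesis by (rule V0(1))
  qed
  have Bd: "B (\<alpha> + x) (\<alpha> + x) = B \<alpha> \<alpha>" if "x \<in> V0" for \<alpha> x
    using that by (simp add: B_simps V0(1) V0')
  have nsh: "B x x \<noteq> 0" if x: "x \<in> Sh + ?L" for x
  proof -
    obtain a b where "a \<in> Sh" "b \<in> ?L" "x = a + b" using x by (rule set_plus_elim)
    then show ?thesis using subsetD[OF L, of b] Bd Bsh c by simp
  qed
  have nlg: "B x x \<noteq> 0" if x: "x \<in> Lg + ?D" for x
  proof -
    obtain a b where "a \<in> Lg" "b \<in> ?D" "x = a + b" using x by (rule set_plus_elim)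
    then show ?thesis using subsetD[OF D, of b] Bd Blg c by simp
  qed
  have "ears_C B Rdot S1 S2 = (?L + ?L) \<union> (Sh + ?L) \<union> (Lg + ?D)"
    unfolding ears_C_def Let_def sh lg ..
  then have "nonisotropic B (ears_C B Rdot S1 S2) = (Sh + ?L) \<union> (Lg + ?D)"
    unfolding nonisotropic_def using iso nsh nlg by blast
  then show ?thesis unfolding short long .
qed

section \<open>Coordinates on a semilattice\<close>

lemma independent_Un_of_trivial_Int:
  fixes E F :: "'a::euclidean_space set"
  assumes "independent E" "independent F" "span E \<inter> span F = {0}"
  shows "independent (E \<union> F)"
proof -
  have fin: "finite E" "finite F" using assms independent_imp_finite by auto
  have sp: "{x + y |x y. x \<in> span E \<and> y \<in> span F} = span (E \<union> F)"
    by (auto simp: span_Un)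
  have "dim (span (E \<union> F)) = card E + card F"
    using dim_sums_Int[of "span E" "span F"] assms by (simp add: sp dim_eq_card_independent)
  then have "card (E \<union> F) \<le> dim (span (E \<union> F))" using card_Un_le[of E F] by simp
  then show ?thesis using fin span_superset[of "E \<union> F"]
    by (intro card_le_dim_spanning[of _ "span (E \<union> F)"]) auto
qed

text \<open>With \<open>Z = Vdot \<union> V\<^sub>1\<close>, this extends the coordinates of \<open>V\<^sub>2\<close> with respect to \<open>\<sigma>\<close> by zero to the
  whole space.\<close>

lemma coordinate_functionals:
  fixes Z :: "'v::euclidean_space set" and \<sigma> :: "'i \<Rightarrow> 'v"
  assumes inj: "inj_on \<sigma> I" and indep: "independent (\<sigma> ` I)"
    and triv: "span Z \<inter> span (\<sigma> ` I) = {0}"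
  obtains lam :: "'i \<Rightarrow> 'v \<Rightarrow>\<^sub>L real" where
    "\<And>r q. r \<in> I \<Longrightarrow> q \<in> I \<Longrightarrow> blinfun_apply (lam r) (\<sigma> q) = of_bool (q = r)"
    "\<And>r z. r \<in> I \<Longrightarrow> z \<in> Z \<Longrightarrow> blinfun_apply (lam r) z = 0"
proof -
  obtain E where E: "E \<subseteq> Z" "independent E" "Z \<subseteq> span E" by (rule basis_exists)
  have spE: "span E = span Z" using E(1,3) by (meson span_eq span_superset subset_trans)
  have ind: "independent (E \<union> \<sigma> ` I)"
    using independent_Un_of_trivial_Int[OF E(2) indep] triv spE by simp
  have "\<exists>f :: 'v \<Rightarrow>\<^sub>L real. (\<forall>q\<in>I. blinfun_apply f (\<sigma> q) = of_bool (q = r)) \<and> (\<forall>z\<in>Z. blinfun_apply f z = 0)"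
    if r: "r \<in> I" for r
  proof -
    obtain g where g: "linear g" "\<forall>x\<in>E \<union> \<sigma> ` I. g x = (if x = \<sigma> r then 1 else 0 :: real)"
      using linear_independent_extend[OF ind, of "\<lambda>x. if x = \<sigma> r then 1 else 0"] by blast
    have bl: "bounded_linear g" using g(1) by (simp add: linear_conv_bounded_linear)
    have "\<sigma> r \<notin> E"
    proof
      assume "\<sigma> r \<in> E"
      then have "\<sigma> r \<in> span Z \<inter> span (\<sigma> ` I)"
        using span_base[of "\<sigma> r" E] span_base[OF imageI[OF r, of \<sigma>]] spE by simp
      then have "0 \<in> \<sigma> ` I" using triv r by (metis image_eqI singletonD)
      then show False using indep dependent_zero by blast
    qed
    then have "g x = 0" if "x \<in> E" for x using g(2) that by auto
    then have "g z = 0" if "z \<in> Z" for z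
      using linear_eq_0_on_span[OF g(1), of E z] that E(3) by blast
    moreover have "g (\<sigma> q) = of_bool (q = r)" if "q \<in> I" for q
      using g(2) that inj_on_eq_iff[OF inj that r] by auto
    ultimately show ?thesis
      by (intro exI[of _ "Blinfun g"]) (simp add: bounded_linear_Blinfun_apply[OF bl])
  qed
  then show thesis using that by metis
qed

text \<open>The setting of the theorem, with the coordinates of a \<open>\<int>\<close>-basis \<open>\<sigma>\<close> of \<open>\<langle>S\<^sub>2\<rangle>\<close> in \<open>S\<^sub>2\<close>.\<close>

locale affine_C_semilattice = affine_C_coordinates B Vdot V0 e c l L D R "{1..n}" lam
  for B :: "'v::euclidean_space \<Rightarrow> 'v \<Rightarrow> real" and Vdot V0 e c l L D R and n :: nat and lam +
  fixes \<sigma> :: "nat \<Rightarrow> 'v" and S1 S2 V2 :: "'v set"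
  assumes L_eq: "L = S1 + zspan S2" and D_eq: "D = (\<lambda>x. 2 *\<^sub>R x) ` S1 + S2"
    and S1: "additive_group S1" and S2: "semilattice_in V2 S2" and \<sigma>: "zbasis_in S2 n \<sigma>"
    and lam_S1: "\<And>r x. r \<in> {1..n} \<Longrightarrow> x \<in> S1 \<Longrightarrow> blinfun_apply (lam r) x = 0"
    and lam_\<sigma>: "\<And>r q. r \<in> {1..n} \<Longrightarrow> q \<in> {1..n} \<Longrightarrow> blinfun_apply (lam r) (\<sigma> q) = of_bool (q = r)"
begin

lemma \<sigma>_S2: "r \<in> {1..n} \<Longrightarrow> \<sigma> r \<in> S2" and \<sigma>_zspan: "zspan (\<sigma> ` {1..n}) = zspan S2"
  using \<sigma> by (simp_all add: zbasis_in_def)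

lemma zero_S2: "0 \<in> S2"
  using S2 by (simp add: semilattice_in_def)

lemma supp_finite: "finite (supp S2 n \<sigma>)" and supp_Pow: "supp S2 n \<sigma> \<subseteq> Pow {1..n}"
proof -
  show "supp S2 n \<sigma> \<subseteq> Pow {1..n}" by (auto simp: supp_def)
  then show "finite (supp S2 n \<sigma>)" by (rule finite_subset) simp
qed

lemma lam_sum_\<sigma>:
  "r \<in> {1..n} \<Longrightarrow> blinfun_apply (lam r) (\<Sum>q\<in>{1..n}. k q *\<^sub>R \<sigma> q) = k r"
  by (simp add: blinfun.sum_right blinfun.scaleR_right lam_\<sigma> if_distrib of_bool_def cong: if_cong)

text \<open>Modulo \<open>2L\<close>, an element of \<open>D\<close> is the sum of the basis vectors at which its coefficient is odd.
  This sum is in \<open>S\<^sub>2\<close> since \<open>S\<^sub>2\<close> is stable under \<open>2\<langle>S\<^sub>2\<rangle>\<close>.\<close>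

lemma class_representative:
  assumes "\<delta> \<in> D"
  shows "cls \<delta> \<in> supp S2 n \<sigma>" "\<exists>x\<in>L. \<delta> = (\<Sum>r\<in>cls \<delta>. \<sigma> r) + 2 *\<^sub>R x"
proof -
  obtain a b where ab: "a \<in> S1" "b \<in> S2" "\<delta> = 2 *\<^sub>R a + b"
    using assms unfolding D_eq by (auto elim!: set_plus_elim)
  have "b \<in> zspan (\<sigma> ` {1..n})" unfolding \<sigma>_zspan using ab(2) zspan_superset by blast
  then obtain k :: "nat \<Rightarrow> int" where k: "b = (\<Sum>r\<in>{1..n}. of_int (k r) *\<^sub>R \<sigma> r)"
    using zspan_coordinates[of "{1..n}" b \<sigma>] by auto
  have cls: "cls \<delta> = {r \<in> {1..n}. odd (k r)}"
    unfolding cls_def using ab lam_S1 k lam_sum_\<sigma>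
    by (auto simp: blinfun.add_right blinfun.scaleR_right)
  define y where "y = (\<Sum>r\<in>{1..n}. of_int (k r div 2) *\<^sub>R \<sigma> r)"
  have "y \<in> zspan S2" unfolding y_def
    by (intro additive_group_sum additive_group_scale additive_group_zspan subsetD[OF zspan_superset] \<sigma>_S2)
  have "b - 2 *\<^sub>R y = (\<Sum>r\<in>{1..n}. (of_int (k r) - 2 * of_int (k r div 2)) *\<^sub>R \<sigma> r)"
    unfolding k y_def by (simp add: scaleR_sum_right sum_subtractf scaleR_diff_left)
  also have "\<dots> = (\<Sum>r\<in>{1..n}. if odd (k r) then \<sigma> r else 0)"
  proof (rule sum.cong[OF refl])
    fix r
    have "of_int (k r) - 2 * of_int (k r div 2) = (of_int (k r mod 2) :: real)"
      by (metis minus_mult_div_eq_mod of_int_diff of_int_mult of_int_numeral)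
    then show "(of_int (k r) - 2 * of_int (k r div 2)) *\<^sub>R \<sigma> r = (if odd (k r) then \<sigma> r else 0)"
      by (auto simp: odd_iff_mod_2_eq_one even_iff_mod_2_eq_zero)
  qed
  also have "\<dots> = (\<Sum>r\<in>cls \<delta>. \<sigma> r)" unfolding cls by (rule sum.inter_filter[symmetric]) simp
  finally have b: "b - 2 *\<^sub>R y = (\<Sum>r\<in>cls \<delta>. \<sigma> r)" .
  have "b - 2 *\<^sub>R y \<in> S2" by (rule semilattice_diff_double[OF S2 ab(2) \<open>y \<in> zspan S2\<close>])
  then show "cls \<delta> \<in> supp S2 n \<sigma>" unfolding b supp_def using cls by auto
  have "a + y \<in> L" unfolding L_eq using ab(1) \<open>y \<in> zspan S2\<close> by (rule set_plus_intro)
  moreover have "\<delta> = (b - 2 *\<^sub>R y) + 2 *\<^sub>R (a + y)" by (simp add: ab(3) algebra_simps)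
  then have "\<delta> = (\<Sum>r\<in>cls \<delta>. \<sigma> r) + 2 *\<^sub>R (a + y)" unfolding b .
  ultimately show "\<exists>x\<in>L. \<delta> = (\<Sum>r\<in>cls \<delta>. \<sigma> r) + 2 *\<^sub>R x" by blast
qed

lemma congruent_if_same_class:
  assumes "\<delta> \<in> D" "\<delta>' \<in> D" "cls \<delta> = cls \<delta>'"
  shows "\<exists>x\<in>L. \<delta>' = \<delta> + 2 *\<^sub>R x"
proof -
  obtain x x' where x: "x \<in> L" "\<delta> = (\<Sum>r\<in>cls \<delta>. \<sigma> r) + 2 *\<^sub>R x" "x' \<in> L" "\<delta>' = (\<Sum>r\<in>cls \<delta>. \<sigma> r) + 2 *\<^sub>R x'"
    using class_representative(2)[OF assms(1)] class_representative(2)[OF assms(2)] assms(3) by metis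
  have "\<delta>' = \<delta> + 2 *\<^sub>R (x' - x)"
    by (subst x(2), subst x(4)) (simp add: algebra_simps)
  then show ?thesis using additive_group_diff[OF L_group x(3,1)] by blast
qed

lemma small_sets_in_supp: "insert {} ((\<lambda>r. {r}) ` {1..n}) \<subseteq> supp S2 n \<sigma>"
  using zero_S2 \<sigma>_S2 by (auto simp: supp_def)

lemma card_small_sets: "card (insert {} ((\<lambda>r. {r}) ` {1..n})) = n + 1"
proof -
  have "card ((\<lambda>r. {r}) ` {1..n}) = n" by (simp add: card_image)
  moreover have "{} \<notin> (\<lambda>r. {r}) ` {1..n}" by blast
  ultimately show ?thesis by simp
qed

lemma minimal_if_supp_small:
  assumes "card (supp S2 n \<sigma>) \<le> n + 4"
  shows "minimal_ears B Vdot R"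
proof (rule minimal_if_no_dependency)
  show "\<exists>x\<in>L. \<delta>' = \<delta> + 2 *\<^sub>R x" if "\<delta> \<in> D" "\<delta>' \<in> D" "cls \<delta> = cls \<delta>'" for \<delta> \<delta>'
    using that by (rule congruent_if_same_class)
next
  fix T assume T: "finite T" "T \<noteq> {}" "T \<subseteq> cls ` D" "even (card T)"
    and pairs: "\<And>i j. i \<in> {1..n} \<Longrightarrow> j \<in> {1..n} \<Longrightarrow> even (card {J \<in> T. i \<in> J \<and> j \<in> J})"
  let ?small = "insert {} ((\<lambda>r. {r}) ` {1..n})"
  have supp: "T \<subseteq> supp S2 n \<sigma>" using T(3) class_representative(1) by blast
  have "{J \<in> T. \<exists>i\<in>J. \<exists>j\<in>J. i \<noteq> j} \<subseteq> supp S2 n \<sigma> - ?small" using supp by auto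
  then have "card {J \<in> T. \<exists>i\<in>J. \<exists>j\<in>J. i \<noteq> j} \<le> card (supp S2 n \<sigma> - ?small)"
    using supp_finite by (intro card_mono) auto
  also have "\<dots> = card (supp S2 n \<sigma>) - (n + 1)"
    unfolding card_small_sets[symmetric] using small_sets_in_supp by (intro card_Diff_subset) auto
  also have "\<dots> \<le> 3" using assms by simp
  finally have large: "card {J \<in> T. \<exists>i\<in>J. \<exists>j\<in>J. i \<noteq> j} \<le> 3" .
  have "\<Union>T \<subseteq> {1..n}" using supp supp_Pow by blast
  from no_even_family_with_few_large_sets[OF T(1,2) this T(4) pairs large] show False .
qed

text \<open>The eightfold relation applies to \<open>\<sigma> 1, \<sigma> 2, \<sigma> 3\<close>. A nonempty partial sum has a coordinate
  \<open>1\<close> and is therefore not in \<open>2L\<close>.\<close>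

lemma not_minimal_if_supp_full:
  assumes n: "n = 3" and full: "supp S2 n \<sigma> = Pow {1..n}"
  shows "\<not> minimal_ears B Vdot R"
proof -
  have S1_0: "0 \<in> S1" using S1 by (rule additive_group_0)
  have \<sigma>L: "\<sigma> r \<in> L" if "r \<in> {1..n}" for r
  proof -
    have "0 + \<sigma> r \<in> S1 + zspan S2"
      using S1_0 \<sigma>_S2[OF that] zspan_superset[of S2] by (intro set_plus_intro) auto
    then show ?thesis by (simp add: L_eq)
  qed
  have "(2::real) *\<^sub>R 0 + 0 \<in> D" unfolding D_eq using S1_0 zero_S2 by (intro set_plus_intro imageI)
  then have D0: "0 \<in> D" by simp
  have sum: "2 *\<^sub>R x + v \<in> D \<and> v \<noteq> 2 *\<^sub>R x"
    if J: "J \<subseteq> {1..n}" "J \<noteq> {}" "v = (\<Sum>r\<in>J. \<sigma> r)" and x: "x \<in> L" for J v x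
  proof
    obtain a y where ay: "a \<in> S1" "y \<in> zspan S2" "x = a + y"
      using x unfolding L_eq by (rule set_plus_elim)
    have "v \<in> S2" using full J by (auto simp: supp_def)
    then have "v + 2 *\<^sub>R y \<in> S2" using ay(2) by (rule semilattice_add_double[OF S2])
    then have "2 *\<^sub>R a + (v + 2 *\<^sub>R y) \<in> D" unfolding D_eq using ay(1) by (intro set_plus_intro imageI)
    then show "2 *\<^sub>R x + v \<in> D" by (simp add: ay(3) algebra_simps)
    show "v \<noteq> 2 *\<^sub>R x"
    proof
      assume v: "v = 2 *\<^sub>R x"
      obtain r where r: "r \<in> J" using J(2) by blast
      then have rn: "r \<in> {1..n}" using J(1) by blast
      have "blinfun_apply (lam r) v = (\<Sum>q\<in>J. of_bool (q = r))"
        unfolding J(3) blinfun.sum_right using J(1) rn lam_\<sigma> by (intro sum.cong) auto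
      also have "\<dots> = 1" using r J(1) finite_subset[OF J(1)] by (simp add: of_bool_def)
      finally have "2 * blinfun_apply (lam r) x = 1" unfolding v by (simp add: blinfun.scaleR_right)
      moreover obtain z where "blinfun_apply (lam r) x = of_int z" using lam_L[OF rn x] by (rule Ints_cases)
      ultimately have "real_of_int (2 * z) = of_int 1" by simp
      then have "2 * z = 1" by (simp only: of_int_eq_iff)
      then show False by presburger
    qed
  qed
  have three: "1 \<in> {1..n}" "2 \<in> {1..n}" "3 \<in> {1..n}" using n by auto
  have "\<exists>\<alpha>\<in>X. W (X - orb \<alpha>) = W X"
  proof (rule removable_orbit_of_independent_classes[OF \<sigma>L[OF three(1)] \<sigma>L[OF three(2)] \<sigma>L[OF three(3)] D0])
    fix v x assume v: "v \<in> {\<sigma> 1, \<sigma> 2, \<sigma> 1 + \<sigma> 2, \<sigma> 3, \<sigma> 3 + \<sigma> 1, \<sigma> 3 + \<sigma> 2, \<sigma> 3 + \<sigma> 1 + \<sigma> 2}" and x: "x \<in> L"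
    have "\<exists>J\<in>{{1}, {2}, {1, 2}, {3}, {3, 1}, {3, 2}, {3, 1, 2}}. v = sum \<sigma> J"
      using v by (auto simp: add.assoc)
    then obtain J where J: "J \<in> {{1}, {2}, {1, 2}, {3}, {3, 1}, {3, 2}, {3, 1, 2}}" "v = sum \<sigma> J" ..
    have "J \<subseteq> {1..n}" "J \<noteq> {}" using J(1) three by auto
    then show "2 *\<^sub>R x + v \<in> D \<and> v \<noteq> 2 *\<^sub>R x" using J(2) x by (rule sum)
  qed
  then show ?thesis unfolding minimal_ears_def weyl_group_def roots by blast
qed

end

section \<open>Minimality\<close>

theorem corollary38:
  fixes B :: "'v::euclidean_space \<Rightarrow> 'v \<Rightarrow> real"
    and Vdot V0 V1 V2 Rdot S1 S2 R :: "'v set"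
    and l \<nu> t :: nat
  assumes "l \<ge> 3"
    and "bilinear B" and "\<And>x y. B x y = B y x" and "\<And>x. 0 \<le> B x x"
    and "subspace Vdot" and "subspace V0" and "subspace V1" and "subspace V2"
    and "Vdot + V0 = UNIV" and "Vdot \<inter> V0 = {0}"
    and "V0 = {x. \<forall>y. B x y = 0}"
    and "V1 + V2 = V0" and "V1 \<inter> V2 = {0}"
    and "t \<le> \<nu>" and "dim V1 = t" and "dim V2 = \<nu> - t"
    and "finite_root_system_C l B Vdot Rdot"
    and "lattice_in V1 S1" and "semilattice_in V2 S2"
    and "R = ears_C B Rdot S1 S2"
  shows "(int (ind S2) - (int \<nu> - int t) \<le> 3 \<or> (\<nu> - t \<le> 3 \<and> ind S2 \<noteq> 7)
            \<longrightarrow> minimal_ears B Vdot R) \<and>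
         (\<nu> - t \<le> 3 \<longrightarrow> (minimal_ears B Vdot R \<longleftrightarrow> ind S2 \<noteq> 7))"
proof -
  note S2 = \<open>semilattice_in V2 S2\<close>
  have S1: "semilattice_in V1 S1" "zspan S1 = S1"
    using \<open>lattice_in V1 S1\<close> by (simp_all add: lattice_in_def)
  have S1_group: "additive_group S1" using additive_group_zspan[of S1] S1(2) by simp
  have rad: "\<And>x y. x \<in> V0 \<Longrightarrow> B x y = 0" using \<open>V0 = _\<close> by blast
  have V12: "V1 \<subseteq> V0" "V2 \<subseteq> V0"
  proof -
    have "x + 0 \<in> V1 + V2" if "x \<in> V1" for x
      using that subspace_0[OF \<open>subspace V2\<close>] by (rule set_plus_intro)
    moreover have "0 + x \<in> V1 + V2" if "x \<in> V2" for x
      using subspace_0[OF \<open>subspace V1\<close>] that by (rule set_plus_intro)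
    ultimately show "V1 \<subseteq> V0" "V2 \<subseteq> V0" using \<open>V1 + V2 = V0\<close> by auto
  qed
  have S1_V1: "S1 \<subseteq> V1" using S1(1) span_superset[of S1] by (simp add: semilattice_in_def)
  have S2_V2: "S2 \<subseteq> V2" using S2 span_superset[of S2] by (simp add: semilattice_in_def)
  have V0_group: "additive_group V0"
    using \<open>subspace V0\<close> by (simp add: additive_group_def subspace_0 subspace_diff)
  obtain e c where c0: "0 < c"
    and "\<forall>i\<in>{1..l}. \<forall>j\<in>{1..l}. B (e i) (e j) = (if i = j then c else 0)"
    and "\<forall>i\<in>{1..l}. e i \<in> Vdot"
    and Rdot: "Rdot = {0} \<union>
            {s *\<^sub>R e i + s' *\<^sub>R e j |s s' i j.
               s \<in> {-1, 1} \<and> s' \<in> {-1, 1} \<and> i \<in> {1..l} \<and> j \<in> {1..l} \<and> i \<noteq> j} \<union>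
            {(2 * s) *\<^sub>R e i |s i. s \<in> {-1, 1} \<and> i \<in> {1..l}}"
    by (rule type_C_orthogonal_basis[OF assms(2,3,17,1)])
  then have B_e: "\<And>i j. i \<in> {1..l} \<Longrightarrow> j \<in> {1..l} \<Longrightarrow> B (e i) (e j) = (if i = j then c else 0)"
    and e_dot: "\<And>i. i \<in> {1..l} \<Longrightarrow> e i \<in> Vdot" by blast+
  obtain n \<sigma> where \<sigma>: "zbasis_in S2 n \<sigma>" and ind: "ind S2 = card (supp S2 n \<sigma>) - 1"
    by (rule ind_eq_card_supp[OF S2])
  have n: "n = \<nu> - t" using zbasis_real_basis(1)[OF S2 \<sigma>] \<open>dim V2 = \<nu> - t\<close> by simp
  have "span (Vdot \<union> V1) \<inter> V2 \<subseteq> {0}"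
  proof
    fix x assume x: "x \<in> span (Vdot \<union> V1) \<inter> V2"
    have sp: "span Vdot = Vdot" "span V1 = V1" using assms(5,7) span_eq_iff by blast+
    then obtain d v where dv: "d \<in> Vdot" "v \<in> V1" "x = d + v"
      using x unfolding span_Un sp by blast
    have "x - v \<in> V0" using x dv(2) V12 additive_group_diff[OF V0_group] by blast
    then have "d \<in> Vdot \<inter> V0" using dv by simp
    then have "d = 0" using \<open>Vdot \<inter> V0 = {0}\<close> by blast
    then have "x \<in> V1 \<inter> V2" using dv x by simp
    then show "x \<in> {0}" using \<open>V1 \<inter> V2 = {0}\<close> by simp
  qed
  then have "span (Vdot \<union> V1) \<inter> span (\<sigma> ` {1..n}) = {0}"
    unfolding zbasis_real_basis(4)[OF S2 \<sigma>] using span_zero subspace_0[OF \<open>subspace V2\<close>] by blast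
  from coordinate_functionals[OF zbasis_real_basis(2,3)[OF S2 \<sigma>] this]
  obtain lam :: "nat \<Rightarrow> 'v \<Rightarrow>\<^sub>L real" where
    lam_\<sigma>: "\<And>r q. r \<in> {1..n} \<Longrightarrow> q \<in> {1..n} \<Longrightarrow> blinfun_apply (lam r) (\<sigma> q) = of_bool (q = r)"
    and lam_0: "\<And>r z. r \<in> {1..n} \<Longrightarrow> z \<in> Vdot \<union> V1 \<Longrightarrow> blinfun_apply (lam r) z = 0"
    by metis
  define L where "L = S1 + zspan S2"
  define D where "D = (\<lambda>x. 2 *\<^sub>R x) ` S1 + S2"
  interpret affine_C_semilattice B Vdot V0 e c l L D R n lam \<sigma> S1 S2 V2
  proof
    show "additive_group L"
    proof (rule additive_groupI)
      have "0 + 0 \<in> L" unfolding L_def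
        by (intro set_plus_intro additive_group_0 S1_group additive_group_zspan)
      then show "0 \<in> L" by simp
    next
      fix x y assume "x \<in> L" "y \<in> L"
      then obtain a b a' b' where h: "a \<in> S1" "b \<in> zspan S2" "x = a + b" "a' \<in> S1" "b' \<in> zspan S2" "y = a' + b'"
        unfolding L_def by (metis set_plus_elim)
      have "(a - a') + (b - b') \<in> L" unfolding L_def
        using h by (intro set_plus_intro additive_group_diff S1_group additive_group_zspan)
      then show "x - y \<in> L" using h by (simp add: algebra_simps)
    qed
    have "zspan S2 \<subseteq> V0" using S2_V2 V12(2) by (intro zspan_minimal V0_group) blast
    then show "L \<subseteq> V0" unfolding L_def set_plus_def
      using S1_V1 V12(1) additive_group_add[OF V0_group] by blast
    have S1_2: "2 *\<^sub>R a \<in> S1" if "a \<in> S1" for a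
      using additive_group_scale[OF S1_group that, of 2] by simp
    show "D \<subseteq> L" unfolding D_def L_def set_plus_def using S1_2 zspan_superset[of S2] by blast
    show "d + 2 *\<^sub>R x \<in> D" if dx: "d \<in> D" "x \<in> L" for d x
    proof -
      obtain a b where ab: "a \<in> S1" "b \<in> S2" "d = 2 *\<^sub>R a + b"
        using dx(1) unfolding D_def by (auto elim!: set_plus_elim)
      obtain a' b' where ab': "a' \<in> S1" "b' \<in> zspan S2" "x = a' + b'"
        using dx(2) unfolding L_def by (rule set_plus_elim)
      have "2 *\<^sub>R (a + a') + (b + 2 *\<^sub>R b') \<in> D" unfolding D_def
        using ab ab' by (intro set_plus_intro imageI additive_group_add S1_group
            semilattice_add_double[OF S2])
      then show ?thesis by (simp add: ab(3) ab'(3) algebra_simps)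
    qed
    show "nonisotropic B R = affine_short e l L \<union> affine_long e l D"
      unfolding \<open>R = _\<close> L_def D_def
      using nonisotropic_ears_C[OF assms(2,3,1) c0 rad \<open>subspace V0\<close> _ _ B_e Rdot, of S1 S2]
        S1_V1 S2_V2 V12 S1(2) by auto
    show "blinfun_apply (lam i) x \<in> \<int>" if i: "i \<in> {1..n}" and x: "x \<in> L" for i x
    proof -
      obtain a b where ab: "a \<in> S1" "b \<in> zspan S2" "x = a + b"
        using x unfolding L_def by (rule set_plus_elim)
      have "zspan (\<sigma> ` {1..n}) = zspan S2" using \<sigma> by (simp add: zbasis_in_def)
      then obtain k :: "nat \<Rightarrow> int" where k: "b = (\<Sum>r\<in>{1..n}. of_int (k r) *\<^sub>R \<sigma> r)"
        using zspan_coordinates[of "{1..n}" b \<sigma>] ab(2) by auto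
      have "blinfun_apply (lam i) x = (\<Sum>r\<in>{1..n}. of_int (k r) * of_bool (r = i))"
        using ab(1,3) S1_V1 i lam_0 lam_\<sigma>
        by (auto simp: k blinfun.add_right blinfun.sum_right blinfun.scaleR_right subset_iff)
      also have "\<dots> \<in> \<int>" by (intro Ints_sum Ints_mult) auto
      finally show ?thesis .
    qed
  qed (use assms(1-3) rad c0 B_e e_dot lam_0 lam_\<sigma> S1_V1 S1_group S2 \<sigma> in \<open>auto simp: L_def D_def\<close>)
  have "card (supp S2 n \<sigma>) \<ge> n + 1"
    using card_mono[OF supp_finite small_sets_in_supp] card_small_sets by simp
  then have card: "card (supp S2 n \<sigma>) = ind S2 + 1" using ind by simp
  have card_le: "card (supp S2 n \<sigma>) \<le> 2 ^ n"
    using card_mono[OF _ supp_Pow] by (simp add: card_Pow)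
  have minimal: "minimal_ears B Vdot R" if "ind S2 \<le> n + 3"
    using that card by (intro minimal_if_supp_small) simp
  \<comment> \<open>For \<open>n \<le> 2\<close> the bound \<open>2\<^sup>n - 1 \<le> n + 3\<close> suffices, and for \<open>n = 3\<close> it only leaves the value \<open>7\<close>.\<close>
  have n_cases: "n = 0 \<or> n = 1 \<or> n = 2 \<or> n = 3" if "n \<le> 3" using that by auto
  have small: "ind S2 \<le> n + 3" if "n \<le> 3" "ind S2 \<noteq> 7"
    using n_cases[OF that(1)] that(2) card card_le by auto
  have not_minimal: "\<not> minimal_ears B Vdot R" if "n \<le> 3" "ind S2 = 7"
  proof (rule not_minimal_if_supp_full)
    show "n = 3" using n_cases[OF that(1)] that(2) card card_le by auto
    then show "supp S2 n \<sigma> = Pow {1..n}"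
      using card that(2) by (intro card_subset_eq supp_Pow) (simp_all add: card_Pow)
  qed
  have "int (ind S2) - (int \<nu> - int t) \<le> 3 \<longleftrightarrow> ind S2 \<le> n + 3"
    using n \<open>t \<le> \<nu>\<close> by linarith
  then show ?thesis using minimal small not_minimal unfolding n[symmetric] by blast
qed

end
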